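(* Let $G_n$ be the random geometric graph described in the context and $\omega$ denote clique number. Then: 1. If $nr^d\le n^{-\alpha}$ for some fixed $\alpha>0$, then with probability one $\omega(G_n)\in\{k(n),k(n)+1\}$ for all but finitely many $n$, where $k(n):=\left\lfloor\frac{\ln n}{\ln(1/(nr^d))}+\frac12\right\rfloor$. 2. If $n^{-\varepsilon}\ll nr^d\ll\ln n$ for every fixed $\varepsilon>0$, then $\omega(G_n)\big/\left(\ln n/\ln\left(\frac{\ln n}{nr^d}\right)\right)\to1$ almost surely. 3. If $\frac{\sigma nr^d}{\ln n}\to t\in(0,\infty)$, then $\frac{\omega(G_n)}{\sigma nr^d}\to f_\omega(t)$ almost surely, where $f_\omega(t)$ is the unique $f\ge \mathrm{vol}(B)/2^d$ solving $H\!\left(\frac{f\,2^d}{\mathrm{vol}(B)}\right)=\frac{2^d}{t\,\mathrm{vol}(B)}$, with $H(x)=x\ln x-x+1$. The function $f_\omega$ is continuous and strictly decreasing, $f_\omega(t)\to\mathrm{vol}(B)/2^d$ as $t\to\infty$ and $f_\omega(t)\to\infty$ as $t\downarrow0$. 4. If $nr^d\gg\ln n$ (and $r\to0$), then $\frac{\omega(G_n)}{\sigma nr^d}\to\frac{\mathrm{vol}(B)}{2^d}$ almost surely.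
   Context: Standing setup: $d\ge1$ is fixed and $\|\cdot\|$ is a fixed norm on $\mathbb R^d$; $B=\{x:\|x\|<1\}$; $\mathrm{vol}$ is Lebesgue measure. $\nu$ is a probability distribution on $\mathbb R^d$ with a bounded density $f$, and $\sigma:=\sup\{s:\mathrm{vol}(\{x:f(x)>s\})>0\}$. $X_1,X_2,\dots$ are i.i.d. with law $\nu$; $r=r(n)>0$ with $r(n)\to0$. $G_n$ has vertex set $\{1,\dots,n\}$, with $i\ne j$ adjacent iff $\|X_i-X_j\|\le r(n)$. *)

theory Defs
  imports "HOL-Probability.Probability" "HOL-Library.Landau_Symbols"
begin

definition is_norm :: "('a::real_vector \<Rightarrow> real) \<Rightarrow> bool" where
  "is_norm N \<longleftrightarrow> (\<forall>x. N x = 0 \<longleftrightarrow> x = 0) \<and> (\<forall>x y. N (x + y) \<le> N x + N y)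
     \<and> (\<forall>c x. N (c *\<^sub>R x) = \<bar>c\<bar> * N x)"

definition ess_sup_dens :: "('a::euclidean_space \<Rightarrow> real) \<Rightarrow> real" where
  "ess_sup_dens f = Sup {s. emeasure lborel {x. s < f x} > 0}"

definition geom_clique_number ::
    "('a::real_vector \<Rightarrow> real) \<Rightarrow> real \<Rightarrow> (nat \<Rightarrow> 'a) \<Rightarrow> nat \<Rightarrow> nat" where
  "geom_clique_number N rho p n =
     Max {card S | S. S \<subseteq> {1..n} \<and> (\<forall>i\<in>S. \<forall>j\<in>S. i \<noteq> j \<longrightarrow> N (p i - p j) \<le> rho)}"

definition Hfun :: "real \<Rightarrow> real" where
  "Hfun x = x * ln x - x + 1"

definition f_omega :: "real \<Rightarrow> nat \<Rightarrow> real \<Rightarrow> real" where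
  "f_omega vB d t = (THE f. f \<ge> vB / 2 ^ d \<and> Hfun (f * 2 ^ d / vB) = 2 ^ d / (t * vB))"

end

theory Submission
  imports Defs "HOL-Real_Asymp.Real_Asymp"
begin

text \<open>
  Upper bounds. Discretise space at scale \<open>\<delta> r\<close>. A clique containing the point \<open>X j\<close> lies in one of
  boundedly many unions of cells around the cell of \<open>X j\<close>; such a union has diameter at most
  \<open>(1 + \<epsilon>) r\<close>, so by the isodiametric inequality (the equal-volume case of Brunn-Minkowski, applied
  to \<open>A\<close> and \<open>-A\<close>) its mass is at most \<open>\<sigma> vol(B) ((1 + \<epsilon>) r / 2)^d\<close>, and a Chernoff bound applies.
  Looking only at cliques whose largest index is \<open>j\<close>, with a radius nonincreasing in \<open>j\<close>, makes the
  probabilities summable, and Borel-Cantelli gives the almost sure statement for all \<open>n\<close> at once.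

  Lower bounds. Where \<open>f\<close> is close to \<open>\<sigma>\<close> one can pack about \<open>r^(-d)\<close> disjoint balls of diameter \<open>r\<close>,
  each of mass at least \<open>(1 - \<epsilon>) \<sigma> vol(B) (r / 2)^d\<close>. Exposing the balls one after the other, each is
  full with conditional probability at least \<open>q\<close>, so none is full with probability at most
  \<open>(1 - q)^m\<close>, which is summable in every regime.
\<close>

section \<open>Brunn-Minkowski for equal volumes\<close>

text \<open>The thresholds balance the number of places, of order \<open>r^(-d)\<close>, against the
  cost of crowding one. A ball of diameter \<open>r\<close> has mean occupation \<open>m\<close>
  about \<open>\<sigma> vol(B) n (r / 2)^d\<close>, and reaching \<open>x m\<close> costs about
  \<open>exp (- m H(x))\<close>. For \<open>m\<close> of order \<open>ln n\<close> this balance is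
  the equation for \<open>f_omega\<close>; for \<open>m\<close> much larger every fixed excess
  \<open>x > 1\<close> is too costly. For small \<open>y = n r^d\<close>, \<open>l\<close> further
  points near a given one cost about \<open>y^l\<close>, and \<open>n y^l = 1\<close> gives
  \<open>l = ln n / ln (1 / y)\<close>.

  The obstacle is the step from probability to almost sure: just above the threshold a union bound
  over \<open>n\<close> points leaves a small negative power of \<open>n\<close>, not summable, and
  \<open>r\<close> need not be monotone. The event that point \<open>j\<close> completes an
  oversized clique gains a factor \<open>1 / j\<close>, which makes it summable; its radius must
  depend on \<open>j\<close> rather than on \<open>r\<close>, and monotonicity carries the bound
  from \<open>j\<close> to all later \<open>n\<close>.

  Brunn-Minkowski is needed only for finite unions of grid cubes and their reflections. These have
  equal volume and are covered by the Hadwiger-Ohmann induction on boxes, in which equality of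
  volumes is preserved by every cut.\<close>

definition box_family :: "'a::euclidean_space set set \<Rightarrow> bool" where
  "box_family \<A> \<longleftrightarrow> finite \<A> \<and> disjoint \<A> \<and> (\<forall>Q\<in>\<A>. Q \<noteq> {} \<and> (\<exists>a b. Q = box a b))"

lemma box_family_open: "box_family \<A> \<Longrightarrow> open (\<Union>\<A>)"
  unfolding box_family_def by (metis open_Union open_box)

lemma box_family_bounded: "box_family \<A> \<Longrightarrow> bounded (\<Union>\<A>)"
  unfolding box_family_def by (metis bounded_Union bounded_box)

lemma emeasure_lborel_bounded_finite: "bounded S \<Longrightarrow> emeasure lborel S \<noteq> \<infinity>"
  using emeasure_bounded_finite[of S] by auto

lemma box_Int_halfspace:
  fixes a b :: "'a::euclidean_space"
  assumes i: "i \<in> Basis"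
  shows "box a b \<inter> {x. x \<bullet> i < c} = box a (b + (min (b \<bullet> i) c - b \<bullet> i) *\<^sub>R i)"
    and "box a b \<inter> {x. x \<bullet> i > c} = box (a + (max (a \<bullet> i) c - a \<bullet> i) *\<^sub>R i) b"
proof -
  have "(b + (min (b \<bullet> i) c - b \<bullet> i) *\<^sub>R i) \<bullet> j = (if j = i then min (b \<bullet> i) c else b \<bullet> j)"
       "(a + (max (a \<bullet> i) c - a \<bullet> i) *\<^sub>R i) \<bullet> j = (if j = i then max (a \<bullet> i) c else a \<bullet> j)"
    if "j \<in> Basis" for j
    using i that by (auto simp: inner_add_left inner_Basis)
  then show "box a b \<inter> {x. x \<bullet> i < c} = box a (b + (min (b \<bullet> i) c - b \<bullet> i) *\<^sub>R i)"
    and "box a b \<inter> {x. x \<bullet> i > c} = box (a + (max (a \<bullet> i) c - a \<bullet> i) *\<^sub>R i) b"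
    using i by (simp_all add: set_eq_iff mem_box) (metis min_less_iff_conj max_less_iff_conj)+
qed

text \<open>Each box leaves at most one piece and empty pieces are dropped, so the cardinality of a
  cut family counts real pieces. The induction below runs on that cardinality.\<close>

lemma box_family_cut:
  assumes "box_family \<A>" "i \<in> Basis" "H = {x. x \<bullet> i < c} \<or> H = {x. x \<bullet> i > c}"
  shows "box_family ((\<lambda>Q. Q \<inter> H) ` \<A> - {{}})"
proof -
  have "\<exists>a b. Q \<inter> H = box a b" if "Q \<in> \<A>" for Q
    using assms that box_Int_halfspace[OF assms(2)] unfolding box_family_def by metis
  moreover have "disjoint ((\<lambda>Q. Q \<inter> H) ` \<A> - {{}})"
    using assms(1) unfolding box_family_def disjoint_def by blast
  ultimately show ?thesis
    using assms(1) unfolding box_family_def by auto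
qed

text \<open>Only the hyperplane is lost, a null set. Both halves are open so that pieces of open
  boxes are again open boxes.\<close>

lemma measure_split_hyperplane:
  fixes S :: "'a::euclidean_space set"
  assumes "open S" "bounded S" "i \<in> Basis"
  shows "measure lborel S = measure lborel (S \<inter> {x. x \<bullet> i < c}) + measure lborel (S \<inter> {x. x \<bullet> i > c})"
proof -
  have S: "S \<in> sets borel" using assms(1) by simp
  have "i \<noteq> 0" using assms by auto
  then have "negligible {x. x \<bullet> i = c}"
    using negligible_hyperplane[of i c] by (simp add: inner_commute)
  then have "{x. x \<bullet> i = c} \<in> null_sets lborel"
    unfolding negligible_iff_null_sets by (simp add: null_sets_completion_iff)
  then have null: "AE x in lborel. x \<bullet> i \<noteq> c"
    by (intro AE_I'[of "{x. x \<bullet> i = c}"]) auto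
  have fin: "emeasure lborel (S \<inter> T) \<noteq> \<infinity>" for T
    using emeasure_lborel_bounded_finite[of "S \<inter> T"] assms(2) by (meson Int_lower1 bounded_subset)
  have "measure lborel S = measure lborel (S \<inter> {x. x \<bullet> i < c} \<union> S \<inter> {x. x \<bullet> i > c})"
    by (rule measure_eq_AE) (use null S in \<open>auto elim!: eventually_mono\<close>)
  also have "\<dots> = measure lborel (S \<inter> {x. x \<bullet> i < c}) + measure lborel (S \<inter> {x. x \<bullet> i > c})"
    by (rule measure_Union) (use fin S in auto)
  finally show ?thesis .
qed

text \<open>The volume below height \<open>c\<close> is Lipschitz in \<open>c\<close>, since a slab
  of the bounded set \<open>S\<close> fits into a box of fixed cross section. The intermediate value
  theorem does the rest.\<close>

lemma hyperplane_prescribed_volume: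
  fixes S :: "'a::euclidean_space set"
  assumes S: "open S" "bounded S" "i \<in> Basis" and v: "0 \<le> v" "v \<le> measure lborel S"
  obtains c where "measure lborel (S \<inter> {x. x \<bullet> i < c}) = v"
proof -
  define m where "m c = measure lborel (S \<inter> {x. x \<bullet> i < c})" for c
  obtain K where K: "K > 0" "\<And>x. x \<in> S \<Longrightarrow> norm x \<le> K"
    using S(2) bounded_pos by metis
  have coord: "\<bar>x \<bullet> b\<bar> \<le> K" if "x \<in> S" "b \<in> Basis" for x b
    using K(2)[OF that(1)] Basis_le_norm[OF that(2), of x] by linarith
  have [measurable]: "S \<in> sets lborel" "{x. x \<bullet> i < c} \<in> sets lborel" for c
    using S(1) by (auto intro!: borel_open open_halfspace_component_lt)
  have fin: "emeasure lborel (S \<inter> T) \<noteq> \<infinity>" for T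
    using emeasure_lborel_bounded_finite[of "S \<inter> T"] S(2) by (meson Int_lower1 bounded_subset)
  \<comment> \<open>The volume of a cross section orthogonal to \<open>i\<close> of the cube of
    half-side \<open>K\<close>.\<close>
  define D where "D = (2 * K) ^ (DIM('a) - 1)"
  have lip: "\<bar>m c' - m c\<bar> \<le> D * \<bar>c' - c\<bar>" if "c \<le> c'" for c c'
  proof -
    define l where "l = (-K) *\<^sub>R One + (c + K) *\<^sub>R i"
    define u where "u = K *\<^sub>R One + (c' - K) *\<^sub>R i"
    have lu: "l \<bullet> b = (if b = i then c else -K)" "u \<bullet> b = (if b = i then c' else K)" if "b \<in> Basis" for b
      using that S(3) by (auto simp: l_def u_def inner_simps inner_Basis)
    have "m c' - m c = measure lborel (S \<inter> {x. x \<bullet> i < c'} - S \<inter> {x. x \<bullet> i < c})"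
      unfolding m_def using that fin[of "{x. x \<bullet> i < c'}"]
      by (subst measure_Diff) auto
    also have "\<dots> \<le> measure lborel (cbox l u)"
    proof (rule measure_mono_fmeasurable)
      show "S \<inter> {x. x \<bullet> i < c'} - S \<inter> {x. x \<bullet> i < c} \<subseteq> cbox l u"
      proof
        fix x assume x: "x \<in> S \<inter> {x. x \<bullet> i < c'} - S \<inter> {x. x \<bullet> i < c}"
        then have "l \<bullet> b \<le> x \<bullet> b \<and> x \<bullet> b \<le> u \<bullet> b" if "b \<in> Basis" for b
          using lu[OF that] coord[of x b] that by (auto simp: abs_le_iff)
        then show "x \<in> cbox l u" by (simp add: mem_box)
      qed
    qed auto
    also have "\<dots> = (\<Prod>b\<in>Basis. (u - l) \<bullet> b)"
      by (subst measure_lborel_cbox_eq) (use lu K that in auto)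
    also have "\<dots> = (c' - c) * (\<Prod>b\<in>Basis - {i}. (u - l) \<bullet> b)"
      by (subst prod.remove[of _ i]) (use S(3) lu in \<open>auto simp: inner_simps\<close>)
    also have "(\<Prod>b\<in>Basis - {i}. (u - l) \<bullet> b) = (\<Prod>b\<in>Basis - {i}. 2 * K)"
      by (rule prod.cong) (auto simp: lu inner_simps)
    also have "\<dots> = D"
      using S(3) by (simp add: D_def)
    finally have "m c' - m c \<le> D * \<bar>c' - c\<bar>" using that by (simp add: mult.commute)
    moreover have "m c \<le> m c'"
      unfolding m_def using that fin[of "{x. x \<bullet> i < c'}"] 
      by (intro measure_mono_fmeasurable) (auto simp: fmeasurable_def less_top)
    ultimately show ?thesis by simp
  qed
  have "D \<ge> 0" using K by (simp add: D_def)
  have lip': "dist (m x) (m y) \<le> D * dist x y" for x y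
    using lip[of x y] lip[of y x] by (cases "x \<le> y") (auto simp: dist_real_def abs_minus_commute)
  have cont: "continuous_on UNIV m"
  proof (rule lipschitz_on_continuous_on)
    show "D-lipschitz_on UNIV m" using lip' \<open>D \<ge> 0\<close> by (auto intro: lipschitz_onI)
  qed
  \<comment> \<open>The upper end is \<open>K + 1\<close> because the half-space is strict and a
    coordinate of a point of \<open>S\<close> may equal \<open>K\<close>.\<close>
  have "S \<inter> {x. x \<bullet> i < - K} = {}" "S \<inter> {x. x \<bullet> i < K + 1} = S"
    using coord[OF _ S(3)] by (auto simp: set_eq_iff abs_le_iff not_less) (smt (verit) coord S(3))+
  then have "m (-K) = 0" "m (K + 1) = measure lborel S" by (auto simp: m_def)
  then have "\<exists>c\<ge>-K. c \<le> K + 1 \<and> m c = v"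
    using IVT'[of m "-K" v "K+1"] v K continuous_on_subset[OF cont] by auto
  then show ?thesis using that unfolding m_def by blast
qed

lemma sqrt_prod: "sqrt (\<Prod>i\<in>A. f i) = (\<Prod>i\<in>A. sqrt (f i))"
  by (induction A rule: infinite_finite_induct) (auto simp: real_sqrt_mult)

lemma bounded_set_sum:
  fixes A B :: "'a::real_normed_vector set"
  assumes "bounded A" "bounded B"
  shows "bounded (\<Union>x\<in>A. \<Union>y\<in>B. {x + y})"
  using bounded_sums[OF assms] by (rule bounded_subset) auto

text \<open>Split a point by taking, in each coordinate, the same relative position
  \<open>\<theta> i\<close> in both boxes. This fraction lies strictly between 0 and 1, so both
  summands stay in the open boxes.\<close>

lemma set_sum_box:
  fixes a b a' b' :: "'a::euclidean_space"
  assumes "box a b \<noteq> {}" "box a' b' \<noteq> {}"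
  shows "box (a + a') (b + b') \<subseteq> (\<Union>x\<in>box a b. \<Union>y\<in>box a' b'. {x + y})"
proof
  fix x assume x: "x \<in> box (a + a') (b + b')"
  have ab: "a \<bullet> i < b \<bullet> i" "a' \<bullet> i < b' \<bullet> i" if "i \<in> Basis" for i
    using assms that by (auto simp: box_ne_empty)
  define \<theta> where "\<theta> i = (x \<bullet> i - a \<bullet> i - a' \<bullet> i) / (b \<bullet> i - a \<bullet> i + (b' \<bullet> i - a' \<bullet> i))" for i
  have \<theta>: "0 < \<theta> i" "\<theta> i < 1" if "i \<in> Basis" for i
    using x ab[OF that] that unfolding \<theta>_def by (auto simp: mem_box inner_simps field_simps)
  have \<theta>_eq: "\<theta> i * (b \<bullet> i - a \<bullet> i) + \<theta> i * (b' \<bullet> i - a' \<bullet> i) = x \<bullet> i - a \<bullet> i - a' \<bullet> i" if "i \<in> Basis" for i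
    using ab[OF that] unfolding \<theta>_def distrib_left[symmetric] by simp
  define y z where "y = (\<Sum>i\<in>Basis. (a \<bullet> i + \<theta> i * (b \<bullet> i - a \<bullet> i)) *\<^sub>R i)"
    and "z = (\<Sum>i\<in>Basis. (a' \<bullet> i + \<theta> i * (b' \<bullet> i - a' \<bullet> i)) *\<^sub>R i)"
  have "x = y + z"
    by (rule euclidean_eqI) (use \<theta>_eq in \<open>force simp: y_def z_def inner_simps\<close>)
  moreover have "\<theta> i * (b \<bullet> i - a \<bullet> i) < b \<bullet> i - a \<bullet> i" "\<theta> i * (b' \<bullet> i - a' \<bullet> i) < b' \<bullet> i - a' \<bullet> i" if "i \<in> Basis" for i
    using \<theta>[OF that] ab[OF that] by (auto simp: mult_less_cancel_right2)
  then have "y \<in> box a b" "z \<in> box a' b'"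
    using \<theta> ab by (auto simp: mem_box y_def z_def less_diff_eq add.commute)
  ultimately show "x \<in> (\<Union>x\<in>box a b. \<Union>y\<in>box a' b'. {x + y})" by blast
qed

text \<open>Coordinatewise, the sum of two side lengths is at least twice their geometric mean. The
  product of these geometric means is the geometric mean of the two volumes, which is the common
  volume.\<close>

lemma brunn_minkowski_box_box:
  fixes a b a' b' :: "'a::euclidean_space"
  assumes ne: "box a b \<noteq> {}" "box a' b' \<noteq> {}"
    and eq: "measure lborel (box a b) = measure lborel (box a' b')"
  shows "2 ^ DIM('a) * measure lborel (box a b) \<le> measure lborel (\<Union>x\<in>box a b. \<Union>y\<in>box a' b'. {x + y})"
proof -
  have ab: "a \<bullet> i < b \<bullet> i" "a' \<bullet> i < b' \<bullet> i" if "i \<in> Basis" for i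
    using ne that by (auto simp: box_ne_empty)
  define v where "v = measure lborel (box a b)"
  have v: "v = (\<Prod>i\<in>Basis. (b - a) \<bullet> i)" "v = (\<Prod>i\<in>Basis. (b' - a') \<bullet> i)"
    using ab less_imp_le[OF ab(1)] less_imp_le[OF ab(2)] unfolding v_def
    by (simp add: measure_lborel_box_eq, simp only: eq) (simp add: measure_lborel_box_eq less_imp_le)
  have "v \<ge> 0" by (simp add: v_def)
  have "2 ^ DIM('a) * v = (\<Prod>i\<in>(Basis::'a set). 2) * sqrt (v * v)"
    using \<open>v \<ge> 0\<close> by simp
  also have "sqrt (v * v) = (\<Prod>i\<in>Basis. sqrt (((b - a) \<bullet> i) * ((b' - a') \<bullet> i)))"
    by (subst v(1), subst v(2)) (simp add: prod.distrib[symmetric] sqrt_prod)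
  also have "(\<Prod>i\<in>(Basis::'a set). 2) * \<dots> = (\<Prod>i\<in>Basis. 2 * sqrt (((b - a) \<bullet> i) * ((b' - a') \<bullet> i)))"
    by (simp only: prod.distrib)
  also have "\<dots> \<le> (\<Prod>i\<in>Basis. ((b + b') - (a + a')) \<bullet> i)"
  proof (rule prod_mono)
    fix i :: 'a assume i: "i \<in> Basis"
    have "0 \<le> (b - a) \<bullet> i" "0 \<le> (b' - a') \<bullet> i" using ab[OF i] by (auto simp: inner_simps)
    then show "0 \<le> 2 * sqrt ((b - a) \<bullet> i * ((b' - a') \<bullet> i)) \<and>
         2 * sqrt ((b - a) \<bullet> i * ((b' - a') \<bullet> i)) \<le> (b + b' - (a + a')) \<bullet> i"
      using arith_geo_mean_sqrt[of "(b - a) \<bullet> i" "(b' - a') \<bullet> i"] by (auto simp: inner_simps)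
  qed
  also have "\<dots> = measure lborel (box (a + a') (b + b'))"
    using ab by (subst measure_lborel_box_eq) (force simp: inner_simps intro!: add_mono less_imp_le)+
  also have "\<dots> \<le> measure lborel (\<Union>x\<in>box a b. \<Union>y\<in>box a' b'. {x + y})"
  proof (rule measure_mono_fmeasurable[OF set_sum_box[OF ne]])
    show "(\<Union>x\<in>box a b. \<Union>y\<in>box a' b'. {x + y}) \<in> fmeasurable lborel"
      using borel_open[OF open_sums[of "box a b" "box a' b'"]] emeasure_lborel_bounded_finite[OF bounded_set_sum[OF bounded_box bounded_box]]
      by (auto simp: fmeasurable_def less_top)
  qed auto
  finally show ?thesis by (simp add: v_def)
qed


text \<open>The Hadwiger-Ohmann step. Cut \<open>\<A>\<close> between two of its boxes and cut
  \<open>\<B>\<close> by a parallel hyperplane in the same volume ratio. Corresponding halves again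
  have equal volumes, so the hypothesis applies to both pairs, and the two partial sum sets are
  separated by a hyperplane, so their volumes add up. The induction hypothesis is an assumption here
  so that the step can also be used with the families exchanged.\<close>

lemma brunn_minkowski_split:
  fixes \<A> \<B> :: "'a::euclidean_space set set"
  assumes A: "box_family \<A>" and B: "box_family \<B>" and card: "card \<A> \<ge> 2"
    and eq: "measure lborel (\<Union>\<A>) = measure lborel (\<Union>\<B>)"
    and IH: "\<And>\<A>' \<B>' :: 'a set set. \<lbrakk>box_family \<A>'; box_family \<B>'; card \<A>' < card \<A>; card \<B>' \<le> card \<B>;
        measure lborel (\<Union>\<A>') = measure lborel (\<Union>\<B>')\<rbrakk>
       \<Longrightarrow> 2 ^ DIM('a) * measure lborel (\<Union>\<A>') \<le> measure lborel (\<Union>x\<in>\<Union>\<A>'. \<Union>y\<in>\<Union>\<B>'. {x + y})"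
  shows "2 ^ DIM('a) * measure lborel (\<Union>\<A>) \<le> measure lborel (\<Union>x\<in>\<Union>\<A>. \<Union>y\<in>\<Union>\<B>. {x + y})"
proof -
  obtain Q1 Q2 where Q: "Q1 \<in> \<A>" "Q2 \<in> \<A>" "Q1 \<noteq> Q2"
    using card card_le_Suc0_iff_eq[of \<A>] A unfolding box_family_def by fastforce
  \<comment> \<open>Disjoint nonempty open boxes are separated in some coordinate. Cutting at the
    separating height makes \<open>P1\<close> vanish on the upper side and \<open>P2\<close> on the
    lower side.\<close>
  obtain i P1 P2 c where P: "i \<in> Basis" "P1 \<in> \<A>" "P2 \<in> \<A>"
      "P1 \<inter> {x. x \<bullet> i > c} = {}" "P2 \<inter> {x. x \<bullet> i < c} = {}"
  proof -
    obtain a1 b1 a2 b2 where ab: "Q1 = box a1 b1" "Q2 = box a2 b2" "Q1 \<noteq> {}" "Q2 \<noteq> {}"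
      using A Q unfolding box_family_def by metis
    have "Q1 \<inter> Q2 = {}" using A Q unfolding box_family_def disjoint_def by blast
    then obtain i where i: "i \<in> Basis" "b1 \<bullet> i \<le> a1 \<bullet> i \<or> b2 \<bullet> i \<le> a2 \<bullet> i \<or> b1 \<bullet> i \<le> a2 \<bullet> i \<or> b2 \<bullet> i \<le> a1 \<bullet> i"
      unfolding ab disjoint_interval by blast
    moreover have "a1 \<bullet> i < b1 \<bullet> i" "a2 \<bullet> i < b2 \<bullet> i"
      using ab i(1) by (auto simp: box_ne_empty)
    ultimately have "b1 \<bullet> i \<le> a2 \<bullet> i \<or> b2 \<bullet> i \<le> a1 \<bullet> i" by linarith
    moreover have "a1 \<bullet> i < x \<bullet> i \<and> x \<bullet> i < b1 \<bullet> i" if "x \<in> Q1" for x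
      using that i(1) unfolding ab(1) mem_box by blast
    moreover have "a2 \<bullet> i < x \<bullet> i \<and> x \<bullet> i < b2 \<bullet> i" if "x \<in> Q2" for x
      using that i(1) unfolding ab(2) mem_box by blast
    ultimately have "Q1 \<inter> {x. x \<bullet> i > a2 \<bullet> i} = {} \<and> Q2 \<inter> {x. x \<bullet> i < a2 \<bullet> i} = {} \<or>
        Q2 \<inter> {x. x \<bullet> i > a1 \<bullet> i} = {} \<and> Q1 \<inter> {x. x \<bullet> i < a1 \<bullet> i} = {}"
      by (cases "b1 \<bullet> i \<le> a2 \<bullet> i") force+
    then show thesis using that[OF i(1) Q(1,2)] that[OF i(1) Q(2,1)] by blast
  qed
  define cut :: "'a set \<Rightarrow> 'a set set \<Rightarrow> 'a set set" where "cut H \<C> = (\<lambda>Q. Q \<inter> H) ` \<C> - {{}}" for H \<C>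
  have Ucut: "\<Union>(cut H \<C>) = \<Union>\<C> \<inter> H" for H \<C>
    unfolding cut_def by auto
  have card_lt: "card (cut H \<A>) < card \<A>" if "P \<in> \<A>" "P \<inter> H = {}" for P H
  proof -
    have fin: "finite \<A>" using A by (simp add: box_family_def)
    have "cut H \<A> \<subseteq> (\<lambda>Q. Q \<inter> H) ` (\<A> - {P})" using that by (auto simp: cut_def)
    then have "card (cut H \<A>) \<le> card ((\<lambda>Q. Q \<inter> H) ` (\<A> - {P}))"
      using fin by (intro card_mono) auto
    also have "\<dots> \<le> card (\<A> - {P})" using fin by (intro card_image_le) auto
    also have "\<dots> < card \<A>" using fin that(1) by (intro psubset_card_mono) auto
    finally show ?thesis .
  qed
  \<comment> \<open>The cut of \<open>\<B>\<close> is dictated by volume and may lose no box at all,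
    but it never creates more pieces than there were boxes.\<close>
  have card_le: "card (cut H \<B>) \<le> card \<B>" for H
  proof -
    have fin: "finite \<B>" using B by (simp add: box_family_def)
    have "card (cut H \<B>) \<le> card ((\<lambda>Q. Q \<inter> H) ` \<B>)"
      unfolding cut_def using fin by (intro card_mono) auto
    also have "\<dots> \<le> card \<B>" using fin by (rule card_image_le)
    finally show ?thesis .
  qed
  note oA = box_family_open[OF A] box_family_bounded[OF A]
  note oB = box_family_open[OF B] box_family_bounded[OF B]
  note splitA = measure_split_hyperplane[OF oA P(1), of c]
  have "measure lborel (\<Union>\<A> \<inter> {x. x \<bullet> i < c}) \<le> measure lborel (\<Union>\<B>)"
    using splitA measure_nonneg[of lborel "\<Union>\<A> \<inter> {x. x \<bullet> i > c}"] eq by linarith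
  then obtain c' where c': "measure lborel (\<Union>\<B> \<inter> {x. x \<bullet> i < c'}) = measure lborel (\<Union>\<A> \<inter> {x. x \<bullet> i < c})"
    using hyperplane_prescribed_volume[OF oB P(1)] measure_nonneg by metis
  note splitB = measure_split_hyperplane[OF oB P(1), of c']
  define Sm where "Sm = (\<Union>x\<in>\<Union>\<A>. \<Union>y\<in>\<Union>\<B>. {x + y})"
  define L where "L = (\<Union>x\<in>\<Union>\<A> \<inter> {x. x \<bullet> i < c}. \<Union>y\<in>\<Union>\<B> \<inter> {x. x \<bullet> i < c'}. {x + y})"
  define R where "R = (\<Union>x\<in>\<Union>\<A> \<inter> {x. x \<bullet> i > c}. \<Union>y\<in>\<Union>\<B> \<inter> {x. x \<bullet> i > c'}. {x + y})"
  have op: "open Sm" "bounded Sm"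
    unfolding Sm_def using open_sums[of "\<Union>\<A>" "\<Union>\<B>"] bounded_set_sum[OF oA(2) oB(2)] oA oB by blast+
  have op': "open L" "open R" "bounded L" "bounded R"
    unfolding L_def R_def using oA oB
    by (auto intro!: open_sums bounded_set_sum bounded_Int open_halfspace_component_lt open_halfspace_component_gt)
  have bf: "box_family (cut {x. x \<bullet> i < z} \<C>)" "box_family (cut {x. x \<bullet> i > z} \<C>)" if "box_family \<C>" for z \<C>
    unfolding cut_def using box_family_cut[OF that P(1), of _ z] by auto
  have "2 ^ DIM('a) * measure lborel (\<Union>\<A> \<inter> {x. x \<bullet> i < c}) \<le> measure lborel L"
    unfolding L_def
    by (rule IH[OF bf(1)[OF A] bf(1)[OF B] card_lt[OF P(3,5)] card_le, unfolded Ucut, OF c'[symmetric]])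
  moreover have "measure lborel (\<Union>\<A> \<inter> {x. x \<bullet> i > c}) = measure lborel (\<Union>\<B> \<inter> {x. x \<bullet> i > c'})"
    using c' splitA splitB eq by linarith
  then have "2 ^ DIM('a) * measure lborel (\<Union>\<A> \<inter> {x. x \<bullet> i > c}) \<le> measure lborel R"
    unfolding R_def
    by (rule IH[OF bf(2)[OF A] bf(2)[OF B] card_lt[OF P(2,4)] card_le, unfolded Ucut])
  ultimately have "2 ^ DIM('a) * measure lborel (\<Union>\<A>) \<le> measure lborel L + measure lborel R"
    using splitA by (simp add: distrib_left)
  also have "\<dots> = measure lborel (L \<union> R)"
  proof (rule measure_Union[symmetric])
    \<comment> \<open>The hyperplane at height \<open>c + c'\<close> separates the lower sum set
      from the upper one.\<close>
    have "z \<bullet> i < c + c'" if "z \<in> L" for z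
      using that unfolding L_def by (auto simp: inner_add_left intro: add_strict_mono)
    moreover have "z \<bullet> i > c + c'" if "z \<in> R" for z
      using that unfolding R_def by (auto simp: inner_add_left intro: add_strict_mono)
    ultimately show "L \<inter> R = {}" by force
  qed (use op' emeasure_lborel_bounded_finite in auto)
  also have "\<dots> \<le> measure lborel Sm"
  proof (rule measure_mono_fmeasurable)
    show "L \<union> R \<subseteq> Sm" unfolding L_def R_def Sm_def by auto
    show "Sm \<in> fmeasurable lborel" using op emeasure_lborel_bounded_finite
      by (auto simp: fmeasurable_def less_top)
  qed (use op' in auto)
  finally show ?thesis unfolding Sm_def .
qed

lemma set_sum_commute:
  fixes A B :: "'a::ab_semigroup_add set"
  shows "(\<Union>x\<in>A. \<Union>y\<in>B. {x + y}) = (\<Union>x\<in>B. \<Union>y\<in>A. {x + y})"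
  by (auto simp: add.commute) (metis add.commute)+

text \<open>Induction on the total number of boxes. If either family has two boxes, that family is
  split, exchanging the roles if necessary since the sum set is symmetric; two single boxes are the
  base case, and an empty family forces volume zero.\<close>

lemma brunn_minkowski_equal_volume:
  fixes \<A> \<B> :: "'a::euclidean_space set set"
  assumes "box_family \<A>" "box_family \<B>" "measure lborel (\<Union>\<A>) = measure lborel (\<Union>\<B>)"
  shows "2 ^ DIM('a) * measure lborel (\<Union>\<A>) \<le> measure lborel (\<Union>x\<in>\<Union>\<A>. \<Union>y\<in>\<Union>\<B>. {x + y})"
  using assms
proof (induction "card \<A> + card \<B>" arbitrary: \<A> \<B> rule: less_induct)
  case less
  consider "card \<A> \<ge> 2" | "card \<B> \<ge> 2" | "measure lborel (\<Union>\<A>) = 0" | "card \<A> = 1" "card \<B> = 1"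
  proof -
    have "\<A> = {} \<or> card \<A> \<ge> 1" "\<B> = {} \<or> card \<B> \<ge> 1"
      using less.prems by (auto simp: box_family_def Suc_le_eq card_gt_0_iff)
    then show ?thesis using that less.prems(3) by fastforce
  qed
  then show ?case
  proof cases
    case 1
    show ?thesis by (rule brunn_minkowski_split[OF less.prems(1,2) 1 less.prems(3)]) (rule less.hyps, auto)
  next
    case 2
    have "2 ^ DIM('a) * measure lborel (\<Union>\<B>) \<le> measure lborel (\<Union>x\<in>\<Union>\<B>. \<Union>y\<in>\<Union>\<A>. {x + y})"
      by (rule brunn_minkowski_split[OF less.prems(2,1) 2 less.prems(3)[symmetric]])
         (subst set_sum_commute, rule order_trans[OF _ less.hyps], auto)
    then show ?thesis using less.prems(3) unfolding set_sum_commute[of "\<Union>\<A>"] by simp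
  next
    case 3
    then show ?thesis by simp
  next
    case 4
    then obtain Q Q' where Q: "\<A> = {Q}" "\<B> = {Q'}" by (auto simp: card_1_singleton_iff)
    then obtain a b a' b' where "Q = box a b" "Q' = box a' b'" "Q \<noteq> {}" "Q' \<noteq> {}"
      using less.prems unfolding box_family_def by auto
    then show ?thesis using brunn_minkowski_box_box[of a b a' b'] less.prems(3) Q by simp
  qed
qed

section \<open>Norms, the isodiametric inequality and packings\<close>

locale finite_dim_norm =
  fixes N :: "'a::euclidean_space \<Rightarrow> real"
  assumes is_norm: "is_norm N"
begin

text \<open>A bound for \<open>N\<close> on the unit ball of the maximum norm. It is the loss
  incurred when a rescaled point is replaced by a corner of its unit cell.\<close>

definition Nsum :: real where "Nsum = (\<Sum>b\<in>Basis. N b)"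
definition volB :: real where "volB = measure lborel {x. N x < 1}"

lemma N_zero_iff [simp]: "N x = 0 \<longleftrightarrow> x = 0"
  and N_triangle: "N (x + y) \<le> N x + N y"
  and N_scale: "N (c *\<^sub>R x) = \<bar>c\<bar> * N x"
  using is_norm unfolding is_norm_def by auto

lemma N_uminus [simp]: "N (- x) = N x"
  using N_scale[of "-1" x] by simp

lemma N_minus_commute: "N (x - y) = N (y - x)"
  using N_uminus[of "x - y"] by simp

lemma N_nonneg [simp]: "0 \<le> N x"
proof -
  have "N (x + - x) \<le> N x + N (- x)" by (rule N_triangle)
  moreover have "N (x + - x) = 0" using N_zero_iff[of 0] by simp
  ultimately show ?thesis by (simp del: add.right_inverse N_zero_iff)
qed

lemma N_pos: "x \<noteq> 0 \<Longrightarrow> 0 < N x"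
  using N_nonneg[of x] N_zero_iff[of x] by linarith

lemma N_triangle_diff: "N (x - z) \<le> N (x - y) + N (y - z)"
  using N_triangle[of "x - y" "y - z"] by simp

lemma N_sum: "finite A \<Longrightarrow> N (\<Sum>a\<in>A. g a) \<le> (\<Sum>a\<in>A. N (g a))"
proof (induction A rule: finite_induct)
  case (insert a A)
  then show ?case using N_triangle[of "g a" "sum g A"] by simp
qed (simp del: N_zero_iff add: N_zero_iff[THEN iffD2])

lemma N_le_Nsum:
  assumes "\<And>b. b \<in> Basis \<Longrightarrow> \<bar>x \<bullet> b\<bar> \<le> t"
  shows "N x \<le> t * Nsum"
proof -
  have "N x = N (\<Sum>b\<in>Basis. (x \<bullet> b) *\<^sub>R b)" by (simp add: euclidean_representation)
  also have "\<dots> \<le> (\<Sum>b\<in>Basis. N ((x \<bullet> b) *\<^sub>R b))" by (rule N_sum) simp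
  also have "\<dots> \<le> (\<Sum>b\<in>Basis. t * N b)"
    unfolding N_scale by (intro sum_mono mult_right_mono assms) auto
  finally show ?thesis by (simp add: Nsum_def sum_distrib_left)
qed

lemma Nsum_pos: "0 < Nsum"
  unfolding Nsum_def by (intro sum_pos) (auto intro!: N_pos)

lemma N_le_norm: "N x \<le> Nsum * norm x"
  using N_le_Nsum[of x "norm x", OF Basis_le_norm] by (simp add: mult.commute)

lemma continuous_on_N: "continuous_on S N"
proof -
  have "dist (N x) (N y) \<le> Nsum * dist x y" for x y
    using N_triangle_diff[of x 0 y] N_triangle_diff[of y 0 x] N_le_norm[of "x - y"] N_minus_commute[of x y]
    by (simp add: dist_real_def dist_norm abs_le_iff)
  then have "Nsum-lipschitz_on S N" using Nsum_pos by (intro lipschitz_onI) auto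
  then show ?thesis by (rule lipschitz_on_continuous_on)
qed

text \<open>The other half of the equivalence of norms: \<open>N\<close> attains a positive minimum
  on the compact Euclidean sphere.\<close>

lemma N_ge_norm: obtains c where "c > 0" "\<And>x. c * norm x \<le> N x"
proof -
  have "sphere (0::'a) 1 \<noteq> {}" by simp
  then obtain y where y: "y \<in> sphere 0 1" "\<And>x. x \<in> sphere 0 1 \<Longrightarrow> N y \<le> N x"
    using continuous_attains_inf[OF compact_sphere _ continuous_on_N] by blast
  have "N y * norm x \<le> N x" for x
  proof (cases "x = 0")
    case False
    then have "N y \<le> N (x /\<^sub>R norm x)" by (intro y(2)) simp
    then show ?thesis using False by (simp add: N_scale field_simps)
  qed simp
  moreover have "N y > 0" using y(1) by (intro N_pos) auto
  ultimately show thesis using that by blast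
qed

lemma open_Nball: "open {x. N (x - c) < \<rho>}"
  by (intro open_Collect_less continuous_intros continuous_on_compose2[OF continuous_on_N[of UNIV]]) auto

lemma bounded_Nball: "bounded {x. N (x - c) < \<rho>}"
proof -
  obtain k where k: "k > 0" "\<And>x. k * norm x \<le> N x" using N_ge_norm by blast
  have "{x. N (x - c) < \<rho>} \<subseteq> cball c (\<rho> / k)"
  proof
    fix x assume "x \<in> {x. N (x - c) < \<rho>}"
    then have "k * norm (x - c) \<le> \<rho>" using k(2)[of "x - c"] by simp
    then show "x \<in> cball c (\<rho> / k)" using k(1) by (simp add: dist_norm norm_minus_commute field_simps)
  qed
  then show ?thesis using bounded_cball bounded_subset by blast
qed

lemma fmeasurable_Nball: "{x. N (x - c) < \<rho>} \<in> fmeasurable lborel"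
  using open_Nball emeasure_lborel_bounded_finite[OF bounded_Nball]
  by (auto simp: fmeasurable_def less_top)

lemma measure_Nball:
  assumes "\<rho> > 0"
  shows "measure lborel {x. N (x - c) < \<rho>} = \<rho> ^ DIM('a) * volB"
proof -
  let ?B = "{x. N (x - c) < \<rho>}"
  have B: "?B \<in> sets borel" using open_Nball by simp
  have "emeasure lborel ?B = emeasure (density (distr lborel borel (\<lambda>x. c + \<rho> *\<^sub>R x)) (\<lambda>_. ennreal (\<bar>\<rho>\<bar> ^ DIM('a)))) ?B"
    using lborel_affine[of \<rho> c] assms by (metis less_irrefl)
  also have "\<dots> = ennreal (\<rho> ^ DIM('a)) * emeasure (distr lborel borel (\<lambda>x. c + \<rho> *\<^sub>R x)) ?B"
    using B assms by (subst emeasure_density_const) auto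
  also have "emeasure (distr lborel borel (\<lambda>x. c + \<rho> *\<^sub>R x)) ?B = emeasure lborel ((\<lambda>x. c + \<rho> *\<^sub>R x) -` ?B \<inter> space lborel)"
    using B by (subst emeasure_distr) auto
  also have "(\<lambda>x. c + \<rho> *\<^sub>R x) -` ?B \<inter> space lborel = {x. N x < 1}"
    using assms by (auto simp: N_scale)
  finally show ?thesis
    using assms by (simp add: measure_def volB_def enn2real_mult)
qed

lemma volB_pos: "0 < volB"
proof -
  have "ball 0 (1 / Nsum) \<subseteq> {x. N (x - 0) < 1}"
  proof
    fix x :: 'a assume "x \<in> ball 0 (1 / Nsum)"
    then have "Nsum * norm x < 1" using Nsum_pos by (simp add: field_simps)
    then show "x \<in> {x. N (x - 0) < 1}" using N_le_norm[of x] by simp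
  qed
  then have "measure lborel (ball (0::'a) (1 / Nsum)) \<le> measure lborel {x. N (x - 0) < 1}"
    by (intro measure_mono_fmeasurable fmeasurable_Nball) auto
  moreover have "measure lborel (ball (0::'a) (1 / Nsum)) > 0"
    using Nsum_pos by (intro content_ball_pos) simp
  ultimately show ?thesis unfolding volB_def diff_zero by (rule order.strict_trans2[rotated])
qed

text \<open>The union \<open>A\<close> of the unit cubes at the points of \<open>T\<close> has
  volume \<open>card T\<close>, as has its reflection. Brunn-Minkowski gives
  \<open>2^d * card T\<close> as a lower bound for the volume of the difference set of
  \<open>A\<close>, and that set lies in an \<open>N\<close>-ball about the origin whose radius is
  the diameter bound plus a rounding term.\<close>

lemma lattice_isodiametric:
  assumes T: "finite T" "\<And>v b. v \<in> T \<Longrightarrow> b \<in> Basis \<Longrightarrow> v \<bullet> b \<in> \<int>"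
    and R0: "0 \<le> R"
    and R: "\<And>v w. v \<in> T \<Longrightarrow> w \<in> T \<Longrightarrow> N (v - w) \<le> R"
  shows "real (card T) \<le> volB * ((R + 2 * Nsum) / 2) ^ DIM('a)"
proof (cases "T = {}")
  case True

  then show ?thesis using R0 Nsum_pos volB_pos by simp
next
  case False

  define Q where "Q v = box v (v + One)" for v :: 'a
  \<comment> \<open>The reflection of \<open>Q v\<close> through the origin, so that sums of points
    of \<open>Q v\<close> and \<open>Q' w\<close> are differences of points of two cubes.\<close>
  define Q' where "Q' v = box (- v - One) (- v)" for v :: 'a
  have mem: "x \<in> Q v \<longleftrightarrow> (\<forall>b\<in>Basis. v \<bullet> b < x \<bullet> b \<and> x \<bullet> b < v \<bullet> b + 1)" for x v
    by (auto simp: Q_def mem_box inner_simps)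
  have mem': "x \<in> Q' v \<longleftrightarrow> - x \<in> Q v" for x v
    unfolding mem by (auto simp: Q'_def mem_box inner_simps)
  have inj: "v = w" if vw: "v \<in> T" "w \<in> T" "x \<in> Q v" "x \<in> Q w" for v w x
  proof (rule euclidean_eqI)
    fix b :: 'a assume b: "b \<in> Basis"
    obtain m n where mn: "v \<bullet> b = of_int m" "w \<bullet> b = of_int n"
      using T(2)[OF vw(1) b] T(2)[OF vw(2) b] by (auto elim!: Ints_cases)
    have "real_of_int m < of_int n + 1" "real_of_int n < of_int m + 1"
      using vw(3,4) b unfolding mem mn[symmetric] by (meson less_trans)+
    then have "m = n" by linarith
    then show "v \<bullet> b = w \<bullet> b" unfolding mn by simp
  qed
  have inj': "v = w" if "v \<in> T" "w \<in> T" "x \<in> Q' v" "x \<in> Q' w" for v w x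
    using inj[of v w "- x"] that mem' by blast
  have ne: "Q v \<noteq> {}" for v unfolding Q_def by (simp add: box_ne_empty inner_simps)
  have ne': "Q' v \<noteq> {}" for v unfolding Q'_def by (simp add: box_ne_empty inner_simps)
  have vol: "measure lborel (Q v) = 1" "measure lborel (Q' v) = 1" for v
    unfolding Q_def Q'_def by (subst measure_lborel_box_eq; simp add: inner_simps)+
  have disjQ: "disjoint_family_on Q T" "disjoint_family_on Q' T"
    using inj inj' unfolding disjoint_family_on_def by blast+
  have bf: "box_family (Q ` T)"
    unfolding box_family_def disjoint_def using T(1) ne inj by (auto simp: Q_def)
  have bf': "box_family (Q' ` T)"
    unfolding box_family_def disjoint_def using T(1) ne' inj' by (auto simp: Q'_def)
  have fin: "emeasure lborel (Q v) \<noteq> \<infinity>" "emeasure lborel (Q' v) \<noteq> \<infinity>" for v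
    unfolding Q_def Q'_def by (rule emeasure_lborel_bounded_finite[OF bounded_box])+
  have sets: "Q ` T \<subseteq> sets lborel" "Q' ` T \<subseteq> sets lborel"
    by (auto simp: Q_def Q'_def)
  have m: "measure lborel (\<Union>(Q ` T)) = card T"
    using measure_finite_Union[OF T(1) sets(1) disjQ(1) fin(1)] by (simp add: vol)
  have m': "measure lborel (\<Union>(Q' ` T)) = card T"
    using measure_finite_Union[OF T(1) sets(2) disjQ(2) fin(2)] by (simp add: vol)
  have "2 ^ DIM('a) * real (card T) \<le> measure lborel (\<Union>x\<in>\<Union>(Q ` T). \<Union>y\<in>\<Union>(Q' ` T). {x + y})"
    using brunn_minkowski_equal_volume[OF bf bf'] m m' by simp
  also have "\<dots> \<le> measure lborel {x. N (x - 0) < R + 2 * Nsum}"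
  proof (rule measure_mono_fmeasurable[OF _ _ fmeasurable_Nball])
    have "N (x + y) < R + 2 * Nsum" if "v \<in> T" "w \<in> T" "x \<in> Q v" "y \<in> Q' w" for v w x y
    proof -
      \<comment> \<open>Both offsets lie in the unit cube, so one \<open>Nsum\<close> bounds their
        difference; the second \<open>Nsum\<close> in the radius makes the inequality strict, as the
        open ball requires.\<close>
      have "N ((x - v) - (- y - w)) \<le> 1 * Nsum"
      proof (rule N_le_Nsum)
        fix b :: 'a assume "b \<in> Basis"
        then show "\<bar>((x - v) - (- y - w)) \<bullet> b\<bar> \<le> 1"
          using that(3,4) unfolding mem' mem by (force simp: inner_simps abs_le_iff)
      qed
      moreover have "N (v - w) \<le> R" using R that by blast
      moreover have "x + y = (v - w) + ((x - v) - (- y - w))" by simp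
      ultimately show ?thesis using N_triangle[of "v - w" "(x - v) - (- y - w)"] Nsum_pos by simp
    qed
    then show "(\<Union>x\<in>\<Union> (Q ` T). \<Union>y\<in>\<Union> (Q' ` T). {x + y}) \<subseteq> {x. N (x - 0) < R + 2 * Nsum}"
      by auto
    show "(\<Union>x\<in>\<Union> (Q ` T). \<Union>y\<in>\<Union> (Q' ` T). {x + y}) \<in> sets lborel"
      using borel_open[OF open_sums[of "\<Union>(Q ` T)" "\<Union>(Q' ` T)"]] box_family_open[OF bf] by simp
  qed
  also have "\<dots> = (R + 2 * Nsum) ^ DIM('a) * volB"
    using R0 Nsum_pos by (intro measure_Nball) simp
  finally show ?thesis by (simp add: power_divide field_simps)
qed

end

section \<open>Bounded densities: the essential supremum and packings of balls of nearly maximal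
  mass\<close>

locale bounded_density = finite_dim_norm N for N :: "'a::euclidean_space \<Rightarrow> real" +
  fixes f :: "'a \<Rightarrow> real"
  assumes f_meas [measurable]: "f \<in> borel_measurable borel"
    and f_nonneg: "\<And>x. f x \<ge> 0"
    and f_bdd: "\<exists>C. \<forall>x. f x \<le> C"
    and f_int: "(\<integral>\<^sup>+x. ennreal (f x) \<partial>lborel) = 1"
begin

definition \<sigma> :: real where "\<sigma> = ess_sup_dens f"
definition \<nu> :: "'a set \<Rightarrow> real" where "\<nu> A = measure (density lborel (\<lambda>x. ennreal (f x))) A"

lemma below_\<sigma>: "s < \<sigma> \<Longrightarrow> emeasure lborel {x. s < f x} > 0"
proof -
  assume "s < \<sigma>"
  have "{s. emeasure lborel {x. s < f x} > 0} \<noteq> {}"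
  proof -
    have "{x. -1 < f x} = UNIV" using f_nonneg by (auto intro: less_le_trans[of _ 0])
    then have "-1 \<in> {s. emeasure lborel {x. s < f x} > 0}" by simp
    then show ?thesis by blast
  qed
  then obtain s' where s': "emeasure lborel {x. s' < f x} > 0" "s < s'"
    using \<open>s < \<sigma>\<close> less_cSupD unfolding \<sigma>_def ess_sup_dens_def by (metis (no_types, lifting) mem_Collect_eq)
  have "emeasure lborel {x. s' < f x} \<le> emeasure lborel {x. s < f x}"
    using s'(2) by (intro emeasure_mono) auto
  then show ?thesis using s'(1) by (rule less_le_trans[rotated])
qed

text \<open>Exceeding \<open>\<sigma>\<close> by \<open>1 / (n + 1)\<close> has measure zero for
  each \<open>n\<close>, by maximality of the supremum, and countably many null sets are combined.
  The pointwise bound on \<open>f\<close> makes the supremum meaningful.\<close>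

lemma f_le_\<sigma>: "AE x in lborel. f x \<le> \<sigma>"
proof -
  obtain C where C: "\<And>x. f x \<le> C" using f_bdd by auto
  have null: "AE x in lborel. f x \<le> \<sigma> + 1 / real (Suc n)" for n
  proof (rule ccontr)
    assume "\<not> ?thesis"
    then have "emeasure lborel {x. \<sigma> + 1 / real (Suc n) < f x} > 0"
      by (subst (asm) AE_iff_measurable[of "{x. \<sigma> + 1 / real (Suc n) < f x}"])
         (auto simp: not_le zero_less_iff_neq_zero)
    moreover have "bdd_above {s. emeasure lborel {x. s < f x} > 0}"
    proof (rule bdd_aboveI[of _ C])
      fix s assume "s \<in> {s. emeasure lborel {x. s < f x} > 0}"
      then have "{x. s < f x} \<noteq> {}" by (metis emeasure_empty less_irrefl mem_Collect_eq)
      then show "s \<le> C" using C by (auto intro: less_imp_le less_le_trans)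
    qed
    ultimately have "\<sigma> + 1 / real (Suc n) \<le> \<sigma>"
      unfolding \<sigma>_def ess_sup_dens_def by (intro cSup_upper) auto
    then show False by simp
  qed
  then have "AE x in lborel. \<forall>n. f x \<le> \<sigma> + 1 / real (Suc n)"
    by (simp add: AE_all_countable)
  then show ?thesis
  proof eventually_elim
    case (elim x)
    have "(\<lambda>n. \<sigma> + 1 / real (Suc n)) \<longlonglongrightarrow> \<sigma> + 0"
      by (intro tendsto_intros) (use LIMSEQ_inverse_real_of_nat in \<open>simp add: inverse_eq_divide\<close>)
    then show ?case using elim LIMSEQ_le_const[of _ "\<sigma> + 0" "f x"] by auto
  qed
qed

lemma \<sigma>_pos: "0 < \<sigma>"
proof (rule ccontr)
  assume "\<not> 0 < \<sigma>"
  then have "AE x in lborel. ennreal (f x) = 0"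
    using f_le_\<sigma> by (auto elim!: eventually_mono simp: ennreal_neg)
  then have "(\<integral>\<^sup>+x. ennreal (f x) \<partial>lborel) = 0"
    by (subst nn_integral_0_iff_AE) auto
  then show False using f_int by simp
qed

lemma prob_space_density: "prob_space (density lborel (\<lambda>x. ennreal (f x)))"
  by (rule prob_spaceI) (simp add: emeasure_density f_int)

lemma \<nu>_le:
  assumes "A \<in> sets borel" "emeasure lborel A \<noteq> \<infinity>"
  shows "\<nu> A \<le> \<sigma> * measure lborel A"
proof -
  have "emeasure (density lborel (\<lambda>x. ennreal (f x))) A = (\<integral>\<^sup>+x. ennreal (f x) * indicator A x \<partial>lborel)"
    using assms by (subst emeasure_density) auto
  also have "\<dots> \<le> (\<integral>\<^sup>+x. ennreal \<sigma> * indicator A x \<partial>lborel)"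
    using f_le_\<sigma> by (intro nn_integral_mono_AE) (auto elim!: eventually_mono intro!: mult_right_mono ennreal_leI)
  also have "\<dots> = ennreal \<sigma> * emeasure lborel A"
    using assms by (subst nn_integral_cmult_indicator) auto
  also have "\<dots> = ennreal (\<sigma> * measure lborel A)"
    using assms \<sigma>_pos by (simp add: emeasure_eq_ennreal_measure ennreal_mult)
  finally show ?thesis
    using \<sigma>_pos by (simp add: \<nu>_def measure_def enn2real_leI)
qed

lemma \<nu>_ge:
  assumes "A \<in> sets borel" "B \<in> sets borel" "B \<subseteq> A" "emeasure lborel B \<noteq> \<infinity>" "\<And>x. x \<in> B \<Longrightarrow> s \<le> f x" "0 \<le> s"
  shows "s * measure lborel B \<le> \<nu> A"
proof -
  interpret D: prob_space "density lborel (\<lambda>x. ennreal (f x))" by (rule prob_space_density)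
  have "ennreal (s * measure lborel B) = ennreal s * emeasure lborel B"
    using assms by (simp add: emeasure_eq_ennreal_measure ennreal_mult)
  also have "\<dots> = (\<integral>\<^sup>+x. ennreal s * indicator B x \<partial>lborel)"
    using assms by (subst nn_integral_cmult_indicator) auto
  also have "\<dots> \<le> (\<integral>\<^sup>+x. ennreal (f x) * indicator A x \<partial>lborel)"
    using assms by (intro nn_integral_mono) (auto intro!: ennreal_leI split: split_indicator)
  also have "\<dots> = emeasure (density lborel (\<lambda>x. ennreal (f x))) A"
    using assms by (subst emeasure_density) auto
  finally show ?thesis
    unfolding \<nu>_def D.emeasure_eq_measure by (simp add: ennreal_le_iff)
qed

text \<open>The superlevel set has positive, possibly infinite, measure. Intersecting with a large
  ball makes it finite, and inner regularity then yields a compact subset.\<close>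

lemma dense_compact:
  assumes "s < \<sigma>"
  obtains K where "compact K" "K \<subseteq> {x. s < f x}" "measure lborel K > 0"
proof -
  let ?F = "\<lambda>n::nat. {x. s < f x} \<inter> cball 0 (real n)"
  have "\<exists>n. emeasure lborel (?F n) > 0"
  proof (rule ccontr)
    assume "\<not> ?thesis"
    then have "emeasure lborel (\<Union>n. ?F n) = 0"
      by (intro emeasure_UN_eq_0) auto
    moreover have "(\<Union>n. ?F n) = {x. s < f x}"
      by (auto simp: real_arch_simple)
    ultimately show False using below_\<sigma>[OF assms] by simp
  qed
  then obtain n where n: "emeasure lborel (?F n) > 0" by blast
  have fin: "emeasure lborel (?F n) \<noteq> \<infinity>"
    by (rule emeasure_lborel_bounded_finite) (meson Int_lower2 bounded_cball bounded_subset)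
  define e where "e = measure lborel (?F n)"
  have e: "e > 0" "emeasure lborel (?F n) = ennreal e"
    using n fin unfolding e_def by (auto simp: emeasure_eq_ennreal_measure)
  have Fb: "?F n \<in> sets borel" by measurable
  \<comment> \<open>The tolerance is the whole measure \<open>e\<close> and the inequality is
    strict, so the closed subset \<open>T\<close> cannot be null.\<close>
  then obtain T where T: "closed T" "T \<subseteq> ?F n" "emeasure lebesgue (?F n - T) < ennreal e"
    using sets_lebesgue_inner_closed[of "?F n" e] e(1) by (metis sets_completionI_sets sets_lborel)
  have Tb: "T \<in> sets borel" using T(1) by simp
  have "measure lborel T > 0"
  proof (rule ccontr)
    assume "\<not> measure lborel T > 0"
    then have "measure lborel T = 0" using measure_nonneg[of lborel T] by linarith
    moreover have "emeasure lborel T \<noteq> \<infinity>"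
      by (rule emeasure_lborel_bounded_finite) (use T(2) in \<open>meson Int_lower2 bounded_cball bounded_subset order_trans\<close>)
    ultimately have T0: "emeasure lborel T = 0" by (simp add: emeasure_eq_ennreal_measure)
    have "emeasure lborel (?F n) \<le> emeasure lborel (?F n - T) + emeasure lborel T"
      using Tb Fb T(2) by (subst plus_emeasure) (auto intro!: emeasure_mono)
    then show False using T(3) T0 e(2) Fb Tb by (simp add: not_less[symmetric])
  qed
  moreover have "compact T"
    using T(1,2) by (meson Int_lower2 bounded_cball bounded_subset compact_eq_bounded_closed order_trans)
  ultimately show thesis using that T(2) by blast
qed

text \<open>Take a maximal \<open>\<rho>\<close>-separated subset \<open>C\<close> of a compact set
  \<open>K\<close> on which \<open>f\<close> is nearly \<open>\<sigma>\<close>. By maximality the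
  balls of radius \<open>\<rho>\<close> cover \<open>K\<close>, so \<open>C\<close> has order
  \<open>\<rho>^(-d)\<close> points. The disjoint balls of radius \<open>\<rho> / 2\<close> all lie
  in an open \<open>U\<close> hardly larger than \<open>K\<close>, so only a few can have a sizeable
  part outside \<open>K\<close>; the others have the required mass. This replaces a density-point
  argument and is uniform in \<open>\<rho>\<close>.\<close>

lemma dense_packing:
  assumes "0 < \<epsilon>" "\<epsilon> < 1"
  obtains c r0 where "c > 0" "r0 > 0"
    "\<And>\<rho>. 0 < \<rho> \<Longrightarrow> \<rho> < r0 \<Longrightarrow> \<exists>C. finite C \<and> c \<le> real (card C) * \<rho> ^ DIM('a) \<and>
        disjoint_family_on (\<lambda>x. {y. N (y - x) < \<rho> / 2}) C \<and>
        (\<forall>x\<in>C. (1 - \<epsilon>) * (\<sigma> * volB * (\<rho> / 2) ^ DIM('a)) \<le> \<nu> {y. N (y - x) < \<rho> / 2})"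
proof -
  \<comment> \<open>The loss \<open>\<epsilon>\<close> is shared: one factor
    \<open>1 - \<epsilon> / 2\<close> for the density on \<open>K\<close>, one for the part of a
    ball inside \<open>K\<close>. Their product is at least \<open>1 - \<epsilon>\<close>.\<close>
  define s where "s = (1 - \<epsilon> / 2) * \<sigma>"
  have s: "s < \<sigma>" "0 < s" using assms \<sigma>_pos by (auto simp: s_def mult_less_cancel_right2)
  obtain K where K: "compact K" "K \<subseteq> {x. s < f x}" "measure lborel K > 0"
    using dense_compact[OF s(1)] by blast
  define \<kappa> where "\<kappa> = measure lborel K"
  \<comment> \<open>Chosen so that the balls with more than the fraction
    \<open>\<epsilon> / 2\<close> outside \<open>K\<close> number at most
    \<open>c / \<rho>^d\<close>, where \<open>c\<close> is half the constant guaranteed by the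
    covering of \<open>K\<close>.\<close>
  define \<eta> where "\<eta> = \<kappa> * \<epsilon> / (4 * 2 ^ DIM('a))"
  have \<kappa>: "\<kappa> > 0" using K by (simp add: \<kappa>_def)
  have \<eta>: "\<eta> > 0" using \<kappa> assms by (simp add: \<eta>_def)
  have Kb: "K \<in> sets borel" using K(1) by (simp add: borel_compact)
  obtain U where U: "open U" "K \<subseteq> U" "emeasure lebesgue (U - K) < ennreal \<eta>"
    using sets_lebesgue_outer_open[of K \<eta>] Kb \<eta> by (metis sets_completionI_sets sets_lborel)
  have UK: "emeasure lborel (U - K) < ennreal \<eta>" using U(1,3) Kb by simp
  obtain e where e: "e > 0" "\<And>x. x \<in> K \<Longrightarrow> ball x e \<subseteq> U"
  proof -
    obtain e where "e > 0" "(\<Union>x\<in>K. ball x e) \<subseteq> U"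
      using compact_subset_open_imp_ball_epsilon_subset[OF K(1) U(1,2)] by blast
    then show thesis using that by blast
  qed
  obtain k where k: "k > 0" "\<And>x. k * norm x \<le> N x" using N_ge_norm by blast
  \<comment> \<open>Below this bound an \<open>N\<close>-ball of radius \<open>\<rho> / 2\<close> is
    contained in a Euclidean ball of radius \<open>e\<close>, hence in \<open>U\<close> when its
    centre is in \<open>K\<close>.\<close>
  define r0 where "r0 = 2 * k * e"
  have r0: "r0 > 0" using k e by (simp add: r0_def)
  define c where "c = \<kappa> / (2 * volB)"
  have c: "c > 0" using \<kappa> volB_pos by (simp add: c_def)
  have "\<exists>C. finite C \<and> c \<le> real (card C) * \<rho> ^ DIM('a) \<and>
        disjoint_family_on (\<lambda>x. {y. N (y - x) < \<rho> / 2}) C \<and>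
        (\<forall>x\<in>C. (1 - \<epsilon>) * (\<sigma> * volB * (\<rho> / 2) ^ DIM('a)) \<le> \<nu> {y. N (y - x) < \<rho> / 2})"
    if \<rho>: "0 < \<rho>" "\<rho> < r0" for \<rho>
  proof -
    define B where "B x = {y. N (y - x) < \<rho> / 2}" for x
    have Bb: "B x \<in> sets borel" for x unfolding B_def using open_Nball by (rule borel_open)
    have volBx: "measure lborel (B x) = (\<rho> / 2) ^ DIM('a) * volB" for x
      using measure_Nball[of "\<rho> / 2" x] \<rho> by (simp add: B_def)
    define w where "w = (\<rho> / 2) ^ DIM('a) * volB"
    have w: "w > 0" using \<rho> volB_pos by (simp add: w_def)
    have finB: "emeasure lborel (B x) \<noteq> \<infinity>" for x
      unfolding B_def by (rule emeasure_lborel_bounded_finite[OF bounded_Nball])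
    have BU: "B x \<subseteq> U" if "x \<in> K" for x
    proof -
      have "B x \<subseteq> ball x e"
      proof
        fix y assume "y \<in> B x"
        then have "k * norm (y - x) < k * e" using k(2)[of "y - x"] \<rho> unfolding B_def r0_def mem_Collect_eq by linarith
        then show "y \<in> ball x e" using k(1) by (simp add: dist_norm norm_minus_commute)
      qed
      then show ?thesis using e(2)[OF that] by blast
    qed
    define sep where "sep C \<longleftrightarrow> finite C \<and> C \<subseteq> K \<and> (\<forall>x\<in>C. \<forall>y\<in>C. x \<noteq> y \<longrightarrow> \<rho> \<le> N (x - y))" for C
    have disj: "disjoint_family_on B C" if "sep C" for C
    proof -
      have "B x \<inter> B y = {}" if xy: "x \<in> C" "y \<in> C" "x \<noteq> y" for x y
      proof (rule ccontr)
        assume "B x \<inter> B y \<noteq> {}"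
        then obtain z where "N (z - x) < \<rho> / 2" "N (z - y) < \<rho> / 2" by (auto simp: B_def)
        then have "N (x - y) < \<rho>" using N_triangle_diff[of x y z] N_minus_commute[of z x] by linarith
        then show False using \<open>sep C\<close> xy unfolding sep_def by force
      qed
      then show ?thesis by (auto simp: disjoint_family_on_def)
    qed
    have finU: "emeasure lborel U \<noteq> \<infinity>"
    proof -
      have "emeasure lborel U = emeasure lborel (U - K) + emeasure lborel K"
        using U(1,2) Kb by (subst plus_emeasure) (auto intro!: arg_cong[where f = "emeasure lborel"])
      moreover have "emeasure lborel K \<noteq> \<infinity>" using K(1) by (intro emeasure_lborel_bounded_finite compact_imp_bounded)
      ultimately show ?thesis using UK by (auto simp: top_unique)
    qed
    have bound: "real (card C) * w \<le> measure lborel U" if "sep C" for C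
    proof -
      have "real (card C) * w = measure lborel (\<Union>(B ` C))"
        using that disj[OF that] finB Bb by (subst measure_finite_Union) (auto simp: sep_def volBx w_def)
      also have "\<dots> \<le> measure lborel U"
        using BU that Bb finU U(1)
        by (intro measure_mono_fmeasurable sets.finite_UN) (auto simp: sep_def fmeasurable_def less_top)
      finally show ?thesis .
    qed
    \<comment> \<open>A separated set of largest cardinality exists because disjoint balls of volume
      \<open>w\<close> inside \<open>U\<close> are bounded in number.\<close>
    have "\<exists>C. sep C \<and> (\<forall>D. sep D \<longrightarrow> card D \<le> card C)"
    proof (rule ex_has_greatest_nat[of sep "{}" card "Suc (nat \<lceil>measure lborel U / w\<rceil>)"])
      show "sep {}" by (simp add: sep_def)
      show "\<forall>D. sep D \<longrightarrow> card D < Suc (nat \<lceil>measure lborel U / w\<rceil>)"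
      proof (intro allI impI)
        fix D assume "sep D"
        then have "real (card D) \<le> measure lborel U / w" using bound w by (simp add: field_simps)
        then show "card D < Suc (nat \<lceil>measure lborel U / w\<rceil>)"
          using of_nat_ceiling[of "measure lborel U / w"] by linarith
      qed
    qed
    then obtain C where C: "sep C" "\<And>D. sep D \<Longrightarrow> card D \<le> card C" by blast
    have finC: "finite C" "C \<subseteq> K" using C(1) by (auto simp: sep_def)
    have cover: "K \<subseteq> (\<Union>y\<in>C. {x. N (x - y) < \<rho>})"
    proof
      fix x assume x: "x \<in> K"
      show "x \<in> (\<Union>y\<in>C. {x. N (x - y) < \<rho>})"
      proof (rule ccontr)
        assume "x \<notin> (\<Union>y\<in>C. {x. N (x - y) < \<rho>})"
        then have far: "\<rho> \<le> N (x - y)" if "y \<in> C" for y using that by (auto simp: not_less)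
        have "x \<notin> C" using far[of x] \<rho> by (auto simp: N_zero_iff[THEN iffD2])
        moreover have "sep (insert x C)"
          using C(1) x far N_minus_commute unfolding sep_def by (auto; metis)
        ultimately show False using C(2)[of "insert x C"] finC by simp
      qed
    qed
    have "\<kappa> \<le> measure lborel (\<Union>y\<in>C. {x. N (x - y) < \<rho>})"
      unfolding \<kappa>_def using cover Kb finC fmeasurable_Nball by (intro measure_mono_fmeasurable fmeasurable.finite_UN) auto
    also have "\<dots> \<le> (\<Sum>y\<in>C. measure lborel {x. N (x - y) < \<rho>})"
      using finC by (intro measure_UNION_le) (auto intro!: borel_open open_Nball)
    also have "\<dots> = real (card C) * (\<rho> ^ DIM('a) * volB)"
      using measure_Nball[OF \<rho>(1)] by simp
    finally have many: "2 * c \<le> real (card C) * \<rho> ^ DIM('a)"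
      using volB_pos by (simp add: c_def field_simps)
    \<comment> \<open>The good centres. Each discarded ball puts more than
      \<open>\<epsilon> / 2 * w\<close> of its volume into \<open>U - K\<close>, and these parts are
      disjoint.\<close>
    define G where "G = {x\<in>C. measure lborel (B x - K) \<le> \<epsilon> / 2 * w}"
    have "real (card (C - G)) * (\<epsilon> / 2 * w) = (\<Sum>x\<in>C - G. \<epsilon> / 2 * w)" by simp
    also have "\<dots> \<le> (\<Sum>x\<in>C - G. measure lborel (B x - K))"
      by (intro sum_mono) (auto simp: G_def)
    also have "\<dots> = measure lborel (\<Union>((\<lambda>x. B x - K) ` (C - G)))"
    proof (subst measure_finite_Union)
      show "disjoint_family_on (\<lambda>x. B x - K) (C - G)"
        using disj[OF C(1)] by (fastforce simp: disjoint_family_on_def)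
      show "emeasure lborel (B x - K) \<noteq> \<infinity>" for x
        using emeasure_lborel_bounded_finite[of "B x - K"] bounded_Nball[of x "\<rho> / 2"]
        by (auto simp: B_def intro: bounded_subset)
    qed (use finC Bb Kb in auto)
    also have "\<dots> \<le> measure lborel (U - K)"
      using BU finC Bb Kb UK U(1)
      by (intro measure_mono_fmeasurable sets.finite_UN) (auto simp: fmeasurable_def intro: less_trans)
    also have "\<dots> \<le> \<eta>" using UK \<eta> by (simp add: measure_def enn2real_leI less_imp_le)
    finally have "real (card (C - G)) * (\<epsilon> / 2 * w) \<le> \<eta>" .
    then have few: "real (card (C - G)) * \<rho> ^ DIM('a) \<le> c"
      using assms volB_pos by (simp add: \<eta>_def w_def c_def power_divide field_simps)
    have "G \<subseteq> C" by (auto simp: G_def)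
    then have "card C = card (C - G) + card G"
      using finC card_mono[of C G] by (simp add: card_Diff_subset finite_subset)
    then have "c \<le> real (card G) * \<rho> ^ DIM('a)" using many few by (simp add: distrib_right)
    moreover have "disjoint_family_on B G"
      using disj[OF C(1)] by (auto simp: disjoint_family_on_def G_def)
    moreover have "(1 - \<epsilon>) * (\<sigma> * volB * (\<rho> / 2) ^ DIM('a)) \<le> \<nu> (B x)" if "x \<in> G" for x
    proof -
      have fin1: "emeasure lborel (B x \<inter> K) \<noteq> \<infinity>"
        using emeasure_lborel_bounded_finite[of "B x \<inter> K"] bounded_Nball[of x "\<rho> / 2"]
        by (auto simp: B_def intro: bounded_subset)
      have "measure lborel (B x) = measure lborel (B x \<inter> K) + measure lborel (B x - K)"
        using Bb Kb fin1 finB[of x] emeasure_mono[of "B x - K" "B x" lborel]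
        by (subst measure_Union[symmetric]) (auto simp: top_unique intro!: arg_cong[where f = "measure lborel"])
      then have "(1 - \<epsilon> / 2) * w \<le> measure lborel (B x \<inter> K)"
        using that by (simp add: G_def volBx w_def algebra_simps)
      then have "s * ((1 - \<epsilon> / 2) * w) \<le> s * measure lborel (B x \<inter> K)" using s by simp
      also have "\<dots> \<le> \<nu> (B x)"
        using Bb Kb fin1 K(2) s by (intro \<nu>_ge) (auto intro: less_imp_le)
      finally have "s * ((1 - \<epsilon> / 2) * w) \<le> \<nu> (B x)" .
      moreover have "(1 - \<epsilon>) * (\<sigma> * w) \<le> s * ((1 - \<epsilon> / 2) * w)"
      proof -
        have "1 - \<epsilon> \<le> (1 - \<epsilon> / 2) * (1 - \<epsilon> / 2)" by (simp add: algebra_simps)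
        then have "(1 - \<epsilon>) * (\<sigma> * w) \<le> (1 - \<epsilon> / 2) * (1 - \<epsilon> / 2) * (\<sigma> * w)"
          using \<sigma>_pos w by (intro mult_right_mono) auto
        then show ?thesis by (simp add: s_def mult_ac)
      qed
      ultimately show ?thesis by (simp add: w_def mult_ac)
    qed
    ultimately show ?thesis using finC unfolding B_def G_def by (intro exI[of _ G]) (auto simp: G_def B_def)
  qed
  then show thesis using that c r0 by blast
qed

end

section \<open>Counting independent points\<close>

locale random_points = bounded_density N f + prob_space M
  for N :: "'a::euclidean_space \<Rightarrow> real" and f :: "'a \<Rightarrow> real" and M :: "'w measure" +
  fixes X :: "nat \<Rightarrow> 'w \<Rightarrow> 'a"
  assumes X_meas [measurable]: "\<And>i. X i \<in> measurable M borel"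
    and X_law: "\<And>i A. A \<in> sets borel \<Longrightarrow> prob {\<omega>\<in>space M. X i \<omega> \<in> A} = \<nu> A"
    and X_indep: "indep_vars (\<lambda>_. borel) X UNIV"
begin

lemma \<nu>_nonneg [simp]: "0 \<le> \<nu> A"
  by (simp add: \<nu>_def)

lemma \<nu>_le_1 [simp]: "\<nu> A \<le> 1"
  using prob_space.prob_le_1[OF prob_space_density] by (simp add: \<nu>_def)

lemma \<nu>_UNIV: "\<nu> UNIV = 1"
  using prob_space.prob_space[OF prob_space_density] by (simp add: \<nu>_def)

lemma \<nu>_diff:
  assumes "A \<in> sets borel" "B \<in> sets borel" "A \<subseteq> B"
  shows "\<nu> (B - A) = \<nu> B - \<nu> A"
proof -
  interpret D: prob_space "density lborel (\<lambda>x. ennreal (f x))" by (rule prob_space_density)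
  show ?thesis using assms unfolding \<nu>_def by (intro D.finite_measure_Diff) auto
qed

lemma \<nu>_mono: "A \<in> sets borel \<Longrightarrow> B \<in> sets borel \<Longrightarrow> A \<subseteq> B \<Longrightarrow> \<nu> A \<le> \<nu> B"
  using \<nu>_diff[of A B] \<nu>_nonneg[of "B - A"] by linarith

lemma prob_cylinder:
  assumes "finite I" "\<And>i. i \<in> I \<Longrightarrow> A i \<in> sets borel"
  shows "prob {\<omega>\<in>space M. \<forall>i\<in>I. X i \<omega> \<in> A i} = (\<Prod>i\<in>I. \<nu> (A i))"
proof (cases "I = {}")
  case False
  have "{\<omega>\<in>space M. \<forall>i\<in>I. X i \<omega> \<in> A i} = (\<Inter>i\<in>I. X i -` A i \<inter> space M)"
    using False by auto
  also have "prob \<dots> = (\<Prod>i\<in>I. prob (X i -` A i \<inter> space M))"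
    using assms False by (intro indep_varsD[OF X_indep]) auto
  also have "\<dots> = (\<Prod>i\<in>I. \<nu> (A i))"
  proof (rule prod.cong)
    fix i assume "i \<in> I"
    moreover have "X i -` A i \<inter> space M = {\<omega>\<in>space M. X i \<omega> \<in> A i}" by auto
    ultimately show "prob (X i -` A i \<inter> space M) = \<nu> (A i)" using X_law assms by simp
  qed simp
  finally show ?thesis .
qed (simp add: prob_space)

text \<open>The random index set has finitely many values, and each value is a cylinder event. Every
  counting event below is measurable for this reason.\<close>

lemma events_index_set:
  assumes "finite I" "\<And>i. i \<in> I \<Longrightarrow> A i \<in> sets borel"
  shows "{\<omega>\<in>space M. Q {i\<in>I. X i \<omega> \<in> A i}} \<in> events"
proof -
  have "{\<omega>\<in>space M. Q {i\<in>I. X i \<omega> \<in> A i}} =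
      (\<Union>J\<in>{J\<in>Pow I. Q J}. {\<omega>\<in>space M. \<forall>i\<in>I. X i \<omega> \<in> (if i \<in> J then A i else - A i)})" (is "?L = ?R")
  proof (intro set_eqI iffI)
    fix \<omega> assume "\<omega> \<in> ?L"
    then show "\<omega> \<in> ?R" by (intro UN_I[of "{i\<in>I. X i \<omega> \<in> A i}"]) auto
  next
    fix \<omega> assume "\<omega> \<in> ?R"
    then obtain J where J: "J \<subseteq> I" "Q J" "\<omega> \<in> space M" "\<forall>i\<in>I. X i \<omega> \<in> (if i \<in> J then A i else - A i)" by auto
    have "{i\<in>I. X i \<omega> \<in> A i} = J" using J(1,4) by (auto split: if_splits)
    then show "\<omega> \<in> ?L" using J by simp
  qed
  moreover have "{\<omega>\<in>space M. \<forall>i\<in>I. X i \<omega> \<in> (if i \<in> J then A i else - A i)} \<in> events" for J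
  proof (rule sets.sets_Collect_finite_All[OF _ assms(1)])
    fix i assume "i \<in> I"
    then have "(if i \<in> J then A i else - A i) \<in> sets borel" using assms(2) by auto
    then show "{\<omega>\<in>space M. X i \<omega> \<in> (if i \<in> J then A i else - A i)} \<in> events" by measurable
  qed
  then have "?R \<in> events" using assms(1) by (intro sets.finite_UN) simp_all
  ultimately show ?thesis by simp
qed

lemma events_cylinder:
  assumes "finite I" "\<And>i. i \<in> I \<Longrightarrow> A i \<in> sets borel"
  shows "{\<omega>\<in>space M. \<forall>i\<in>I. X i \<omega> \<in> A i} \<in> events"
proof -
  have "{\<omega>\<in>space M. \<forall>i\<in>I. X i \<omega> \<in> A i} = {\<omega>\<in>space M. {i\<in>I. X i \<omega> \<in> A i} = I}" by auto
  then show ?thesis using events_index_set[OF assms, where Q = "\<lambda>J. J = I"] by simp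
qed

text \<open>Sum over the possible index sets \<open>J\<close>. The additional constraints on the
  disjoint indices \<open>H\<close> factor out by independence; they will hold the distinguished
  point \<open>j\<close> of a clique.\<close>

lemma prob_index_set_le:
  assumes fin: "finite I" "finite H" "H \<inter> I = {}" and A: "A \<in> sets borel"
    and B: "\<And>h. h \<in> H \<Longrightarrow> B h \<in> sets borel"
  shows "prob {\<omega>\<in>space M. (\<forall>h\<in>H. X h \<omega> \<in> B h) \<and> Q {i\<in>I. X i \<omega> \<in> A}} \<le>
     (\<Prod>h\<in>H. \<nu> (B h)) * (\<Sum>J | J \<subseteq> I \<and> Q J. \<nu> A ^ card J * (1 - \<nu> A) ^ card (I - J))"
proof -
  define E where "E J = {\<omega>\<in>space M. \<forall>i\<in>H \<union> I. X i \<omega> \<in> (if i \<in> H then B i else if i \<in> J then A else - A)}" for J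
  have Eb: "(if i \<in> H then B i else if i \<in> J then A else - A) \<in> sets borel" for i J using A B by auto
  have Eev: "E J \<in> events" for J unfolding E_def using fin Eb by (intro events_cylinder) auto
  have pE: "prob (E J) = (\<Prod>h\<in>H. \<nu> (B h)) * (\<nu> A ^ card J * (1 - \<nu> A) ^ card (I - J))" if "J \<subseteq> I" for J
  proof -
    have "prob (E J) = (\<Prod>i\<in>H \<union> I. \<nu> (if i \<in> H then B i else if i \<in> J then A else - A))"
      unfolding E_def using fin Eb by (intro prob_cylinder) auto
    also have "\<dots> = (\<Prod>h\<in>H. \<nu> (B h)) * (\<Prod>i\<in>I. \<nu> (if i \<in> H then B i else if i \<in> J then A else - A))"
      using fin by (simp add: prod.union_disjoint)
    also have "(\<Prod>i\<in>I. \<nu> (if i \<in> H then B i else if i \<in> J then A else - A)) =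
        (\<Prod>i\<in>J. \<nu> A) * (\<Prod>i\<in>I - J. \<nu> (- A))"
    proof -
      have "(\<Prod>i\<in>I. \<nu> (if i \<in> H then B i else if i \<in> J then A else - A)) =
          (\<Prod>i\<in>J. \<nu> (if i \<in> H then B i else if i \<in> J then A else - A)) *
          (\<Prod>i\<in>I - J. \<nu> (if i \<in> H then B i else if i \<in> J then A else - A))"
        using prod.subset_diff[OF that fin(1)] by (simp add: mult.commute)
      also have "(\<Prod>i\<in>J. \<nu> (if i \<in> H then B i else if i \<in> J then A else - A)) = (\<Prod>i\<in>J. \<nu> A)"
        using that fin(3) by (intro prod.cong) auto
      also have "(\<Prod>i\<in>I - J. \<nu> (if i \<in> H then B i else if i \<in> J then A else - A)) = (\<Prod>i\<in>I - J. \<nu> (- A))"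
        using fin(3) by (intro prod.cong) auto
      finally show ?thesis .
    qed
    also have "\<nu> (- A) = 1 - \<nu> A" using \<nu>_diff[of A UNIV] A by (simp add: \<nu>_UNIV Compl_eq_Diff_UNIV)
    finally show ?thesis by simp
  qed
  have "prob {\<omega>\<in>space M. (\<forall>h\<in>H. X h \<omega> \<in> B h) \<and> Q {i\<in>I. X i \<omega> \<in> A}} \<le> prob (\<Union>J\<in>{J. J \<subseteq> I \<and> Q J}. E J)"
  proof (rule finite_measure_mono)
    show "{\<omega>\<in>space M. (\<forall>h\<in>H. X h \<omega> \<in> B h) \<and> Q {i\<in>I. X i \<omega> \<in> A}} \<subseteq> (\<Union>J\<in>{J. J \<subseteq> I \<and> Q J}. E J)"
    proof
      fix \<omega> assume "\<omega> \<in> {\<omega>\<in>space M. (\<forall>h\<in>H. X h \<omega> \<in> B h) \<and> Q {i\<in>I. X i \<omega> \<in> A}}"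
      then show "\<omega> \<in> (\<Union>J\<in>{J. J \<subseteq> I \<and> Q J}. E J)"
        unfolding E_def by (intro UN_I[of "{i\<in>I. X i \<omega> \<in> A}"]) auto
    qed
    show "(\<Union>J\<in>{J. J \<subseteq> I \<and> Q J}. E J) \<in> events"
      using Eev fin(1) by (intro sets.finite_UN) auto
  qed
  also have "\<dots> \<le> (\<Sum>J\<in>{J. J \<subseteq> I \<and> Q J}. prob (E J))"
    using Eev fin(1) by (intro finite_measure_subadditive_finite) auto
  also have "\<dots> = (\<Sum>J\<in>{J. J \<subseteq> I \<and> Q J}. (\<Prod>h\<in>H. \<nu> (B h)) * (\<nu> A ^ card J * (1 - \<nu> A) ^ card (I - J)))"
    by (intro sum.cong) (auto simp: pE)
  finally show ?thesis by (simp add: sum_distrib_left)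
qed

lemma sum_subsets_binomial:
  fixes a b :: real
  assumes "finite I"
  shows "(\<Sum>J\<in>Pow I. a ^ card J * b ^ card (I - J)) = (a + b) ^ card I"
  using prod_add[OF assms, of "\<lambda>_. a" "\<lambda>_. b"] by simp

text \<open>Exponential Markov inequality: on the event, the weight \<open>x^(card J) / x^l\<close>
  is at least 1, so it may be inserted, and the binomial theorem sums the weighted terms. The
  condition on \<open>Q\<close> covers both tails, \<open>x \<ge> 1\<close> for at least
  \<open>l\<close> points and \<open>x \<le> 1\<close> for at most \<open>l\<close>.\<close>

lemma prob_index_set_chernoff:
  assumes fin: "finite I" "finite H" "H \<inter> I = {}" and A: "A \<in> sets borel"
    and B: "\<And>h. h \<in> H \<Longrightarrow> B h \<in> sets borel" and x: "0 < x"
    and Q: "\<And>J. J \<subseteq> I \<Longrightarrow> Q J \<Longrightarrow> x ^ l \<le> x ^ card J"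
  shows "prob {\<omega>\<in>space M. (\<forall>h\<in>H. X h \<omega> \<in> B h) \<and> Q {i\<in>I. X i \<omega> \<in> A}} \<le>
     (\<Prod>h\<in>H. \<nu> (B h)) * ((1 / x) ^ l * exp (real (card I) * \<nu> A * (x - 1)))"
proof -
  have "(\<Sum>J | J \<subseteq> I \<and> Q J. \<nu> A ^ card J * (1 - \<nu> A) ^ card (I - J)) \<le>
        (\<Sum>J | J \<subseteq> I \<and> Q J. (1 / x) ^ l * ((x * \<nu> A) ^ card J * (1 - \<nu> A) ^ card (I - J)))"
  proof (rule sum_mono)
    fix J assume "J \<in> {J. J \<subseteq> I \<and> Q J}"
    then have "1 \<le> (1 / x) ^ l * x ^ card J" using Q[of J] x by (simp add: power_one_over field_simps)
    then have "1 * (\<nu> A ^ card J * (1 - \<nu> A) ^ card (I - J)) \<le> ((1 / x) ^ l * x ^ card J) * (\<nu> A ^ card J * (1 - \<nu> A) ^ card (I - J))"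
      by (intro mult_right_mono) auto
    then show "\<nu> A ^ card J * (1 - \<nu> A) ^ card (I - J) \<le> (1 / x) ^ l * ((x * \<nu> A) ^ card J * (1 - \<nu> A) ^ card (I - J))"
      by (simp add: power_mult_distrib mult_ac)
  qed
  also have "\<dots> \<le> (\<Sum>J\<in>Pow I. (1 / x) ^ l * ((x * \<nu> A) ^ card J * (1 - \<nu> A) ^ card (I - J)))"
    using fin(1) x by (intro sum_mono2) auto
  also have "\<dots> = (1 / x) ^ l * (x * \<nu> A + (1 - \<nu> A)) ^ card I"
    by (subst sum_distrib_left[symmetric], subst sum_subsets_binomial[OF fin(1)]) simp
  also have "\<dots> \<le> (1 / x) ^ l * exp (\<nu> A * (x - 1)) ^ card I"
  proof (intro mult_left_mono power_mono)
    show "x * \<nu> A + (1 - \<nu> A) \<le> exp (\<nu> A * (x - 1))"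
      using exp_ge_add_one_self[of "\<nu> A * (x - 1)"] by (simp add: algebra_simps)
    show "0 \<le> x * \<nu> A + (1 - \<nu> A)" using x by (intro add_nonneg_nonneg) auto
  qed (use x in auto)
  also have "exp (\<nu> A * (x - 1)) ^ card I = exp (real (card I) * \<nu> A * (x - 1))"
    by (simp add: exp_of_nat_mult[symmetric] mult.assoc)
  finally show ?thesis
    by (intro order_trans[OF prob_index_set_le[OF fin A B]] mult_left_mono prod_nonneg) auto
qed

lemma prob_count_ge:
  assumes fin: "finite I" "finite H" "H \<inter> I = {}" and A: "A \<in> sets borel"
    and B: "\<And>h. h \<in> H \<Longrightarrow> B h \<in> sets borel" and x: "1 \<le> x" and p: "\<nu> A \<le> p"
  shows "prob {\<omega>\<in>space M. (\<forall>h\<in>H. X h \<omega> \<in> B h) \<and> l \<le> card {i\<in>I. X i \<omega> \<in> A}} \<le>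
     (\<Prod>h\<in>H. \<nu> (B h)) * ((1 / x) ^ l * exp (real (card I) * p * (x - 1)))"
proof -
  have "prob {\<omega>\<in>space M. (\<forall>h\<in>H. X h \<omega> \<in> B h) \<and> l \<le> card {i\<in>I. X i \<omega> \<in> A}} \<le>
     (\<Prod>h\<in>H. \<nu> (B h)) * ((1 / x) ^ l * exp (real (card I) * \<nu> A * (x - 1)))"
    using x by (intro prob_index_set_chernoff[OF fin A B, where Q = "\<lambda>J. l \<le> card J"] power_increasing) auto
  also have "\<dots> \<le> (\<Prod>h\<in>H. \<nu> (B h)) * ((1 / x) ^ l * exp (real (card I) * p * (x - 1)))"
    using x p by (intro mult_left_mono prod_nonneg) (auto intro!: mult_right_mono mult_left_mono)
  finally show ?thesis .
qed

lemma prob_count_le: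
  assumes fin: "finite I" and A: "A \<in> sets borel" and x: "0 < x" "x \<le> 1" and p: "p \<le> \<nu> A"
  shows "prob {\<omega>\<in>space M. card {i\<in>I. X i \<omega> \<in> A} \<le> l} \<le>
     (1 / x) ^ l * exp (real (card I) * p * (x - 1))"
proof -
  have "prob {\<omega>\<in>space M. (\<forall>h\<in>({}::nat set). X h \<omega> \<in> UNIV) \<and> card {i\<in>I. X i \<omega> \<in> A} \<le> l} \<le>
     (\<Prod>h\<in>({}::nat set). \<nu> UNIV) * ((1 / x) ^ l * exp (real (card I) * \<nu> A * (x - 1)))"
    using prob_index_set_chernoff[of I "{}" A "\<lambda>_. UNIV" x "\<lambda>J. card J \<le> l" l] fin A x
      power_decreasing[of _ l x] by fastforce
  also have "\<dots> \<le> (1 / x) ^ l * exp (real (card I) * p * (x - 1))"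
    using x p by (auto intro!: mult_left_mono mult_right_mono_neg)
  finally show ?thesis by simp
qed

text \<open>The left side is at most one term of the binomial expansion of
  \<open>(p + (1 - P'))^b\<close>. It shows that the bound \<open>q\<close> used as a conditional
  probability does not exceed 1.\<close>

lemma binomial_pow_le_1:
  fixes p P' :: real
  assumes "0 \<le> p" "p \<le> P'" "P' \<le> 1" "b \<le> n"
  shows "real (b choose k) * p ^ k * (1 - P') ^ n \<le> 1"
proof (cases "k \<le> b")
  case True
  have "real (b choose k) * p ^ k * (1 - P') ^ n \<le> real (b choose k) * p ^ k * (1 - P') ^ (b - k)"
    using assms by (intro mult_left_mono power_decreasing) auto
  also have "\<dots> \<le> (\<Sum>j\<le>b. real (b choose j) * p ^ j * (1 - P') ^ (b - j))"
    using assms True by (intro member_le_sum[of k "{..b}" "\<lambda>j. real (b choose j) * p ^ j * (1 - P') ^ (b - j)"]) auto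
  also have "\<dots> = (p + (1 - P')) ^ b" by (simp add: binomial_ring)
  also have "\<dots> \<le> 1" using assms by (intro power_le_one) auto
  finally show ?thesis .
qed (simp add: binomial_eq_0)

text \<open>Here \<open>s\<close> is the mass of the region holding the remaining points and
  \<open>a\<close> that of the cell, so after division by \<open>s^(card I)\<close> the terms are
  binomial probabilities with parameter \<open>a / s\<close>, which lies between \<open>p\<close>
  and \<open>P'\<close>. The terms with exactly \<open>k\<close> points already contribute at least
  \<open>q\<close>, which leaves at most \<open>1 - q\<close> for fewer than
  \<open>k\<close>.\<close>

lemma sum_small_subsets_le:
  fixes a s p P' q :: real and I :: "nat set"
  assumes I: "finite I" "b \<le> card I" "card I \<le> n0"
    and p: "0 \<le> p" "p \<le> a" "a \<le> P' * s" "s \<le> 1" "0 \<le> s" "0 \<le> P'" "P' \<le> 1"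
    and q: "q \<le> real (b choose k) * p ^ k * (1 - P') ^ n0"
  shows "(\<Sum>J | J \<subseteq> I \<and> card J < k. a ^ card J * (s - a) ^ card (I - J)) \<le> s ^ card I * (1 - q)"
proof -
  have "P' * s \<le> s" using p mult_right_mono[of P' 1 s] by simp
  then have as: "0 \<le> a" "a \<le> s" using p by linarith+
  define t where "t J = a ^ card J * (s - a) ^ card (I - J)" for J :: "nat set"
  have t0: "0 \<le> t J" for J using as by (simp add: t_def)
  have "s ^ card I * q \<le> s ^ card I * (real (card I choose k) * p ^ k * (1 - P') ^ n0)"
  proof (rule mult_left_mono)
    have "real (b choose k) * p ^ k * (1 - P') ^ n0 \<le> real (card I choose k) * p ^ k * (1 - P') ^ n0"
      using p binomial_right_mono[OF I(2), of k] by (intro mult_right_mono) auto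
    then show "q \<le> real (card I choose k) * p ^ k * (1 - P') ^ n0" using q by linarith
  qed (use p in auto)
  also have "\<dots> \<le> real (card I choose k) * (a ^ k * (s - a) ^ (card I - k))"
  proof (cases "k \<le> card I")
    case True
    have "s ^ card I = s ^ k * s ^ (card I - k)" using True by (simp add: power_add[symmetric])
    then have "s ^ card I * (p ^ k * (1 - P') ^ n0) = (s ^ k * p ^ k) * (s ^ (card I - k) * (1 - P') ^ n0)"
      by simp
    also have "\<dots> \<le> a ^ k * (s - a) ^ (card I - k)"
    proof (rule mult_mono)
      show "s ^ k * p ^ k \<le> a ^ k"
        unfolding power_mult_distrib[symmetric] using p mult_mono[of s 1 p a] by (intro power_mono) auto
      \<comment> \<open>The relative mass left outside the cell is at least \<open>1 - P'\<close>,
        and raising the exponent to \<open>n0\<close> only decreases that power.\<close>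
      have "s ^ (card I - k) * (1 - P') ^ n0 \<le> s ^ (card I - k) * (1 - P') ^ (card I - k)"
        using p I by (intro mult_left_mono power_decreasing) auto
      also have "\<dots> \<le> (s - a) ^ (card I - k)"
        unfolding power_mult_distrib[symmetric] using p \<open>P' * s \<le> s\<close> by (intro power_mono) (auto simp: algebra_simps)
      finally show "s ^ (card I - k) * (1 - P') ^ n0 \<le> (s - a) ^ (card I - k)" .
    qed (use p as in auto)
    finally have "s ^ card I * (p ^ k * (1 - P') ^ n0) \<le> a ^ k * (s - a) ^ (card I - k)" .
    from mult_left_mono[OF this, of "real (card I choose k)"] show ?thesis by (simp add: mult_ac)
  qed (simp add: binomial_eq_0)
  also have "\<dots> = (\<Sum>J | J \<subseteq> I \<and> card J = k. t J)"
  proof -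
    have "(\<Sum>J | J \<subseteq> I \<and> card J = k. t J) = (\<Sum>J | J \<subseteq> I \<and> card J = k. a ^ k * (s - a) ^ (card I - k))"
      using I(1) by (intro sum.cong) (auto simp: t_def card_Diff_subset finite_subset)
    then show ?thesis using n_subsets[OF I(1)] by simp
  qed
  finally have "s ^ card I * q \<le> (\<Sum>J | J \<subseteq> I \<and> card J = k. t J)" .
  moreover have "(\<Sum>J | J \<subseteq> I \<and> card J < k. t J) + (\<Sum>J | J \<subseteq> I \<and> card J = k. t J) \<le> s ^ card I"
  proof -
    have "(\<Sum>J | J \<subseteq> I \<and> card J < k. t J) + (\<Sum>J | J \<subseteq> I \<and> card J = k. t J) =
        sum t ({J. J \<subseteq> I \<and> card J < k} \<union> {J. J \<subseteq> I \<and> card J = k})"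
      using I(1) by (intro sum.union_disjoint[symmetric]) auto
    also have "\<dots> \<le> sum t (Pow I)" using I(1) t0 by (intro sum_mono2) auto
    also have "\<dots> = s ^ card I" unfolding t_def using sum_subsets_binomial[OF I(1), of a "s - a"] by simp
    finally show ?thesis .
  qed
  ultimately show ?thesis unfolding t_def by (simp add: right_diff_distrib)
qed

text \<open>
  Expose the cells one at a time: if a cell received fewer than \<open>k\<close> points, the remaining points are
  independent and avoid it, so the next cell is again full with conditional probability at least \<open>q\<close>.
  Demanding \<open>b\<close> points outside all cells guarantees that at least \<open>b\<close> points are left at every step.
  The cylinder event on \<open>H\<close> records the points already exposed.
\<close>

lemma prob_no_full_cell:
  fixes p P' q s0 :: real
  assumes C: "finite C" "disjoint_family_on A C" "\<And>c. c \<in> C \<Longrightarrow> A c \<in> sets borel" "\<And>c. c \<in> C \<Longrightarrow> A c \<subseteq> D"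
    and D: "D \<in> sets borel" and O: "D - (\<Union>c\<in>C. A c) = O'" "s0 \<le> \<nu> O'" "O' \<in> sets borel"
    and p: "0 \<le> p" "0 \<le> P'" "P' \<le> 1" "\<And>c. c \<in> C \<Longrightarrow> p \<le> \<nu> (A c)" "\<And>c. c \<in> C \<Longrightarrow> \<nu> (A c) \<le> P' * s0"
    and q: "q \<le> real (b choose k) * p ^ k * (1 - P') ^ n0" "q \<le> 1"
    and I: "finite I" "card I \<le> n0" "finite H" "H \<inter> I = {}" "\<And>h. h \<in> H \<Longrightarrow> B h \<in> sets borel"
  shows "prob {\<omega>\<in>space M. (\<forall>h\<in>H. X h \<omega> \<in> B h) \<and> (\<forall>i\<in>I. X i \<omega> \<in> D) \<and>
      (\<forall>c\<in>C. card {i\<in>I. X i \<omega> \<in> A c} < k) \<and> b \<le> card {i\<in>I. X i \<omega> \<in> O'}} \<le>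
     (\<Prod>h\<in>H. \<nu> (B h)) * \<nu> D ^ card I * (1 - q) ^ card C"
  using C D O p(4,5) I
proof (induction C arbitrary: D I H B rule: finite_induct)
  case empty
  have "prob {\<omega>\<in>space M. (\<forall>h\<in>H. X h \<omega> \<in> B h) \<and> (\<forall>i\<in>I. X i \<omega> \<in> D) \<and>
      (\<forall>c\<in>{}. card {i\<in>I. X i \<omega> \<in> A c} < k) \<and> b \<le> card {i\<in>I. X i \<omega> \<in> O'}} \<le>
      prob {\<omega>\<in>space M. \<forall>i\<in>H \<union> I. X i \<omega> \<in> (if i \<in> H then B i else D)}"
    using empty by (intro finite_measure_mono events_cylinder) auto
  also have "\<dots> = (\<Prod>i\<in>H \<union> I. \<nu> (if i \<in> H then B i else D))"
    using empty by (intro prob_cylinder) auto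
  also have "\<dots> = (\<Prod>i\<in>H. \<nu> (if i \<in> H then B i else D)) * (\<Prod>i\<in>I. \<nu> (if i \<in> H then B i else D))"
    using empty by (intro prod.union_disjoint) auto
  also have "(\<Prod>i\<in>I. \<nu> (if i \<in> H then B i else D)) = (\<Prod>i\<in>I. \<nu> D)"
    using empty by (intro prod.cong) auto
  finally show ?case by simp
next
  case (insert c C)
  let ?E = "{\<omega>\<in>space M. (\<forall>h\<in>H. X h \<omega> \<in> B h) \<and> (\<forall>i\<in>I. X i \<omega> \<in> D) \<and>
      (\<forall>c\<in>insert c C. card {i\<in>I. X i \<omega> \<in> A c} < k) \<and> b \<le> card {i\<in>I. X i \<omega> \<in> O'}}"
  have Ac: "A c \<in> sets borel" "A c \<subseteq> D" "\<And>c'. c' \<in> C \<Longrightarrow> A c' \<inter> A c = {}"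
    using insert.prems insert.hyps(2) by (auto simp: disjoint_family_on_def)
  have O'D: "O' \<subseteq> D" "O' \<inter> A c = {}" using insert.prems(5) by auto
  show ?case
  proof (cases "b \<le> card I")
    case False
    have "card {i\<in>I. X i \<omega> \<in> O'} \<le> card I" for \<omega> using insert.prems by (intro card_mono) auto
    \<comment> \<open>With fewer than \<open>b\<close> points left the demand for \<open>b\<close>
      points outside all cells cannot be met.\<close>
    then have "?E = {}" using False by (auto simp: not_le) (meson leD le_less_trans order_trans)
    then have "prob ?E = 0" by (simp only: measure_empty)
    then show ?thesis using q(2) by (simp add: prod_nonneg)
  next
    case True
    \<comment> \<open>The points found in the cell \<open>A c\<close> join the exposed indices, each
      with the constraint to lie in \<open>A c\<close>; the others continue in
      \<open>D - A c\<close>.\<close>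
    define B' where "B' J = (\<lambda>i. if i \<in> J then A c else B i)" for J :: "nat set"
    define E where "E J = {\<omega>\<in>space M. (\<forall>h\<in>H \<union> J. X h \<omega> \<in> B' J h) \<and> (\<forall>i\<in>I - J. X i \<omega> \<in> D - A c) \<and>
      (\<forall>c\<in>C. card {i\<in>I - J. X i \<omega> \<in> A c} < k) \<and> b \<le> card {i\<in>I - J. X i \<omega> \<in> O'}}" for J
    have IH: "prob (E J) \<le> (\<Prod>h\<in>H. \<nu> (B h)) * (\<nu> (A c) ^ card J * (\<nu> D - \<nu> (A c)) ^ card (I - J)) * (1 - q) ^ card C"
      if J: "J \<subseteq> I" for J
    proof -
      have finJ: "finite J" using J insert.prems by (auto intro: finite_subset)
      have "prob (E J) \<le> (\<Prod>h\<in>H \<union> J. \<nu> (B' J h)) * \<nu> (D - A c) ^ card (I - J) * (1 - q) ^ card C"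
        unfolding E_def
      proof (rule insert.IH)
        show "disjoint_family_on A C" using insert.prems(1) by (auto simp: disjoint_family_on_def)
        show "card (I - J) \<le> n0" using insert.prems(10,11) by (meson Diff_subset card_mono order_trans)
        show "D - A c - (\<Union>c\<in>C. A c) = O'" using insert.prems(5) by auto
        show "A c' \<subseteq> D - A c" if "c' \<in> C" for c' using insert.prems(3)[of c'] Ac(3)[OF that] that by auto
      qed (use insert.prems Ac J finJ in \<open>auto simp: B'_def\<close>)
      also have "(\<Prod>h\<in>H \<union> J. \<nu> (B' J h)) = (\<Prod>h\<in>H. \<nu> (B' J h)) * (\<Prod>h\<in>J. \<nu> (B' J h))"
        using insert.prems J finJ by (intro prod.union_disjoint) auto
      also have "(\<Prod>h\<in>H. \<nu> (B' J h)) = (\<Prod>h\<in>H. \<nu> (B h))"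
        using insert.prems J by (intro prod.cong) (auto simp: B'_def)
      also have "(\<Prod>h\<in>J. \<nu> (B' J h)) = \<nu> (A c) ^ card J" by (simp add: B'_def)
      also have "\<nu> (D - A c) = \<nu> D - \<nu> (A c)" using Ac insert.prems by (intro \<nu>_diff) auto
      finally show ?thesis by (simp add: mult_ac)
    qed
    have Eev: "E J \<in> events" if J: "J \<subseteq> I" for J
    proof -
      have finJ: "finite J" using J insert.prems by (auto intro: finite_subset)
      have 1: "{\<omega>\<in>space M. \<forall>h\<in>H \<union> J. X h \<omega> \<in> B' J h} \<in> events"
        using insert.prems Ac finJ by (intro events_cylinder) (auto simp: B'_def)
      have 2: "{\<omega>\<in>space M. \<forall>i\<in>I - J. X i \<omega> \<in> D - A c} \<in> events"
        using insert.prems Ac by (intro events_cylinder) auto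
      have 3: "{\<omega>\<in>space M. \<forall>c\<in>C. card {i\<in>I - J. X i \<omega> \<in> A c} < k} \<in> events"
        using insert.prems insert.hyps
        by (intro sets.sets_Collect_finite_All events_index_set[where Q = "\<lambda>L. card L < k"]) auto
      have 4: "{\<omega>\<in>space M. b \<le> card {i\<in>I - J. X i \<omega> \<in> O'}} \<in> events"
        using insert.prems by (intro events_index_set[where Q = "\<lambda>L. b \<le> card L"]) auto
      have "E J = {\<omega>\<in>space M. \<forall>h\<in>H \<union> J. X h \<omega> \<in> B' J h} \<inter> {\<omega>\<in>space M. \<forall>i\<in>I - J. X i \<omega> \<in> D - A c} \<inter>
         ({\<omega>\<in>space M. \<forall>c\<in>C. card {i\<in>I - J. X i \<omega> \<in> A c} < k} \<inter> {\<omega>\<in>space M. b \<le> card {i\<in>I - J. X i \<omega> \<in> O'}})"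
        unfolding E_def by auto
      then show ?thesis using sets.Int[OF sets.Int[OF 1 2] sets.Int[OF 3 4]] by simp
    qed
    have finJs: "finite {J. J \<subseteq> I \<and> card J < k}" using insert.prems(10) by simp
    \<comment> \<open>Decompose by the set \<open>J\<close> of indices found in \<open>A c\<close>.
      Since \<open>A c\<close> is disjoint from the later cells and from \<open>O'\<close>, removing
      \<open>J\<close> changes none of their counts.\<close>
    have "prob ?E \<le> prob (\<Union>J\<in>{J. J \<subseteq> I \<and> card J < k}. E J)"
    proof (rule finite_measure_mono)
      show "?E \<subseteq> (\<Union>J\<in>{J. J \<subseteq> I \<and> card J < k}. E J)"
      proof
        fix \<omega> assume \<omega>: "\<omega> \<in> ?E"
        define J where "J = {i\<in>I. X i \<omega> \<in> A c}"
        have 1: "{i\<in>I - J. X i \<omega> \<in> A c'} = {i\<in>I. X i \<omega> \<in> A c'}" if "c' \<in> C" for c'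
          using Ac(3)[OF that] by (auto simp: J_def)
        have 2: "{i\<in>I - J. X i \<omega> \<in> O'} = {i\<in>I. X i \<omega> \<in> O'}" using O'D by (auto simp: J_def)
        have "\<omega> \<in> E J"
          unfolding E_def using \<omega> insert.prems(13) 1 2 by (auto simp: B'_def J_def)
        then show "\<omega> \<in> (\<Union>J\<in>{J. J \<subseteq> I \<and> card J < k}. E J)"
          using \<omega> by (intro UN_I[of J]) (auto simp: J_def)
      qed
      show "(\<Union>J\<in>{J. J \<subseteq> I \<and> card J < k}. E J) \<in> events"
        using Eev finJs by (intro sets.finite_UN) auto
    qed
    also have "\<dots> \<le> (\<Sum>J | J \<subseteq> I \<and> card J < k. prob (E J))"
      using Eev finJs by (intro finite_measure_subadditive_finite) auto
    also have "\<dots> \<le> (\<Sum>J | J \<subseteq> I \<and> card J < k. (\<Prod>h\<in>H. \<nu> (B h)) * (\<nu> (A c) ^ card J * (\<nu> D - \<nu> (A c)) ^ card (I - J)) * (1 - q) ^ card C)"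
      using IH by (intro sum_mono) auto
    also have "\<dots> = (\<Prod>h\<in>H. \<nu> (B h)) * (\<Sum>J | J \<subseteq> I \<and> card J < k. \<nu> (A c) ^ card J * (\<nu> D - \<nu> (A c)) ^ card (I - J)) * (1 - q) ^ card C"
      by (simp add: sum_distrib_left sum_distrib_right)
    also have "\<dots> \<le> (\<Prod>h\<in>H. \<nu> (B h)) * (\<nu> D ^ card I * (1 - q)) * (1 - q) ^ card C"
    proof (intro mult_right_mono mult_left_mono sum_small_subsets_le[OF _ True])
      \<comment> \<open>The region shrinks at every stage but always contains \<open>O'\<close>, so
        one lower bound \<open>s0\<close> controls the relative mass of each cell
        throughout.\<close>
      have "s0 \<le> \<nu> D" using O'D insert.prems \<nu>_mono[of O' D] by auto
      then show "\<nu> (A c) \<le> P' * \<nu> D"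
        using insert.prems(9)[of c] p(2) by (meson insertI1 mult_left_mono order_trans)
    qed (use insert.prems p q in \<open>auto intro!: prod_nonneg\<close>)
    finally show ?thesis using insert.hyps by (simp add: mult_ac)
  qed
qed

end

section \<open>Cliques of a given size\<close>

context finite_dim_norm
begin

definition int_lattice :: "'a set" where "int_lattice = {v. \<forall>b\<in>Basis. v \<bullet> b \<in> \<int>}"

text \<open>The cell is named by its integer corner in units of \<open>h\<close>, not by its
  position in space, so the shapes of cell configurations do not depend on the scale.\<close>

definition grid_cell :: "real \<Rightarrow> 'a \<Rightarrow> 'a" where
  "grid_cell h x = (\<Sum>b\<in>Basis. of_int \<lfloor>(x \<bullet> b) / h\<rfloor> *\<^sub>R b)"

lemma grid_cell_inner: "b \<in> Basis \<Longrightarrow> grid_cell h x \<bullet> b = of_int \<lfloor>(x \<bullet> b) / h\<rfloor>"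
  unfolding grid_cell_def by simp

lemma grid_cell_lattice: "grid_cell h x \<in> int_lattice"
  by (simp add: int_lattice_def grid_cell_inner)

lemma grid_cell_measurable [measurable]: "grid_cell h \<in> borel_measurable borel"
  unfolding grid_cell_def[abs_def] by measurable

lemma int_lattice_eq: "int_lattice = (\<lambda>z. \<Sum>b\<in>Basis. of_int (z b) *\<^sub>R b) ` (Basis \<rightarrow>\<^sub>E (UNIV :: int set))"
proof (intro set_eqI iffI)
  fix v :: 'a assume v: "v \<in> int_lattice"
  have "v = (\<Sum>b\<in>Basis. of_int ((\<lambda>b\<in>Basis. \<lfloor>v \<bullet> b\<rfloor>) b) *\<^sub>R b)"
  proof (rule euclidean_eqI)
    fix b :: 'a assume b: "b \<in> Basis"
    then show "v \<bullet> b = (\<Sum>b\<in>Basis. of_int ((\<lambda>b\<in>Basis. \<lfloor>v \<bullet> b\<rfloor>) b) *\<^sub>R b) \<bullet> b"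
      using v by (simp add: int_lattice_def)
  qed
  then show "v \<in> (\<lambda>z. \<Sum>b\<in>Basis. of_int (z b) *\<^sub>R b) ` (Basis \<rightarrow>\<^sub>E (UNIV :: int set))"
    by (intro image_eqI[of _ _ "\<lambda>b\<in>Basis. \<lfloor>v \<bullet> b\<rfloor>"]) auto
qed (auto simp: int_lattice_def)

lemma countable_int_lattice: "countable int_lattice"
  unfolding int_lattice_eq by (intro countable_image countable_PiE) auto

text \<open>Finiteness here bounds the number of possible clique shapes by a constant independent of
  the radius and of the number of points.\<close>

lemma finite_lattice_Nball: "finite {v \<in> int_lattice. N v \<le> R}"
proof -
  obtain k where k: "k > 0" "\<And>x. k * norm x \<le> N x" using N_ge_norm by blast
  define m where "m = \<lceil>R / k\<rceil>"
  have "{v \<in> int_lattice. N v \<le> R} \<subseteq> (\<lambda>z. \<Sum>b\<in>Basis. of_int (z b) *\<^sub>R b) ` (Basis \<rightarrow>\<^sub>E {-m..m})"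
  proof
    fix v assume v: "v \<in> {v \<in> int_lattice. N v \<le> R}"
    then obtain z where z: "z \<in> Basis \<rightarrow>\<^sub>E (UNIV :: int set)" "v = (\<Sum>b\<in>Basis. of_int (z b) *\<^sub>R b)"
      unfolding int_lattice_eq by auto
    have "z b \<in> {-m..m}" if b: "b \<in> Basis" for b
    proof -
      have "of_int (z b) = v \<bullet> b" using z(2) b by simp
      then have "\<bar>of_int (z b)\<bar> \<le> norm v" using Basis_le_norm[OF b, of v] by simp
      also have "norm v \<le> R / k" using k(1) k(2)[of v] v by (simp add: field_simps)
      finally have "\<bar>of_int (z b)\<bar> \<le> R / k" .
      then have "of_int (z b) \<le> R / k" "of_int (- z b) \<le> R / k" by auto
      then have "z b \<le> m" "- z b \<le> m" unfolding m_def by linarith+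
      then show ?thesis by simp
    qed
    then have "z \<in> Basis \<rightarrow>\<^sub>E {-m..m}" using z(1) by (auto simp: PiE_iff)
    then show "v \<in> (\<lambda>z. \<Sum>b\<in>Basis. of_int (z b) *\<^sub>R b) ` (Basis \<rightarrow>\<^sub>E {-m..m})"
      using z(2) by blast
  qed
  then show ?thesis by (rule finite_subset) (auto intro!: finite_PiE)
qed

lemma N_grid_cell_diff:
  assumes "h > 0"
  shows "N (grid_cell h x - grid_cell h y) \<le> N (x - y) / h + 2 * Nsum"
proof -
  have near: "N (grid_cell h x - x /\<^sub>R h) \<le> 1 * Nsum" for x
  proof (rule N_le_Nsum)
    fix b :: 'a assume b: "b \<in> Basis"
    then have "(grid_cell h x - x /\<^sub>R h) \<bullet> b = of_int \<lfloor>(x \<bullet> b) / h\<rfloor> - (x \<bullet> b) / h"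
      by (simp add: inner_diff_left grid_cell_inner divide_inverse)
    then show "\<bar>(grid_cell h x - x /\<^sub>R h) \<bullet> b\<bar> \<le> 1" by linarith
  qed
  have "N (grid_cell h x - grid_cell h y) \<le> N (grid_cell h x - x /\<^sub>R h) + N (x /\<^sub>R h - grid_cell h y)"
    by (rule N_triangle_diff)
  also have "N (x /\<^sub>R h - grid_cell h y) \<le> N (x /\<^sub>R h - y /\<^sub>R h) + N (y /\<^sub>R h - grid_cell h y)"
    by (rule N_triangle_diff)
  also have "N (x /\<^sub>R h - y /\<^sub>R h) = N (x - y) / h"
    unfolding scaleR_diff_right[symmetric] using assms by (simp add: N_scale divide_inverse)
  finally show ?thesis using near[of x] near[of y] N_minus_commute[of "y /\<^sub>R h" "grid_cell h y"] by simp
qed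

lemma measure_grid_cell:
  assumes "h > 0"
  shows "measure lborel {x. grid_cell h x = u} \<le> h ^ DIM('a)" "emeasure lborel {x. grid_cell h x = u} \<noteq> \<infinity>"
proof -
  let ?c = "cbox (h *\<^sub>R u) (h *\<^sub>R u + h *\<^sub>R One)"
  have sub: "{x. grid_cell h x = u} \<subseteq> ?c"
  proof
    fix x assume "x \<in> {x. grid_cell h x = u}"
    then have "u \<bullet> b = of_int \<lfloor>(x \<bullet> b) / h\<rfloor>" if "b \<in> Basis" for b
      using grid_cell_inner[OF that, of h x] by simp
    then have "u \<bullet> b \<le> (x \<bullet> b) / h \<and> (x \<bullet> b) / h \<le> u \<bullet> b + 1" if "b \<in> Basis" for b
      using that by simp
    then show "x \<in> ?c" using assms by (simp add: mem_box inner_add_left field_simps)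
  qed
  have "measure lborel {x. grid_cell h x = u} \<le> measure lborel ?c"
    by (intro measure_mono_fmeasurable sub) (auto simp: measurable_sets_borel)
  also have "\<dots> = h ^ DIM('a)"
    using assms by (subst measure_lborel_cbox_eq) (auto simp: inner_add_left)
  finally show "measure lborel {x. grid_cell h x = u} \<le> h ^ DIM('a)" .
  show "emeasure lborel {x. grid_cell h x = u} \<noteq> \<infinity>"
    using sub by (intro emeasure_lborel_bounded_finite) (meson bounded_cbox bounded_subset)
qed

end

section \<open>Probability bounds for the presence and the absence of large cliques\<close>

context random_points
begin

definition clique :: "real \<Rightarrow> 'w \<Rightarrow> nat set \<Rightarrow> bool" where
  "clique \<rho> \<omega> S \<longleftrightarrow> (\<forall>i\<in>S. \<forall>j\<in>S. i \<noteq> j \<longrightarrow> N (X i \<omega> - X j \<omega>) \<le> \<rho>)"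

text \<open>
  Discretise at scale \<open>\<delta> * \<rho>\<close>. Relative to the cell of \<open>X j\<close>, the cells met by a clique through \<open>j\<close> form one
  of boundedly many shapes, and by the isodiametric inequality each shape has volume at most that of
  a ball of diameter \<open>(1 + \<epsilon>) * \<rho>\<close>.
\<close>

lemma prob_clique_through_le:
  assumes \<epsilon>: "0 < \<epsilon>"
  obtains K where "0 \<le> K"
    "\<And>\<rho> I j l x. \<lbrakk>0 < \<rho>; finite I; j \<in> I; 1 \<le> x\<rbrakk> \<Longrightarrow>
       \<exists>E\<in>events. {\<omega>\<in>space M. \<exists>S\<subseteq>I. j \<in> S \<and> l + 1 \<le> card S \<and> clique \<rho> \<omega> S} \<subseteq> E \<and>
         prob E \<le> K * ((1 / x) ^ l * exp (real (card I) * (\<sigma> * volB * ((1 + \<epsilon>) * \<rho> / 2) ^ DIM('a)) * (x - 1)))"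
proof -
  \<comment> \<open>With cells of side \<open>h = \<delta> * \<rho>\<close>, the isodiametric radius
    \<open>(R + 2 * Nsum) / 2 * h\<close> equals
    \<open>(1 + 4 * Nsum * \<delta>) * \<rho> / 2\<close>. The choice of \<open>\<delta>\<close>
    turns this into \<open>(1 + \<epsilon>) * \<rho> / 2\<close>.\<close>
  define \<delta> where "\<delta> = \<epsilon> / (4 * Nsum)"
  have \<delta>: "\<delta> > 0" using \<epsilon> Nsum_pos by (simp add: \<delta>_def)
  define R where "R = 1 / \<delta> + 2 * Nsum"
  have R: "R \<ge> 0" using \<delta> Nsum_pos by (simp add: R_def)
  \<comment> \<open>The possible shapes relative to the cell of \<open>X j\<close>. The family
    depends only on \<open>N\<close> and \<open>\<epsilon>\<close>, so its cardinality serves as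
    \<open>K\<close>.\<close>
  define \<T> where "\<T> = {T. T \<subseteq> {v \<in> int_lattice. N v \<le> R} \<and> (\<forall>v\<in>T. \<forall>w\<in>T. N (v - w) \<le> R)}"
  have fin\<T>: "finite \<T>" unfolding \<T>_def using finite_lattice_Nball by auto
  have "\<exists>E\<in>events. {\<omega>\<in>space M. \<exists>S\<subseteq>I. j \<in> S \<and> l + 1 \<le> card S \<and> clique \<rho> \<omega> S} \<subseteq> E \<and>
         prob E \<le> real (card \<T>) * ((1 / x) ^ l * exp (real (card I) * (\<sigma> * volB * ((1 + \<epsilon>) * \<rho> / 2) ^ DIM('a)) * (x - 1)))"
    if \<rho>: "0 < \<rho>" and I: "finite I" "j \<in> I" and x: "1 \<le> x" for \<rho> I j l x
  proof -
    define h where "h = \<delta> * \<rho>"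
    have h: "h > 0" using \<delta> \<rho> by (simp add: h_def)
    define p where "p = \<sigma> * volB * ((1 + \<epsilon>) * \<rho> / 2) ^ DIM('a)"
    have p0: "p \<ge> 0" using \<sigma>_pos volB_pos \<epsilon> \<rho> by (simp add: p_def)
    define g where "g = grid_cell h"
    have gm: "{x. g x = u} \<in> sets borel" for u
      unfolding g_def by (simp add: measurable_sets_borel)
    define A where "A y T = {x. g x - y \<in> T}" for y T
    have Aeq: "A y T = (\<Union>v\<in>T. {x. g x = y + v})" for y T by (auto simp: A_def algebra_simps)
    have Ab: "A y T \<in> sets borel" if "T \<in> \<T>" for y T
    proof -
      have "finite T" using that finite_lattice_Nball unfolding \<T>_def by (auto intro: finite_subset)
      then show ?thesis unfolding Aeq using gm by (intro sets.finite_UN) auto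
    qed
    have Anu: "\<nu> (A y T) \<le> p" if T: "T \<in> \<T>" for y T
    proof -
      have fT: "finite T" using T finite_lattice_Nball unfolding \<T>_def by (auto intro: finite_subset)
      have "emeasure lborel (A y T) \<le> (\<Sum>v\<in>T. emeasure lborel {x. g x = y + v})"
        unfolding Aeq using gm fT by (intro emeasure_subadditive_finite) auto
      also have "\<dots> < \<infinity>" using measure_grid_cell(2)[OF h] fT by (auto simp: g_def less_top[symmetric])
      finally have fin: "emeasure lborel (A y T) \<noteq> \<infinity>" by simp
      have "measure lborel (A y T) \<le> (\<Sum>v\<in>T. measure lborel {x. g x = y + v})"
        unfolding Aeq using gm fT by (intro measure_UNION_le) auto
      also have "\<dots> \<le> (\<Sum>v\<in>T. h ^ DIM('a))"
        using measure_grid_cell(1)[OF h] by (intro sum_mono) (simp add: g_def)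
      also have "\<dots> = real (card T) * h ^ DIM('a)" by simp
      also have "\<dots> \<le> volB * ((R + 2 * Nsum) / 2) ^ DIM('a) * h ^ DIM('a)"
        using T fT R h unfolding \<T>_def int_lattice_def
        by (intro mult_right_mono lattice_isodiametric) auto
      also have "\<dots> = volB * ((R + 2 * Nsum) / 2 * h) ^ DIM('a)" by (simp only: power_mult_distrib mult.assoc)
      also have "(R + 2 * Nsum) / 2 * h = (1 + \<epsilon>) * \<rho> / 2"
        using \<delta> Nsum_pos unfolding R_def h_def by (simp add: \<delta>_def field_simps)
      finally have "measure lborel (A y T) \<le> volB * ((1 + \<epsilon>) * \<rho> / 2) ^ DIM('a)" .
      then have "\<sigma> * measure lborel (A y T) \<le> p"
        using \<sigma>_pos unfolding p_def by (simp add: mult.assoc)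
      then show ?thesis using \<nu>_le[OF Ab[OF T] fin] by linarith
    qed
    define b where "b = (1 / x) ^ l * exp (real (card I) * p * (x - 1))"
    have b0: "0 \<le> b" using x by (simp add: b_def)
    \<comment> \<open>Fixing the cell \<open>y\<close> of \<open>X j\<close> makes the target region
      \<open>A y T\<close> deterministic, so the other points are counted independently of
      \<open>X j\<close>.\<close>
    define F where "F y T = {\<omega>\<in>space M. (\<forall>i\<in>{j}. X i \<omega> \<in> {x. g x = y}) \<and> l \<le> card {i\<in>I - {j}. X i \<omega> \<in> A y T}}" for y T
    have Fev: "F y T \<in> events" if "T \<in> \<T>" for y T
    proof -
      have eq: "F y T = {\<omega>\<in>space M. \<forall>i\<in>{j}. X i \<omega> \<in> {x. g x = y}} \<inter> {\<omega>\<in>space M. l \<le> card {i\<in>I - {j}. X i \<omega> \<in> A y T}}"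
        by (auto simp: F_def)
      have 1: "{\<omega>\<in>space M. \<forall>i\<in>{j}. X i \<omega> \<in> {x. g x = y}} \<in> events"
        using gm by (intro events_cylinder) auto
      have 2: "{\<omega>\<in>space M. l \<le> card {i\<in>I - {j}. X i \<omega> \<in> A y T}} \<in> events"
        using I Ab[OF that] by (intro events_index_set[where Q = "\<lambda>L. l \<le> card L"]) auto
      show ?thesis unfolding eq by (rule sets.Int[OF 1 2])
    qed
    have FP: "prob (F y T) \<le> \<nu> {x. g x = y} * b" if T: "T \<in> \<T>" for y T
    proof -
      have "prob (F y T) \<le> (\<Prod>i\<in>{j}. \<nu> {x. g x = y}) * ((1 / x) ^ l * exp (real (card (I - {j})) * p * (x - 1)))"
        unfolding F_def using I gm Ab[OF T] Anu[OF T] x by (intro prob_count_ge) auto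
      also have "\<dots> \<le> \<nu> {x. g x = y} * b"
        unfolding b_def using x p0 I by (auto intro!: mult_left_mono mult_right_mono card_mono)
      finally show ?thesis .
    qed
    define G where "G y = (\<Union>T\<in>\<T>. F y T)" for y
    have Gev: "G y \<in> events" for y unfolding G_def using Fev fin\<T> by (intro sets.finite_UN) auto
    have GP: "emeasure M (G y) \<le> ennreal (real (card \<T>) * b) * emeasure M {\<omega>\<in>space M. X j \<omega> \<in> {x. g x = y}}" for y
    proof -
      have "prob (G y) \<le> (\<Sum>T\<in>\<T>. prob (F y T))"
        unfolding G_def using Fev fin\<T> by (intro finite_measure_subadditive_finite) auto
      also have "\<dots> \<le> (\<Sum>T\<in>\<T>. \<nu> {x. g x = y} * b)" using FP by (intro sum_mono) auto
      also have "\<dots> = real (card \<T>) * b * prob {\<omega>\<in>space M. X j \<omega> \<in> {x. g x = y}}"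
        by (subst X_law[OF gm]) simp
      finally show ?thesis
        using b0 by (simp add: emeasure_eq_measure ennreal_mult[symmetric])
    qed
    define E where "E = (\<Union>y\<in>int_lattice. G y)"
    have "E \<in> events" unfolding E_def using Gev countable_int_lattice by (intro sets.countable_UN'') auto
    moreover have "{\<omega>\<in>space M. \<exists>S\<subseteq>I. j \<in> S \<and> l + 1 \<le> card S \<and> clique \<rho> \<omega> S} \<subseteq> E"
    proof
      fix \<omega> assume "\<omega> \<in> {\<omega>\<in>space M. \<exists>S\<subseteq>I. j \<in> S \<and> l + 1 \<le> card S \<and> clique \<rho> \<omega> S}"
      then obtain S where S: "\<omega> \<in> space M" "S \<subseteq> I" "j \<in> S" "l + 1 \<le> card S" "clique \<rho> \<omega> S" by auto
      have finS: "finite S" using S I by (auto intro: finite_subset)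
      define y where "y = g (X j \<omega>)"
      define T where "T = (\<lambda>i. g (X i \<omega>) - y) ` S"
      have close: "N (g (X i \<omega>) - g (X i' \<omega>)) \<le> R" if "i \<in> S" "i' \<in> S" for i i'
      proof (cases "i = i'")
        case True
        then show ?thesis using R by (simp add: N_zero_iff[THEN iffD2])
      next
        case False
        then have "N (X i \<omega> - X i' \<omega>) / h \<le> \<rho> / h"
          using S(5) that h by (intro divide_right_mono) (auto simp: clique_def)
        also have "\<rho> / h = 1 / \<delta>" using \<rho> by (simp add: h_def)
        finally show ?thesis
          using N_grid_cell_diff[OF h, of "X i \<omega>" "X i' \<omega>"] unfolding g_def R_def by linarith
      qed
      have "T \<in> \<T>"
      proof -
        have "g u - g v \<in> int_lattice" for u v
          using grid_cell_lattice[of h u] grid_cell_lattice[of h v]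
          by (auto simp: g_def int_lattice_def inner_diff_left)
        moreover have "N (v - w) \<le> R" if "v \<in> T" "w \<in> T" for v w
          using that close by (auto simp: T_def)
        moreover have "N v \<le> R" if "v \<in> T" for v
          using that close[OF _ S(3)] by (auto simp: T_def y_def)
        ultimately show ?thesis by (auto simp: \<T>_def T_def y_def)
      qed
      moreover have "\<omega> \<in> F y T"
      proof -
        have "S - {j} \<subseteq> {i\<in>I - {j}. X i \<omega> \<in> A y T}" using S(2) by (auto simp: A_def T_def)
        then have "card (S - {j}) \<le> card {i\<in>I - {j}. X i \<omega> \<in> A y T}" using I by (intro card_mono) auto
        moreover have "l \<le> card (S - {j})" using S(3,4) finS by simp
        ultimately show ?thesis using S(1) by (simp add: F_def y_def)
      qed
      moreover have "y \<in> int_lattice" unfolding y_def g_def by (rule grid_cell_lattice)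
      ultimately show "\<omega> \<in> E" unfolding E_def G_def by blast
    qed
    moreover have "prob E \<le> real (card \<T>) * b"
    proof -
      \<comment> \<open>Summing over the infinitely many cells costs no factor: the bound for a cell
        is proportional to the probability that \<open>X j\<close> lies there, and these
        probabilities sum to at most 1.\<close>
      have disj: "disjoint_family_on (\<lambda>y. {\<omega>\<in>space M. X j \<omega> \<in> {x. g x = y}}) int_lattice"
        by (auto simp: disjoint_family_on_def)
      have disjG: "disjoint_family_on G int_lattice"
        by (auto simp: disjoint_family_on_def G_def F_def)
      have Xg: "{\<omega>\<in>space M. X j \<omega> \<in> {x. g x = y}} \<in> events" for y
        using gm by measurable
      have "emeasure M E = (\<integral>\<^sup>+y. emeasure M (G y) \<partial>count_space int_lattice)"
        unfolding E_def using Gev countable_int_lattice disjG by (intro emeasure_UN_countable) auto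
      also have "\<dots> \<le> (\<integral>\<^sup>+y. ennreal (real (card \<T>) * b) * emeasure M {\<omega>\<in>space M. X j \<omega> \<in> {x. g x = y}} \<partial>count_space int_lattice)"
        by (intro nn_integral_mono GP)
      also have "\<dots> = ennreal (real (card \<T>) * b) * (\<integral>\<^sup>+y. emeasure M {\<omega>\<in>space M. X j \<omega> \<in> {x. g x = y}} \<partial>count_space int_lattice)"
        by (intro nn_integral_cmult) auto
      also have "(\<integral>\<^sup>+y. emeasure M {\<omega>\<in>space M. X j \<omega> \<in> {x. g x = y}} \<partial>count_space int_lattice) =
          emeasure M (\<Union>y\<in>int_lattice. {\<omega>\<in>space M. X j \<omega> \<in> {x. g x = y}})"
        using Xg countable_int_lattice disj by (intro emeasure_UN_countable[symmetric]) auto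
      also have "ennreal (real (card \<T>) * b) * \<dots> \<le> ennreal (real (card \<T>) * b) * 1"
        by (intro mult_left_mono emeasure_le_1) auto
      finally show ?thesis using b0 by (simp add: emeasure_eq_measure)
    qed
    ultimately show ?thesis unfolding b_def p_def by blast
  qed
  then show thesis using that[of "real (card \<T>)"] by simp
qed

lemma cells_give_clique:
  assumes "\<And>i. i \<in> S \<Longrightarrow> X i \<omega> \<in> {y. N (y - c) < \<rho> / 2}"
  shows "clique \<rho> \<omega> S"
  unfolding clique_def
proof (intro ballI impI)
  fix i j assume "i \<in> S" "j \<in> S"
  then have "N (X i \<omega> - c) < \<rho> / 2" "N (X j \<omega> - c) < \<rho> / 2" using assms by auto
  then show "N (X i \<omega> - X j \<omega>) \<le> \<rho>"
    using N_triangle_diff[of "X i \<omega>" "X j \<omega>" c] N_minus_commute[of c "X j \<omega>"] by linarith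
qed

text \<open>The points in any one ball of diameter \<open>\<rho>\<close> form a clique, so a lower
  tail bound for a single heavy ball suffices. This is enough when the mean occupation is much
  larger than \<open>ln n\<close>.\<close>

lemma prob_no_clique_single_ball:
  assumes \<epsilon>: "0 < \<epsilon>" "\<epsilon> < 1"
  obtains r0 where "0 < r0"
    "\<And>\<rho> n k x. \<lbrakk>0 < \<rho>; \<rho> < r0; 0 < x; x \<le> 1\<rbrakk> \<Longrightarrow>
       \<exists>E\<in>events. {\<omega>\<in>space M. \<forall>S\<subseteq>{1..n}. clique \<rho> \<omega> S \<longrightarrow> card S \<le> k} \<subseteq> E \<and>
         prob E \<le> (1 / x) ^ k * exp (real n * ((1 - \<epsilon>) * (\<sigma> * volB * (\<rho> / 2) ^ DIM('a))) * (x - 1))"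
proof -
  obtain c r0 where c: "c > 0" "r0 > 0"
    "\<And>\<rho>. 0 < \<rho> \<Longrightarrow> \<rho> < r0 \<Longrightarrow> \<exists>C. finite C \<and> c \<le> real (card C) * \<rho> ^ DIM('a) \<and>
        disjoint_family_on (\<lambda>x. {y. N (y - x) < \<rho> / 2}) C \<and>
        (\<forall>x\<in>C. (1 - \<epsilon>) * (\<sigma> * volB * (\<rho> / 2) ^ DIM('a)) \<le> \<nu> {y. N (y - x) < \<rho> / 2})"
    using dense_packing[OF \<epsilon>] by blast
  show thesis
  proof (rule that[OF c(2)])
    fix \<rho> n k x assume \<rho>: "0 < \<rho>" "\<rho> < r0" and x: "0 < (x::real)" "x \<le> 1"
    obtain C where C: "finite C" "c \<le> real (card C) * \<rho> ^ DIM('a)"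
        "\<forall>x\<in>C. (1 - \<epsilon>) * (\<sigma> * volB * (\<rho> / 2) ^ DIM('a)) \<le> \<nu> {y. N (y - x) < \<rho> / 2}"
      using c(3)[OF \<rho>] by blast
    have "C \<noteq> {}" using C(2) c(1) by auto
    then obtain y where y: "y \<in> C" by blast
    define A where "A = {z. N (z - y) < \<rho> / 2}"
    have Ab: "A \<in> sets borel" unfolding A_def using open_Nball by (rule borel_open)
    let ?E = "{\<omega>\<in>space M. card {i\<in>{1..n}. X i \<omega> \<in> A} \<le> k}"
    have "?E \<in> events" using Ab by (intro events_index_set[where Q = "\<lambda>L. card L \<le> k"]) auto
    moreover have "{\<omega>\<in>space M. \<forall>S\<subseteq>{1..n}. clique \<rho> \<omega> S \<longrightarrow> card S \<le> k} \<subseteq> ?E"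
    proof
      fix \<omega> assume \<omega>: "\<omega> \<in> {\<omega>\<in>space M. \<forall>S\<subseteq>{1..n}. clique \<rho> \<omega> S \<longrightarrow> card S \<le> k}"
      have "clique \<rho> \<omega> {i\<in>{1..n}. X i \<omega> \<in> A}" by (rule cells_give_clique[of _ _ y]) (auto simp: A_def)
      moreover have "{i\<in>{1..n}. X i \<omega> \<in> A} \<subseteq> {1..n}" by blast
      ultimately show "\<omega> \<in> ?E" using \<omega> by blast
    qed
    moreover have "(1 - \<epsilon>) * (\<sigma> * volB * (\<rho> / 2) ^ DIM('a)) \<le> \<nu> A"
      using C(3) y unfolding A_def by blast
    then have "prob ?E \<le> (1 / x) ^ k * exp (real n * ((1 - \<epsilon>) * (\<sigma> * volB * (\<rho> / 2) ^ DIM('a))) * (x - 1))"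
      using prob_count_le[OF finite_atLeastAtMost Ab x, of _ 1 n k] by simp
    ultimately show "\<exists>E\<in>events. {\<omega>\<in>space M. \<forall>S\<subseteq>{1..n}. clique \<rho> \<omega> S \<longrightarrow> card S \<le> k} \<subseteq> E \<and>
         prob E \<le> (1 / x) ^ k * exp (real n * ((1 - \<epsilon>) * (\<sigma> * volB * (\<rho> / 2) ^ DIM('a))) * (x - 1))"
      by blast
  qed
qed

text \<open>Among order \<open>\<rho>^(-d)\<close> balls of total mass at most
  \<open>\<epsilon> / 2\<close>, either at least \<open>\<epsilon> * n\<close> points fall into the
  balls, which is exponentially unlikely, or at least
  \<open>n - nat \<lceil>\<epsilon> * n\<rceil>\<close> points lie outside and the sequential
  exposure applies. The latter gives \<open>(1 - q)^m \<le> exp (- m * q)\<close>.\<close>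

lemma prob_no_clique_le:
  assumes \<epsilon>: "0 < \<epsilon>" "\<epsilon> < 1"
  obtains c r0 \<kappa> where "0 < c" "0 < r0" "0 < \<kappa>"
    "\<And>\<rho> n k. \<lbrakk>0 < \<rho>; \<rho> < r0\<rbrakk> \<Longrightarrow>
       \<exists>E\<in>events. {\<omega>\<in>space M. \<forall>S\<subseteq>{1..n}. clique \<rho> \<omega> S \<longrightarrow> card S < k} \<subseteq> E \<and>
         prob E \<le> exp (- \<kappa> * real n) + exp (- (c / \<rho> ^ DIM('a) * (real ((n - nat \<lceil>\<epsilon> * real n\<rceil>) choose k) *
            ((1 - \<epsilon>) * (\<sigma> * volB * (\<rho> / 2) ^ DIM('a))) ^ k * (1 - (1 + \<epsilon>) * (\<sigma> * volB * (\<rho> / 2) ^ DIM('a))) ^ n)))"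
proof -
  obtain c0 r1 where c0: "c0 > 0" "r1 > 0"
    "\<And>\<rho>. 0 < \<rho> \<Longrightarrow> \<rho> < r1 \<Longrightarrow> \<exists>C. finite C \<and> c0 \<le> real (card C) * \<rho> ^ DIM('a) \<and>
        disjoint_family_on (\<lambda>x. {y. N (y - x) < \<rho> / 2}) C \<and>
        (\<forall>x\<in>C. (1 - \<epsilon>) * (\<sigma> * volB * (\<rho> / 2) ^ DIM('a)) \<le> \<nu> {y. N (y - x) < \<rho> / 2})"
    using dense_packing[OF \<epsilon>] by blast
  \<comment> \<open>The second entry of the minimum caps the number of balls used, so that their
    total mass stays below \<open>\<epsilon> / 2\<close>.\<close>
  define c1 where "c1 = min c0 (\<epsilon> / 2 * 2 ^ DIM('a) / (\<sigma> * volB))"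
  have c1: "c1 > 0" "c1 \<le> c0" "c1 * (\<sigma> * volB) \<le> \<epsilon> / 2 * 2 ^ DIM('a)"
  proof -
    show "c1 > 0" using c0 \<epsilon> \<sigma>_pos volB_pos by (simp add: c1_def)
    have "c1 \<le> \<epsilon> / 2 * 2 ^ DIM('a) / (\<sigma> * volB)" by (simp add: c1_def)
    then show "c1 * (\<sigma> * volB) \<le> \<epsilon> / 2 * 2 ^ DIM('a)"
      using \<sigma>_pos volB_pos by (simp add: pos_le_divide_eq)
  qed (simp add: c1_def)
  \<comment> \<open>For \<open>\<rho>\<close> below 1 and \<open>c1\<close> one has
    \<open>\<rho>^d \<le> \<rho> \<le> c1\<close>, so rounding \<open>c1 / \<rho>^d\<close> down
    leaves at least one ball and loses at most a factor 2.\<close>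
  define r0 where "r0 = min r1 (min 1 c1)"
  \<comment> \<open>The Chernoff rate at \<open>x = 2\<close> for at least
    \<open>\<epsilon> * n\<close> successes with mean at most
    \<open>\<epsilon> * n / 2\<close>.\<close>
  define \<kappa> where "\<kappa> = \<epsilon> * (ln 2 - 1 / 2)"
  have \<kappa>: "\<kappa> > 0" using \<epsilon> ln2_ge_two_thirds by (simp add: \<kappa>_def)
  show thesis
  proof (rule that[of "c1 / 2" r0 \<kappa>])
    show "0 < c1 / 2" "0 < r0" "0 < \<kappa>" using c1 c0 \<kappa> by (auto simp: r0_def)
    fix \<rho> :: real and n k :: nat assume \<rho>: "0 < \<rho>" "\<rho> < r0"
    obtain C where C: "finite C" "c0 \<le> real (card C) * \<rho> ^ DIM('a)"
        "disjoint_family_on (\<lambda>x. {y. N (y - x) < \<rho> / 2}) C"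
        "\<And>x. x \<in> C \<Longrightarrow> (1 - \<epsilon>) * (\<sigma> * volB * (\<rho> / 2) ^ DIM('a)) \<le> \<nu> {y. N (y - x) < \<rho> / 2}"
      using c0(3)[of \<rho>] \<rho> unfolding r0_def by auto
    define P where "P = \<sigma> * volB * (\<rho> / 2) ^ DIM('a)"
    have P: "P > 0" using \<sigma>_pos volB_pos \<rho> by (simp add: P_def)
    define rd where "rd = \<rho> ^ DIM('a)"
    have rd: "0 < rd" "rd \<le> c1"
    proof -
      have "\<rho> ^ DIM('a) \<le> \<rho> ^ 1" using \<rho> by (intro power_decreasing) (auto simp: r0_def Suc_le_eq)
      then show "rd \<le> c1" using \<rho> by (simp add: rd_def r0_def)
    qed (use \<rho> in \<open>simp add: rd_def\<close>)
    define m where "m = nat \<lfloor>c1 / rd\<rfloor>"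
    have "1 \<le> c1 / rd" using rd by simp
    then have "1 \<le> \<lfloor>c1 / rd\<rfloor>" by linarith
    then have rm: "real m = of_int \<lfloor>c1 / rd\<rfloor>" "1 \<le> real m" unfolding m_def by simp_all
    have rm': "c1 / rd - 1 \<le> real m" "real m \<le> c1 / rd" unfolding rm(1) by linarith+
    have half: "y / 2 \<le> z" if "1 \<le> z" "y - 1 \<le> z" for y z :: real using that by linarith
    have m: "1 \<le> m" "real m \<le> c1 / rd" "c1 / rd / 2 \<le> real m"
      using rm(2) rm'(2) half[OF rm(2) rm'(1)] by auto
    have "real m \<le> real (card C)"
    proof -
      have "c1 / rd \<le> real (card C)" using C(2) c1(2) rd unfolding rd_def[symmetric] by (simp add: field_simps)
      then show ?thesis using m by linarith
    qed
    then obtain C' where C': "C' \<subseteq> C" "card C' = m" "finite C'"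
      using obtain_subset_with_card_n[of m C] by auto
    define A where "A x = {y. N (y - x) < \<rho> / 2}" for x
    have Ab: "A x \<in> sets borel" for x unfolding A_def using open_Nball by (rule borel_open)
    have Anu: "\<nu> (A x) \<le> P" for x
    proof -
      have "\<nu> (A x) \<le> \<sigma> * measure lborel (A x)"
        by (rule \<nu>_le[OF Ab]) (unfold A_def, rule emeasure_lborel_bounded_finite[OF bounded_Nball])
      also have "measure lborel (A x) = (\<rho> / 2) ^ DIM('a) * volB"
        unfolding A_def by (rule measure_Nball) (use \<rho> in simp)
      finally show ?thesis by (simp add: P_def mult_ac)
    qed
    have mP: "real m * P \<le> \<epsilon> / 2"
    proof -
      have "real m * P \<le> c1 / rd * P" using m P by (intro mult_right_mono) auto
      also have "\<dots> = c1 * (\<sigma> * volB) / 2 ^ DIM('a)" using \<rho> by (simp add: P_def power_divide rd_def)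
      also have "\<dots> \<le> \<epsilon> / 2" using c1(3) by (simp add: field_simps)
      finally show ?thesis .
    qed
    define O' where "O' = UNIV - (\<Union>x\<in>C'. A x)"
    have Ob: "(\<Union>x\<in>C'. A x) \<in> sets borel" "O' \<in> sets borel"
      unfolding O'_def using Ab C' by (auto intro!: sets.finite_UN)
    have Unu: "\<nu> (\<Union>x\<in>C'. A x) \<le> \<epsilon> / 2"
    proof -
      interpret Dn: prob_space "density lborel (\<lambda>x. ennreal (f x))" by (rule prob_space_density)
      have "\<nu> (\<Union>x\<in>C'. A x) \<le> (\<Sum>x\<in>C'. \<nu> (A x))"
        unfolding \<nu>_def using Ab C' by (intro Dn.finite_measure_subadditive_finite) auto
      also have "\<dots> \<le> (\<Sum>x\<in>C'. P)" using Anu by (intro sum_mono)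
      also have "\<dots> \<le> \<epsilon> / 2" using C' mP by simp
      finally show ?thesis .
    qed
    have Onu: "1 - \<epsilon> / 2 \<le> \<nu> O'" using Unu Ob \<nu>_diff[of "\<Union>x\<in>C'. A x" UNIV] by (simp add: O'_def \<nu>_UNIV)
    define b where "b = n - nat \<lceil>\<epsilon> * real n\<rceil>"
    define q where "q = real (b choose k) * ((1 - \<epsilon>) * P) ^ k * (1 - (1 + \<epsilon>) * P) ^ n"
    have "1 * P \<le> real m * P" using m(1) P by (intro mult_right_mono) auto
    then have P2: "P \<le> \<epsilon> / 2" using mP by linarith
    have P': "(1 + \<epsilon>) * P \<le> 1"
    proof -
      have "(1 + \<epsilon>) * P \<le> 2 * (1 / 2)" using \<epsilon> P P2 by (intro mult_mono) auto
      then show ?thesis by simp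
    qed
    \<comment> \<open>A ball of mass at most \<open>P\<close> has relative mass at most
      \<open>(1 + \<epsilon>) * P\<close> in any region of mass at least
      \<open>1 - \<epsilon> / 2\<close>.\<close>
    have PP': "P \<le> (1 + \<epsilon>) * P * (1 - \<epsilon> / 2)"
    proof -
      have "1 \<le> (1 + \<epsilon>) * (1 - \<epsilon> / 2)" using \<epsilon> mult_left_le_one_le[of \<epsilon> \<epsilon>] by (simp add: algebra_simps)
      from mult_right_mono[OF this, of P] show ?thesis using P by (simp add: mult_ac)
    qed
    have q1: "q \<le> 1" unfolding q_def
    proof (rule binomial_pow_le_1)
      show "(1 - \<epsilon>) * P \<le> (1 + \<epsilon>) * P" using \<epsilon> P by (intro mult_right_mono) auto
    qed (use \<epsilon> P P' in \<open>auto simp: b_def\<close>)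
    let ?E1 = "{\<omega>\<in>space M. (\<forall>c\<in>C'. card {i\<in>{1..n}. X i \<omega> \<in> A c} < k) \<and> b \<le> card {i\<in>{1..n}. X i \<omega> \<in> O'}}"
    let ?l = "nat \<lceil>\<epsilon> * real n\<rceil>"
    \<comment> \<open>Fewer than \<open>?l\<close> points in the balls leaves at least
      \<open>n - ?l = b\<close> outside, so the two events cover the absence of a large
      clique.\<close>
    let ?E2 = "{\<omega>\<in>space M. ?l \<le> card {i\<in>{1..n}. X i \<omega> \<in> (\<Union>x\<in>C'. A x)}}"
    have E1: "?E1 \<in> events"
    proof -
      have 3: "{\<omega>\<in>space M. \<forall>c\<in>C'. card {i\<in>{1..n}. X i \<omega> \<in> A c} < k} \<in> events"
        using C' Ab by (intro sets.sets_Collect_finite_All events_index_set[where Q = "\<lambda>L. card L < k"]) auto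
      have 4: "{\<omega>\<in>space M. b \<le> card {i\<in>{1..n}. X i \<omega> \<in> O'}} \<in> events"
        using Ob by (intro events_index_set[where Q = "\<lambda>L. b \<le> card L"]) auto
      have "?E1 = {\<omega>\<in>space M. \<forall>c\<in>C'. card {i\<in>{1..n}. X i \<omega> \<in> A c} < k} \<inter> {\<omega>\<in>space M. b \<le> card {i\<in>{1..n}. X i \<omega> \<in> O'}}"
        by auto
      then show ?thesis using sets.Int[OF 3 4] by simp
    qed
    have E2: "?E2 \<in> events" using Ob by (intro events_index_set[where Q = "\<lambda>L. ?l \<le> card L"]) auto
    have "prob {\<omega>\<in>space M. (\<forall>h\<in>{}. X h \<omega> \<in> UNIV) \<and> (\<forall>i\<in>{1..n}. X i \<omega> \<in> UNIV) \<and>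
      (\<forall>c\<in>C'. card {i\<in>{1..n}. X i \<omega> \<in> A c} < k) \<and> b \<le> card {i\<in>{1..n}. X i \<omega> \<in> O'}} \<le>
     (\<Prod>h\<in>({}::nat set). \<nu> UNIV) * \<nu> UNIV ^ card {1..n} * (1 - q) ^ card C'"
    proof (rule prob_no_full_cell[where p = "(1 - \<epsilon>) * P" and P' = "(1 + \<epsilon>) * P" and ?s0.0 = "1 - \<epsilon> / 2" and ?n0.0 = n])
      show "disjoint_family_on A C'" using C(3) C'(1) unfolding A_def[abs_def] disjoint_family_on_def by blast
      show "\<nu> (A c) \<le> (1 + \<epsilon>) * P * (1 - \<epsilon> / 2)" for c using Anu[of c] PP' by linarith
      show "(1 - \<epsilon>) * P \<le> \<nu> (A c)" if "c \<in> C'" for c using C(4)[of c] that C'(1) unfolding A_def P_def by blast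
    qed (use C' Ab Ob Onu \<epsilon> P P' q1 in \<open>auto simp: q_def O'_def\<close>)
    then have "prob ?E1 \<le> (1 - q) ^ m" using C' by (simp add: \<nu>_UNIV)
    also have "\<dots> \<le> exp (- q) ^ m" using q1 exp_ge_add_one_self[of "- q"] by (intro power_mono) auto
    also have "\<dots> = exp (- (real m * q))" by (simp add: exp_of_nat_mult[symmetric])
    also have "\<dots> \<le> exp (- (c1 / 2 / rd * q))"
    proof -
      have "0 \<le> q" unfolding q_def using \<epsilon> P P' by simp
      then have "c1 / 2 / rd * q \<le> real m * q" using m(3) by (intro mult_right_mono) auto
      then show ?thesis by simp
    qed
    finally have p1: "prob ?E1 \<le> exp (- (c1 / 2 / rd * q))" .
    have "prob {\<omega>\<in>space M. (\<forall>h\<in>{}. X h \<omega> \<in> UNIV) \<and> ?l \<le> card {i\<in>{1..n}. X i \<omega> \<in> (\<Union>x\<in>C'. A x)}} \<le>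
       (\<Prod>h\<in>({}::nat set). \<nu> UNIV) * ((1 / 2) ^ ?l * exp (real (card {1..n}) * (\<epsilon> / 2) * (2 - 1)))"
      by (rule prob_count_ge) (use Ob Unu in auto)
    then have "prob ?E2 \<le> (1 / 2) ^ ?l * exp (real n * \<epsilon> / 2)" by simp
    also have "(1 / 2 :: real) ^ ?l = exp (- (ln 2 * real ?l))"
      using exp_of_nat_mult[of ?l "- ln (2::real)"] by (simp add: exp_minus inverse_eq_divide mult.commute)
    also have "\<dots> * exp (real n * \<epsilon> / 2) = exp (real n * \<epsilon> / 2 - ln 2 * real ?l)"
      by (simp add: exp_add[symmetric])
    also have "\<dots> \<le> exp (- \<kappa> * real n)"
    proof -
      have "\<epsilon> * real n \<le> real ?l" by (rule of_nat_ceiling)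
      then have "ln 2 * (\<epsilon> * real n) \<le> ln 2 * real ?l" by (intro mult_left_mono) auto
      then show ?thesis by (simp add: \<kappa>_def algebra_simps)
    qed
    finally have p2: "prob ?E2 \<le> exp (- \<kappa> * real n)" .
    have "{\<omega>\<in>space M. \<forall>S\<subseteq>{1..n}. clique \<rho> \<omega> S \<longrightarrow> card S < k} \<subseteq> ?E2 \<union> ?E1"
    proof
      fix \<omega> assume \<omega>: "\<omega> \<in> {\<omega>\<in>space M. \<forall>S\<subseteq>{1..n}. clique \<rho> \<omega> S \<longrightarrow> card S < k}"
      have "card {i\<in>{1..n}. X i \<omega> \<in> A c} < k" for c
      proof -
        have "clique \<rho> \<omega> {i\<in>{1..n}. X i \<omega> \<in> A c}" by (rule cells_give_clique[of _ _ c]) (auto simp: A_def)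
        moreover have "{i\<in>{1..n}. X i \<omega> \<in> A c} \<subseteq> {1..n}" by blast
        ultimately show ?thesis using \<omega> by blast
      qed
      moreover have "n = card {i\<in>{1..n}. X i \<omega> \<in> O'} + card {i\<in>{1..n}. X i \<omega> \<in> (\<Union>x\<in>C'. A x)}"
      proof -
        have "{1..n} = {i\<in>{1..n}. X i \<omega> \<in> O'} \<union> {i\<in>{1..n}. X i \<omega> \<in> (\<Union>x\<in>C'. A x)}" by (auto simp: O'_def)
        then have "card {1..n} = card ({i\<in>{1..n}. X i \<omega> \<in> O'} \<union> {i\<in>{1..n}. X i \<omega> \<in> (\<Union>x\<in>C'. A x)})" by (rule arg_cong)
        also have "\<dots> = card {i\<in>{1..n}. X i \<omega> \<in> O'} + card {i\<in>{1..n}. X i \<omega> \<in> (\<Union>x\<in>C'. A x)}"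
          by (intro card_Un_disjoint) (auto simp: O'_def)
        finally show ?thesis by simp
      qed
      then have "b \<le> card {i\<in>{1..n}. X i \<omega> \<in> O'} \<or> ?l \<le> card {i\<in>{1..n}. X i \<omega> \<in> (\<Union>x\<in>C'. A x)}"
        unfolding b_def by linarith
      ultimately show "\<omega> \<in> ?E2 \<union> ?E1" using \<omega> by auto
    qed
    moreover have "?E2 \<union> ?E1 \<in> events" using E1 E2 by (rule sets.Un[rotated])
    moreover have "prob (?E2 \<union> ?E1) \<le> exp (- \<kappa> * real n) + exp (- (c1 / 2 / rd * q))"
      using measure_Un_le[OF E2 E1] p1 p2 by linarith
    ultimately show "\<exists>E\<in>events. {\<omega>\<in>space M. \<forall>S\<subseteq>{1..n}. clique \<rho> \<omega> S \<longrightarrow> card S < k} \<subseteq> E \<and>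
         prob E \<le> exp (- \<kappa> * real n) + exp (- (c1 / 2 / \<rho> ^ DIM('a) * (real ((n - nat \<lceil>\<epsilon> * real n\<rceil>) choose k) *
            ((1 - \<epsilon>) * (\<sigma> * volB * (\<rho> / 2) ^ DIM('a))) ^ k * (1 - (1 + \<epsilon>) * (\<sigma> * volB * (\<rho> / 2) ^ DIM('a))) ^ n)))"
      unfolding q_def P_def b_def rd_def by blast
  qed
qed

end

section \<open>Almost sure upper bounds\<close>

lemma eventually_at_right_0_between:
  "0 < c \<Longrightarrow> eventually (\<lambda>x::real. 0 < x \<and> x < c) (at_right 0)"
  using eventually_at_right_real[of 0 c] by simp

text \<open>Borel-Cantelli with measurable covers: the bad sets are only shown to lie inside events
  \<open>E\<close>, so their own measurability never has to be proved.\<close>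

lemma (in prob_space) AE_eventually_not:
  assumes "eventually (\<lambda>n. \<exists>E\<in>events. {\<omega>\<in>space M. Bad n \<omega>} \<subseteq> E \<and> prob E \<le> u n) sequentially"
    and "summable u"
  shows "AE \<omega> in M. eventually (\<lambda>n. \<not> Bad n \<omega>) sequentially"
proof -
  obtain n0 where n0: "\<And>n. n \<ge> n0 \<Longrightarrow> \<exists>E\<in>events. {\<omega>\<in>space M. Bad n \<omega>} \<subseteq> E \<and> prob E \<le> u n"
    using assms(1) unfolding eventually_sequentially by blast
  then obtain E where E: "\<And>n. n \<ge> n0 \<Longrightarrow> E n \<in> events \<and> {\<omega>\<in>space M. Bad n \<omega>} \<subseteq> E n \<and> prob (E n) \<le> u n"
    by metis
  define E' where "E' n = (if n \<ge> n0 then E n else {})" for n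
  have "AE \<omega> in M. eventually (\<lambda>n. \<omega> \<in> space M - E' n) sequentially"
  proof (rule borel_cantelli_AE1)
    show "E' n \<in> events" for n using E by (simp add: E'_def)
    show "summable (\<lambda>n. prob (E' n))"
      by (rule summable_comparison_test_ev[OF _ assms(2)])
         (use E in \<open>auto simp: eventually_sequentially E'_def intro!: exI[of _ n0]\<close>)
  qed (simp add: emeasure_eq_measure)
  then show ?thesis
  proof (rule AE_mp, intro AE_I2 impI)
    fix \<omega> assume \<omega>: "\<omega> \<in> space M" "eventually (\<lambda>n. \<omega> \<in> space M - E' n) sequentially"
    from \<omega>(2) eventually_ge_at_top[of n0] show "eventually (\<lambda>n. \<not> Bad n \<omega>) sequentially"
      by eventually_elim (use E \<omega>(1) in \<open>auto simp: E'_def\<close>)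
  qed
qed

lemma geom_clique_number_ge_iff:
  "k \<le> geom_clique_number N \<rho> x n \<longleftrightarrow>
     (\<exists>S\<subseteq>{1..n}. (\<forall>i\<in>S. \<forall>j\<in>S. i \<noteq> j \<longrightarrow> N (x i - x j) \<le> \<rho>) \<and> k \<le> card S)"
proof -
  let ?A = "{card S | S. S \<subseteq> {1..n} \<and> (\<forall>i\<in>S. \<forall>j\<in>S. i \<noteq> j \<longrightarrow> N (x i - x j) \<le> \<rho>)}"
  have "finite ?A" by (rule finite_subset[of _ "card ` Pow {1..n}"]) auto
  moreover have "card {} \<in> ?A" by force
  ultimately have "k \<le> Max ?A \<longleftrightarrow> (\<exists>a\<in>?A. k \<le> a)" by (intro Max_ge_iff) auto
  then show ?thesis unfolding geom_clique_number_def by blast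
qed

lemma summable_nat_powr: "\<delta> > 0 \<Longrightarrow> summable (\<lambda>n. real n powr (- 1 - \<delta>))"
  by (subst summable_real_powr_iff) simp

context random_points
begin

text \<open>Coinciding points form a clique of size 2 at every radius, so the clique bound for the
  index set \<open>{i, j}\<close> applies with \<open>\<rho>\<close> tending to 0.\<close>

lemma AE_X_distinct: "AE \<omega> in M. \<forall>i j. i \<noteq> j \<longrightarrow> X i \<omega> \<noteq> X j \<omega>"
proof -
  obtain K where K: "0 \<le> K"
    "\<And>\<rho> I j l x. \<lbrakk>0 < \<rho>; finite I; j \<in> I; 1 \<le> x\<rbrakk> \<Longrightarrow>
       \<exists>E\<in>events. {\<omega>\<in>space M. \<exists>S\<subseteq>I. j \<in> S \<and> l + 1 \<le> card S \<and> clique \<rho> \<omega> S} \<subseteq> E \<and>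
         prob E \<le> K * ((1 / x) ^ l * exp (real (card I) * (\<sigma> * volB * ((1 + 1) * \<rho> / 2) ^ DIM('a)) * (x - 1)))"
    using prob_clique_through_le[of 1] by auto
  define Cc where "Cc = \<sigma> * volB"
  have Cc: "Cc > 0" using \<sigma>_pos volB_pos by (simp add: Cc_def)
  have one: "AE \<omega> in M. X i \<omega> \<noteq> X j \<omega>" if ij: "i \<noteq> j" for i j
  proof -
    let ?B = "{\<omega>\<in>space M. X i \<omega> = X j \<omega>}"
    have Bev: "?B \<in> events" by measurable
    have bound: "prob ?B \<le> K * exp (2 * Cc) * \<rho>" if \<rho>: "0 < \<rho>" "\<rho> \<le> 1" for \<rho>
    proof -
      \<comment> \<open>This choice keeps the Chernoff exponent below \<open>2 * Cc\<close> while
        the factor \<open>1 / x\<close> equals \<open>\<rho>^d\<close>.\<close>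
      define x where "x = 1 / \<rho> ^ DIM('a)"
      have rd: "0 < \<rho> ^ DIM('a)" "\<rho> ^ DIM('a) \<le> 1" using \<rho> by (auto intro: power_le_one)
      have x: "1 \<le> x" using rd by (simp add: x_def)
      obtain E where E: "E \<in> events" "{\<omega>\<in>space M. \<exists>S\<subseteq>{i,j}. j \<in> S \<and> 1 + 1 \<le> card S \<and> clique \<rho> \<omega> S} \<subseteq> E"
         "prob E \<le> K * ((1 / x) ^ 1 * exp (real (card {i,j}) * (\<sigma> * volB * ((1 + 1) * \<rho> / 2) ^ DIM('a)) * (x - 1)))"
        using K(2)[OF \<rho>(1) _ _ x, of "{i,j}" j 1] by auto
      have "?B \<subseteq> E"
      proof
        fix \<omega> assume \<omega>: "\<omega> \<in> ?B"
        then have "clique \<rho> \<omega> {i,j}" using \<rho> by (auto simp: clique_def N_zero_iff[THEN iffD2])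
        then show "\<omega> \<in> E" using \<omega> E(2) ij by (auto intro!: subsetD[OF E(2)] exI[of _ "{i,j}"])
      qed
      then have "prob ?B \<le> prob E" using E(1) by (intro finite_measure_mono) auto
      also have "\<dots> \<le> K * (\<rho> ^ DIM('a) * exp (2 * (Cc * \<rho> ^ DIM('a)) * (x - 1)))"
        using E(3) ij by (simp add: x_def Cc_def)
      also have "\<dots> \<le> K * (\<rho> * exp (2 * Cc))"
      proof (intro mult_left_mono mult_mono)
        show "\<rho> ^ DIM('a) \<le> \<rho>" using power_decreasing[of 1 "DIM('a)" \<rho>] \<rho> by (simp add: Suc_le_eq)
        have "2 * (Cc * \<rho> ^ DIM('a)) * (x - 1) \<le> 2 * (Cc * \<rho> ^ DIM('a)) * x"
          using Cc rd by (intro mult_left_mono) auto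
        also have "\<dots> = 2 * Cc" using \<rho> by (simp add: x_def)
        finally show "exp (2 * (Cc * \<rho> ^ DIM('a)) * (x - 1)) \<le> exp (2 * Cc)" by simp
      qed (use K \<rho> in auto)
      finally show ?thesis by (simp add: mult_ac)
    qed
    have "prob ?B \<le> 0"
    proof (rule LIMSEQ_le_const)
      show "(\<lambda>n. K * exp (2 * Cc) * (1 / real (Suc n))) \<longlonglongrightarrow> 0"
        by real_asymp
      show "\<exists>N. \<forall>n\<ge>N. prob ?B \<le> K * exp (2 * Cc) * (1 / real (Suc n))"
        by (intro exI[of _ 0] allI impI bound) auto
    qed
    then have "prob ?B = 0" using measure_nonneg[of M ?B] by linarith
    then have "emeasure M ?B = 0" by (simp add: emeasure_eq_measure)
    then show ?thesis using Bev by (intro AE_I[of _ _ ?B]) auto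
  qed
  have "AE \<omega> in M. \<forall>i\<in>UNIV. \<forall>j\<in>UNIV. i \<noteq> j \<longrightarrow> X i \<omega> \<noteq> X j \<omega>"
    using one by (intro AE_ball_countable') (auto intro: AE_mp)
  then show ?thesis by simp
qed

text \<open>
  The radius \<open>\<rho> j l\<close> may depend on the clique size \<open>s j l + 1\<close>, so that one null set serves all sizes.
  Only cliques whose largest index is \<open>j\<close> are counted: this saves the factor \<open>j\<close> of the union bound,
  and the remaining probabilities are summable without passing to a subsequence.
\<close>

lemma AE_no_new_clique:
  assumes \<epsilon>: "0 < \<epsilon>"
  obtains K where "0 \<le> K"
   "\<And>\<rho> s x u L. \<lbrakk>eventually (\<lambda>j. \<forall>l\<in>L. 0 < \<rho> j l \<and> 1 \<le> x j l \<and>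
         K * ((1 / x j l) ^ s j l * exp (real j * (\<sigma> * volB * ((1 + \<epsilon>) * \<rho> j l / 2) ^ DIM('a)) * (x j l - 1))) \<le> u j * (1/2) ^ l) sequentially;
         summable u; \<And>j. 0 \<le> u j\<rbrakk> \<Longrightarrow>
       AE \<omega> in M. eventually (\<lambda>j. \<forall>l\<in>L. \<not> (\<exists>S\<subseteq>{1..j}. j \<in> S \<and> s j l + 1 \<le> card S \<and> clique (\<rho> j l) \<omega> S)) sequentially"
proof -
  obtain K where K: "0 \<le> K"
    "\<And>\<rho> I j l x. \<lbrakk>0 < \<rho>; finite I; j \<in> I; 1 \<le> x\<rbrakk> \<Longrightarrow>
       \<exists>E\<in>events. {\<omega>\<in>space M. \<exists>S\<subseteq>I. j \<in> S \<and> l + 1 \<le> card S \<and> clique \<rho> \<omega> S} \<subseteq> E \<and>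
         prob E \<le> K * ((1 / x) ^ l * exp (real (card I) * (\<sigma> * volB * ((1 + \<epsilon>) * \<rho> / 2) ^ DIM('a)) * (x - 1)))"
    using prob_clique_through_le[OF \<epsilon>] by blast
  show thesis
  proof (rule that[OF K(1)])
    fix \<rho> x :: "nat \<Rightarrow> nat \<Rightarrow> real" and s :: "nat \<Rightarrow> nat \<Rightarrow> nat" and u :: "nat \<Rightarrow> real" and L :: "nat set"
    assume ev: "eventually (\<lambda>j. \<forall>l\<in>L. 0 < \<rho> j l \<and> 1 \<le> x j l \<and>
         K * ((1 / x j l) ^ s j l * exp (real j * (\<sigma> * volB * ((1 + \<epsilon>) * \<rho> j l / 2) ^ DIM('a)) * (x j l - 1))) \<le> u j * (1/2) ^ l) sequentially"
      and u: "summable u" and u0: "\<And>j. 0 \<le> u j"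
    define Bad where "Bad j \<omega> = (\<exists>l\<in>L. \<exists>S\<subseteq>{1..j}. j \<in> S \<and> s j l + 1 \<le> card S \<and> clique (\<rho> j l) \<omega> S)" for j \<omega>
    have "AE \<omega> in M. eventually (\<lambda>j. \<not> Bad j \<omega>) sequentially"
    proof (rule AE_eventually_not)
      \<comment> \<open>The factor 2 is the sum of the weights \<open>(1/2)^l\<close> over all
        clique sizes.\<close>
      show "summable (\<lambda>j. u j * 2)" using u by (rule summable_mult2)
      have "eventually (\<lambda>j. j \<ge> (1::nat)) sequentially" by (rule eventually_ge_at_top)
      with ev show "eventually (\<lambda>j. \<exists>E\<in>events. {\<omega>\<in>space M. Bad j \<omega>} \<subseteq> E \<and> prob E \<le> u j * 2) sequentially"
      proof eventually_elim
        case (elim j)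
        have "\<exists>E\<in>events. (l \<in> L \<longrightarrow> {\<omega>\<in>space M. \<exists>S\<subseteq>{1..j}. j \<in> S \<and> s j l + 1 \<le> card S \<and> clique (\<rho> j l) \<omega> S} \<subseteq> E) \<and>
            prob E \<le> u j * (1/2) ^ l" for l
        proof (cases "l \<in> L")
          case True
          then have "0 < \<rho> j l" "1 \<le> x j l" using elim by auto
          from K(2)[OF this(1) _ _ this(2), of "{1..j}" j "s j l"] elim(2)
          obtain E where "E \<in> events" "{\<omega>\<in>space M. \<exists>S\<subseteq>{1..j}. j \<in> S \<and> s j l + 1 \<le> card S \<and> clique (\<rho> j l) \<omega> S} \<subseteq> E"
            "prob E \<le> K * ((1 / x j l) ^ s j l * exp (real j * (\<sigma> * volB * ((1 + \<epsilon>) * \<rho> j l / 2) ^ DIM('a)) * (x j l - 1)))"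
            by auto
          then show ?thesis using elim(1) True by (intro bexI[of _ E] conjI impI) force+
        next
          case False
          then show ?thesis using u0[of j] by (intro bexI[of _ "{}"]) auto
        qed
        then have "\<forall>l. \<exists>E. E \<in> events \<and> (l \<in> L \<longrightarrow> {\<omega>\<in>space M. \<exists>S\<subseteq>{1..j}. j \<in> S \<and> s j l + 1 \<le> card S \<and> clique (\<rho> j l) \<omega> S} \<subseteq> E) \<and>
            prob E \<le> u j * (1/2) ^ l" by blast
        from choice[OF this] obtain E where "\<forall>l. E l \<in> events \<and> (l \<in> L \<longrightarrow> {\<omega>\<in>space M. \<exists>S\<subseteq>{1..j}. j \<in> S \<and> s j l + 1 \<le> card S \<and> clique (\<rho> j l) \<omega> S} \<subseteq> E l) \<and>
            prob (E l) \<le> u j * (1/2) ^ l" by (rule exE)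
        then have E: "\<And>l. E l \<in> events" "\<And>l. prob (E l) \<le> u j * (1/2) ^ l"
          "\<And>l. l \<in> L \<Longrightarrow> {\<omega>\<in>space M. \<exists>S\<subseteq>{1..j}. j \<in> S \<and> s j l + 1 \<le> card S \<and> clique (\<rho> j l) \<omega> S} \<subseteq> E l"
          by simp_all
        have sm: "summable (\<lambda>l. u j * (1/2::real) ^ l)" by (intro summable_mult summable_geometric) simp
        have sm': "summable (\<lambda>l. prob (E l))"
          by (rule summable_comparison_test[OF _ sm]) (use E(2) in auto)
        have "prob (\<Union>l. E l) \<le> (\<Sum>l. prob (E l))"
          using E(1) sm' by (intro finite_measure_subadditive_countably) auto
        also have "\<dots> \<le> (\<Sum>l. u j * (1/2) ^ l)" by (intro suminf_le E(2) sm sm')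
        also have "\<dots> = u j * 2" by (subst suminf_mult) (auto simp: suminf_geometric intro!: summable_geometric)
        finally have "prob (\<Union>l. E l) \<le> u j * 2" .
        moreover have "{\<omega>\<in>space M. Bad j \<omega>} \<subseteq> (\<Union>l. E l)" unfolding Bad_def using E(3) by blast
        moreover have "(\<Union>l. E l) \<in> events" using E(1) by auto
        ultimately show ?case by blast
      qed
    qed
    then show "AE \<omega> in M. eventually (\<lambda>j. \<forall>l\<in>L. \<not> (\<exists>S\<subseteq>{1..j}. j \<in> S \<and> s j l + 1 \<le> card S \<and> clique (\<rho> j l) \<omega> S)) sequentially"
      unfolding Bad_def by simp
  qed
qed

end

section \<open>The graph process and its upper bounds in the sparse, critical and dense
  regimes\<close>

locale random_geometric_graph = random_points N f M X
  for N :: "'a::euclidean_space \<Rightarrow> real" and f :: "'a \<Rightarrow> real" and M :: "'w measure" and X :: "nat \<Rightarrow> 'w \<Rightarrow> 'a" +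
  fixes r :: "nat \<Rightarrow> real"
  assumes r_pos: "\<And>n. r n > 0" and r_lim: "r \<longlonglongrightarrow> 0"
begin

definition cl :: "nat \<Rightarrow> 'w \<Rightarrow> nat" where
  "cl n \<omega> = geom_clique_number N (r n) (\<lambda>i. X i \<omega>) n"

lemma cl_ge_iff: "k \<le> cl n \<omega> \<longleftrightarrow> (\<exists>S\<subseteq>{1..n}. clique (r n) \<omega> S \<and> k \<le> card S)"
  unfolding cl_def geom_clique_number_ge_iff clique_def ..

lemma cl_pos: "n \<ge> 1 \<Longrightarrow> 1 \<le> cl n \<omega>"
  unfolding cl_ge_iff by (rule exI[of _ "{1}"]) (auto simp: clique_def)

text \<open>Borel-Cantelli controls cliques whose largest index is at least some random
  \<open>J\<close>. Those among the first \<open>J\<close> points disappear because the points are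
  distinct and \<open>r\<close> tends to 0.\<close>

lemma AE_first_points_separated:
  "AE \<omega> in M. \<forall>J. eventually (\<lambda>n. \<forall>S\<subseteq>{..J}. 2 \<le> card S \<longrightarrow> \<not> clique (r n) \<omega> S) sequentially"
  using AE_X_distinct
proof eventually_elim
  case (elim \<omega>)
  show ?case
  proof
    fix J
    have "eventually (\<lambda>n. i \<noteq> j \<longrightarrow> r n < N (X i \<omega> - X j \<omega>)) sequentially" for i j
    proof (cases "i = j")
      case False
      then have "0 < N (X i \<omega> - X j \<omega>)" using elim by (intro N_pos) simp
      from order_tendstoD(2)[OF r_lim this] show ?thesis by (rule eventually_mono) simp
    qed simp
    then have "eventually (\<lambda>n. \<forall>i\<in>{..J}. \<forall>j\<in>{..J}. i \<noteq> j \<longrightarrow> r n < N (X i \<omega> - X j \<omega>)) sequentially"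
      by (intro eventually_ball_finite ballI) auto
    then show "eventually (\<lambda>n. \<forall>S\<subseteq>{..J}. 2 \<le> card S \<longrightarrow> \<not> clique (r n) \<omega> S) sequentially"
    proof eventually_elim
      case (elim n)
      show ?case
      proof (intro allI impI notI)
        fix S assume S: "S \<subseteq> {..J}" "2 \<le> card S" "clique (r n) \<omega> S"
        have "finite S" using S(1) finite_subset by blast
        then obtain i j where "i \<in> S" "j \<in> S" "i \<noteq> j"
          using S(2) card_le_Suc0_iff_eq[of S] by fastforce
        then show False using S elim unfolding clique_def by (meson leD subsetD)
      qed
    qed
  qed
qed

lemma clique_mono: "clique \<rho> \<omega> S \<Longrightarrow> \<rho> \<le> \<rho>' \<Longrightarrow> clique \<rho>' \<omega> S"
  unfolding clique_def by force

text \<open>The events for \<open>j\<close> use a radius \<open>\<rho> j l\<close> at which a clique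
  of size \<open>l + 1\<close> with largest index \<open>j\<close> has probability of order
  \<open>j^(-1 - \<delta>) 2^(-l)\<close>. Hence such a clique at time \<open>n\<close> forces
  \<open>r n > \<rho> j l\<close>, and since \<open>\<rho>\<close> decreases in
  \<open>j \<le> n\<close> this becomes a bound in \<open>n\<close>. It holds for all
  \<open>l\<close> outside one null set, as needed when the clique size grows with
  \<open>n\<close>.\<close>

lemma clique_number_upper_sparse:
  assumes \<delta>: "\<delta> > 0"
  obtains c where "c > 0" "AE \<omega> in M. eventually (\<lambda>n. \<forall>l\<ge>1. l + 1 \<le> cl n \<omega> \<longrightarrow>
      c * real l * real n powr (- (1 + \<delta>) / real l) < real n * r n ^ DIM('a)) sequentially"
proof -
  obtain K where K: "0 \<le> K"
   "\<And>\<rho> s x u L. \<lbrakk>eventually (\<lambda>j. \<forall>l\<in>L. 0 < \<rho> j l \<and> 1 \<le> x j l \<and>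
         K * ((1 / x j l) ^ s j l * exp (real j * (\<sigma> * volB * ((1 + 1) * \<rho> j l / 2) ^ DIM('a)) * (x j l - 1))) \<le> u j * (1/2) ^ l) sequentially;
         summable u; \<And>j. 0 \<le> u j\<rbrakk> \<Longrightarrow>
       AE \<omega> in M. eventually (\<lambda>j. \<forall>l\<in>L. \<not> (\<exists>S\<subseteq>{1..j}. j \<in> S \<and> s j l + 1 \<le> card S \<and> clique (\<rho> j l) \<omega> S)) sequentially"
    using AE_no_new_clique[OF zero_less_one] by blast
  define C where "C = \<sigma> * volB"
  have C: "C > 0" using \<sigma>_pos volB_pos by (simp add: C_def)
  \<comment> \<open>With \<open>x = 2 * exp 1 * j^(a l)\<close> and
    \<open>\<rho>^d = c * l * j^(-1 - a l)\<close> the Chernoff exponent is at most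
    \<open>l\<close>. The bound becomes \<open>(j^(- a l) / 2)^l\<close>, and \<open>a l\<close> is
    chosen so that this is \<open>j^(-1 - \<delta>) 2^(-l)\<close>.\<close>
  define c where "c = 1 / (2 * exp 1 * C)"
  have c: "c > 0" using C by (simp add: c_def)
  define a where "a l = (1 + \<delta>) / real l" for l
  define \<rho> where "\<rho> j l = root DIM('a) (c * real l * real j powr (- 1 - a l))" for j l
  have \<rho>d: "\<rho> j l ^ DIM('a) = c * real l * real j powr (- 1 - a l)" for j l
    unfolding \<rho>_def using c by (intro real_root_pow_pos2) auto
  have "AE \<omega> in M. eventually (\<lambda>j. \<forall>l\<in>{1..}. \<not> (\<exists>S\<subseteq>{1..j}. j \<in> S \<and> l + 1 \<le> card S \<and> clique (\<rho> j l) \<omega> S)) sequentially"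
  proof (rule K(2)[of "{1..}" \<rho> "\<lambda>j l. 2 * exp 1 * real j powr (a l)" "\<lambda>j l. l" "\<lambda>j. K * real j powr (- 1 - \<delta>)"])
    show "summable (\<lambda>j. K * real j powr (- 1 - \<delta>))" using \<delta> by (intro summable_mult summable_nat_powr)
    show "0 \<le> K * real j powr (- 1 - \<delta>)" for j using K(1) by simp
    show "eventually (\<lambda>j. \<forall>l\<in>{1..}. 0 < \<rho> j l \<and> 1 \<le> 2 * exp 1 * real j powr (a l) \<and>
         K * ((1 / (2 * exp 1 * real j powr (a l))) ^ l * exp (real j * (\<sigma> * volB * ((1 + 1) * \<rho> j l / 2) ^ DIM('a)) * (2 * exp 1 * real j powr (a l) - 1)))
         \<le> K * real j powr (- 1 - \<delta>) * (1/2) ^ l) sequentially"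
      using eventually_ge_at_top[of 1]
    proof eventually_elim
      case (elim j)
      show ?case
      proof (intro ballI conjI)
        fix l :: nat assume "l \<in> {1..}"
        then have l: "l \<ge> 1" by simp
        have j: "real j \<ge> 1" using elim by simp
        show "0 < \<rho> j l" unfolding \<rho>_def using c l j by (intro real_root_gt_zero) auto
        have al: "a l > 0" using \<delta> l by (simp add: a_def)
        have jp: "1 \<le> real j powr a l" using j al by (intro ge_one_powr_ge_zero) auto
        have "1 * 1 \<le> (2 * exp 1) * real j powr a l" using jp exp_ge_add_one_self[of 1] by (intro mult_mono) auto
        then show "1 \<le> 2 * exp 1 * real j powr a l" by simp
        have "real j * (\<sigma> * volB * ((1 + 1) * \<rho> j l / 2) ^ DIM('a)) * (2 * exp 1 * real j powr (a l) - 1) \<le>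
              real j * (\<sigma> * volB * ((1 + 1) * \<rho> j l / 2) ^ DIM('a)) * (2 * exp 1 * real j powr (a l))"
          using \<sigma>_pos volB_pos \<open>0 < \<rho> j l\<close> by (intro mult_left_mono) auto
        also have "\<dots> = real j * (C * (c * real l * real j powr (- 1 - a l))) * (2 * exp 1 * real j powr (a l))"
          by (simp add: \<rho>d C_def)
        also have "\<dots> = (2 * exp 1 * C * c) * real l * (real j * real j powr (- 1 - a l) * real j powr (a l))"
          by (simp add: mult_ac)
        also have "real j * real j powr (- 1 - a l) * real j powr (a l) = 1"
          using j by (simp add: powr_diff powr_minus field_simps)
        also have "2 * exp 1 * C * c = 1" using C by (simp add: c_def)
        finally have "exp (real j * (\<sigma> * volB * ((1 + 1) * \<rho> j l / 2) ^ DIM('a)) * (2 * exp 1 * real j powr (a l) - 1)) \<le> exp (real l * 1)"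
          by simp
        also have "\<dots> = exp 1 ^ l" by (rule exp_of_nat_mult)
        finally have "(1 / (2 * exp 1 * real j powr (a l))) ^ l * exp (real j * (\<sigma> * volB * ((1 + 1) * \<rho> j l / 2) ^ DIM('a)) * (2 * exp 1 * real j powr (a l) - 1))
           \<le> (1 / (2 * exp 1 * real j powr (a l))) ^ l * exp 1 ^ l" by (intro mult_left_mono) auto
        also have "\<dots> = (real j powr (- a l) * (1 / 2)) ^ l"
          unfolding power_mult_distrib[symmetric] by (simp add: powr_minus field_simps)
        also have "\<dots> = real j powr (- 1 - \<delta>) * (1/2) ^ l"
        proof -
          have "(real j powr (- a l)) ^ l = real j powr (- a l * real l)"
            using j by (subst powr_realpow[symmetric]) (auto simp: powr_powr)
          also have "- a l * real l = - 1 - \<delta>" using l by (simp add: a_def)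
          finally show ?thesis by (simp only: power_mult_distrib)
        qed
        finally show "K * ((1 / (2 * exp 1 * real j powr (a l))) ^ l * exp (real j * (\<sigma> * volB * ((1 + 1) * \<rho> j l / 2) ^ DIM('a)) * (2 * exp 1 * real j powr (a l) - 1)))
         \<le> K * real j powr (- 1 - \<delta>) * (1/2) ^ l" using K(1) by (simp add: mult_left_mono mult.assoc)
      qed
    qed
  qed
  then have "AE \<omega> in M. eventually (\<lambda>n. \<forall>l\<ge>1. l + 1 \<le> cl n \<omega> \<longrightarrow>
      c * real l * real n powr (- (1 + \<delta>) / real l) < real n * r n ^ DIM('a)) sequentially"
    using AE_first_points_separated
  proof eventually_elim
    case (elim \<omega>)
    obtain J where J: "\<And>j l S. \<lbrakk>j \<ge> J; l \<ge> 1; S \<subseteq> {1..j}; j \<in> S; l + 1 \<le> card S\<rbrakk> \<Longrightarrow> \<not> clique (\<rho> j l) \<omega> S"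
      using elim(1) unfolding eventually_sequentially by (metis atLeast_iff)
    from elim(2)[rule_format, of J] eventually_ge_at_top[of 1] show ?case
    proof eventually_elim
      case (elim n)
      show ?case
      proof (intro allI impI)
        fix l assume l: "1 \<le> l" "l + 1 \<le> cl n \<omega>"
        then obtain S where S: "S \<subseteq> {1..n}" "clique (r n) \<omega> S" "l + 1 \<le> card S" unfolding cl_ge_iff by blast
        have fS: "finite S" "S \<noteq> {}" using S finite_subset by auto
        define j where "j = Max S"
        have jS: "j \<in> S" unfolding j_def using Max_in[OF fS] .
        have "S \<subseteq> {1..j}" using S(1) Max_ge[OF fS(1)] unfolding j_def by auto
        with jS S(1) have j: "j \<in> S" "S \<subseteq> {1..j}" "1 \<le> j" "j \<le> n" by auto
        have "j \<ge> J"
        proof (rule ccontr)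
          assume "\<not> j \<ge> J"
          then have "S \<subseteq> {..J}" using j(2) by auto
          then show False using elim(1) S(2,3) l(1) by auto
        qed
        from J[OF this l(1) j(2,1) S(3)] have "\<rho> j l < r n" using clique_mono[OF S(2)] by (meson not_le)
        moreover have "0 \<le> \<rho> j l" unfolding \<rho>_def using c by (intro real_root_ge_zero) auto
        ultimately have "\<rho> j l ^ DIM('a) < r n ^ DIM('a)" by (intro power_strict_mono) auto
        then have "c * real l * real j powr (- 1 - a l) < r n ^ DIM('a)" by (simp add: \<rho>d)
        moreover have "real n powr (- 1 - a l) \<le> real j powr (- 1 - a l)"
        proof (rule powr_mono2')
          have "0 \<le> a l" using \<delta> by (simp add: a_def)
          then show "- 1 - a l \<le> 0" by simp
        qed (use j in auto)
        then have "c * real l * real n powr (- 1 - a l) \<le> c * real l * real j powr (- 1 - a l)"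
          using c by (intro mult_left_mono) auto
        ultimately have "c * real l * real n powr (- 1 - a l) < r n ^ DIM('a)" by linarith
        then have "real n * (c * real l * real n powr (- 1 - a l)) < real n * r n ^ DIM('a)"
          using elim(2) by (intro mult_strict_left_mono) auto
        moreover have "real n * (c * real l * real n powr (- 1 - a l)) = c * real l * real n powr (- (1 + \<delta>) / real l)"
        proof -
          have "real n * real n powr (- 1 - a l) = real n powr (- a l)"
            using elim(2) by (simp add: powr_diff powr_minus field_simps)
          also have "- a l = - (1 + \<delta>) / real l" unfolding a_def by (rule minus_divide_left)
          finally show ?thesis by (simp add: mult_ac)
        qed
        ultimately show "c * real l * real n powr (- (1 + \<delta>) / real l) < real n * r n ^ DIM('a)" by simp
      qed
    qed
  qed
  then show thesis using that c by blast
qed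

lemma one_over_power_floor_le:
  fixes x y :: real
  assumes "1 \<le> x" "0 \<le> y"
  shows "(1 / x) ^ nat \<lfloor>y\<rfloor> \<le> x * exp (- y * ln x)"
proof -
  have "real (nat \<lfloor>y\<rfloor>) = of_int \<lfloor>y\<rfloor>" using assms(2) by simp
  then have fl: "y - 1 \<le> real (nat \<lfloor>y\<rfloor>)" by linarith
  have "(1 / x) ^ m = exp (- (real m * ln x))" for m
    using assms by (simp add: exp_minus exp_of_nat_mult power_one_over inverse_eq_divide)
  then have "(1 / x) ^ nat \<lfloor>y\<rfloor> = exp (- (real (nat \<lfloor>y\<rfloor>) * ln x))" .
  also have "\<dots> \<le> exp (- ((y - 1) * ln x))"
    using fl assms by (simp add: mult_right_mono)
  also have "- ((y - 1) * ln x) = ln x + - y * ln x" by (simp add: algebra_simps)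
  also have "exp \<dots> = x * exp (- y * ln x)" using assms by (subst exp_add) simp
  finally show ?thesis .
qed

text \<open>Up to slack, a clique through \<open>j\<close> with \<open>g * t * ln j\<close> points
  has probability \<open>j\<close> to the power
  \<open>- t * (g * ln x - vol(B) / 2^d * (x - 1))\<close>. Since only the largest index is counted,
  an exponent beyond 1 is already summable. The parameter \<open>x\<close> stays free here and is
  optimised where the lemma is used.\<close>

lemma clique_number_upper_critical:
  assumes lim: "(\<lambda>n. \<sigma> * real n * r n ^ DIM('a) / ln (real n)) \<longlonglongrightarrow> t" and t: "t > 0" and g: "g > 0"
    and x: "x \<ge> 1" and H: "t * (g * ln x - volB / 2 ^ DIM('a) * (x - 1)) > 1"
  shows "AE \<omega> in M. eventually (\<lambda>n. real (cl n \<omega>) \<le> g * (\<sigma> * real n * r n ^ DIM('a))) sequentially"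
proof -
  \<comment> \<open>The rate with slack \<open>\<eta>\<close> in three places: the size threshold,
    the auxiliary radius and the enlargement due to the grid.\<close>
  define \<phi> where "\<phi> \<eta> = g * (t * (1 - \<eta>)) * ln x - volB * ((1 + \<eta>) / 2) ^ DIM('a) * (t * (1 + \<eta>)) * (x - 1)" for \<eta>
  have "((\<lambda>\<eta>. \<phi> \<eta>) \<longlongrightarrow> \<phi> 0) (at_right 0)"
    unfolding \<phi>_def by (intro tendsto_intros) auto
  moreover have "\<phi> 0 > 1" using H by (simp add: \<phi>_def algebra_simps power_divide)
  ultimately have "eventually (\<lambda>\<eta>. \<phi> \<eta> > 1) (at_right 0)" by (rule order_tendstoD(1))
  moreover have "eventually (\<lambda>\<eta>::real. 0 < \<eta> \<and> \<eta> < 1) (at_right 0)"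
    by (rule eventually_at_right_0_between) simp
  ultimately have "eventually (\<lambda>\<eta>. \<phi> \<eta> > 1 \<and> 0 < \<eta> \<and> \<eta> < 1) (at_right 0)" by (rule eventually_conj)
  then obtain \<eta> where \<eta>: "\<phi> \<eta> > 1" "0 < \<eta>" "\<eta> < 1"
    using eventually_happens'[OF trivial_limit_at_right_real] by blast
  obtain K where K: "0 \<le> K"
   "\<And>\<rho> s x u L. \<lbrakk>eventually (\<lambda>j. \<forall>l\<in>L. 0 < \<rho> j l \<and> 1 \<le> x j l \<and>
         K * ((1 / x j l) ^ s j l * exp (real j * (\<sigma> * volB * ((1 + \<eta>) * \<rho> j l / 2) ^ DIM('a)) * (x j l - 1))) \<le> u j * (1/2) ^ l) sequentially;
         summable u; \<And>j. 0 \<le> u j\<rbrakk> \<Longrightarrow>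
       AE \<omega> in M. eventually (\<lambda>j. \<forall>l\<in>L. \<not> (\<exists>S\<subseteq>{1..j}. j \<in> S \<and> s j l + 1 \<le> card S \<and> clique (\<rho> j l) \<omega> S)) sequentially"
    using AE_no_new_clique[OF \<eta>(2)] by blast
  \<comment> \<open>The radius at which \<open>\<sigma> * j * \<rho>^d\<close> is
    \<open>t * (1 + \<eta>) * ln j\<close>. Eventually \<open>r n < \<rho> n\<close>, and
    \<open>\<rho> n \<le> \<rho> j\<close> for earlier \<open>j\<close>, so a clique at time
    \<open>n\<close> is one at radius \<open>\<rho> j\<close>.\<close>
  define \<rho> where "\<rho> j = root DIM('a) (t * (1 + \<eta>) / \<sigma> * (ln (real j) / real j))" for j
  have \<rho>d: "\<rho> j ^ DIM('a) = t * (1 + \<eta>) / \<sigma> * (ln (real j) / real j)" if "j \<ge> 1" for j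
    unfolding \<rho>_def using t \<eta> \<sigma>_pos that by (intro real_root_pow_pos2) auto
  define y where "y j = g * (t * (1 - \<eta>)) * ln (real j)" for j
  have y0: "0 \<le> y j" if "j \<ge> 1" for j using g t \<eta> that by (simp add: y_def)
  have "AE \<omega> in M. eventually (\<lambda>j. \<forall>l\<in>{0::nat}. \<not> (\<exists>S\<subseteq>{1..j}. j \<in> S \<and> nat \<lfloor>y j\<rfloor> + 1 \<le> card S \<and> clique (\<rho> j) \<omega> S)) sequentially"
  proof (rule K(2)[of "{0}" "\<lambda>j _. \<rho> j" "\<lambda>_ _. x" "\<lambda>j _. nat \<lfloor>y j\<rfloor>" "\<lambda>j. K * x * real j powr (- 1 - (\<phi> \<eta> - 1))"])
    show "summable (\<lambda>j. K * x * real j powr (- 1 - (\<phi> \<eta> - 1)))" using \<eta> by (intro summable_mult summable_nat_powr) auto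
    show "0 \<le> K * x * real j powr (- 1 - (\<phi> \<eta> - 1))" for j using K(1) x by simp
    show "eventually (\<lambda>j. \<forall>l\<in>{0::nat}. 0 < \<rho> j \<and> 1 \<le> x \<and>
         K * ((1 / x) ^ nat \<lfloor>y j\<rfloor> * exp (real j * (\<sigma> * volB * ((1 + \<eta>) * \<rho> j / 2) ^ DIM('a)) * (x - 1)))
         \<le> K * x * real j powr (- 1 - (\<phi> \<eta> - 1)) * (1/2) ^ l) sequentially"
      using eventually_ge_at_top[of 2]
    proof eventually_elim
      case (elim j)
      have "0 < \<rho> j" unfolding \<rho>_def using elim t \<eta> \<sigma>_pos by (intro real_root_gt_zero) auto
      moreover have "(1 / x) ^ nat \<lfloor>y j\<rfloor> * exp (real j * (\<sigma> * volB * ((1 + \<eta>) * \<rho> j / 2) ^ DIM('a)) * (x - 1)) \<le>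
          x * real j powr (- \<phi> \<eta>)"
      proof -
        have "real j * (\<sigma> * volB * ((1 + \<eta>) * \<rho> j / 2) ^ DIM('a)) * (x - 1) =
            real j * (\<sigma> * volB * (((1 + \<eta>) / 2) ^ DIM('a) * \<rho> j ^ DIM('a))) * (x - 1)"
          by (simp add: power_mult_distrib[symmetric])
        also have "\<dots> = volB * ((1 + \<eta>) / 2) ^ DIM('a) * (t * (1 + \<eta>)) * (x - 1) * ln (real j)"
          using elim \<sigma>_pos by (simp add: \<rho>d)
        finally have e: "real j * (\<sigma> * volB * ((1 + \<eta>) * \<rho> j / 2) ^ DIM('a)) * (x - 1) =
            volB * ((1 + \<eta>) / 2) ^ DIM('a) * (t * (1 + \<eta>)) * (x - 1) * ln (real j)" .
        have "(1 / x) ^ nat \<lfloor>y j\<rfloor> * exp (real j * (\<sigma> * volB * ((1 + \<eta>) * \<rho> j / 2) ^ DIM('a)) * (x - 1)) \<le>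
           (x * exp (- y j * ln x)) * exp (volB * ((1 + \<eta>) / 2) ^ DIM('a) * (t * (1 + \<eta>)) * (x - 1) * ln (real j))"
          unfolding e using one_over_power_floor_le[OF x y0, of j] elim by (intro mult_right_mono) auto
        also have "\<dots> = x * exp (- \<phi> \<eta> * ln (real j))"
          by (simp add: exp_add[symmetric] y_def \<phi>_def algebra_simps)
        also have "exp (- \<phi> \<eta> * ln (real j)) = real j powr (- \<phi> \<eta>)" using elim by (simp add: powr_def)
        finally show ?thesis .
      qed
      from mult_left_mono[OF this K(1)] have
        "K * ((1 / x) ^ nat \<lfloor>y j\<rfloor> * exp (real j * (\<sigma> * volB * ((1 + \<eta>) * \<rho> j / 2) ^ DIM('a)) * (x - 1))) \<le> K * x * real j powr (- 1 - (\<phi> \<eta> - 1))"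
        by (simp add: mult.assoc)
      ultimately show ?case using x by simp
    qed
  qed
  then show ?thesis using AE_first_points_separated
  proof eventually_elim
    case (elim \<omega>)
    obtain J0 where J0: "\<And>j S. \<lbrakk>j \<ge> J0; S \<subseteq> {1..j}; j \<in> S; nat \<lfloor>y j\<rfloor> + 1 \<le> card S\<rbrakk> \<Longrightarrow> \<not> clique (\<rho> j) \<omega> S"
      using elim(1) unfolding eventually_sequentially by (metis singletonI)
    \<comment> \<open>Index 3 is past \<open>exp 1\<close>, from where \<open>ln j / j\<close> is
      decreasing.\<close>
    define J where "J = max J0 3"
    have "eventually (\<lambda>n. \<sigma> * real n * r n ^ DIM('a) / ln (real n) < t * (1 + \<eta>)) sequentially"
      using t \<eta> by (intro order_tendstoD[OF lim]) auto
    moreover have "eventually (\<lambda>n. \<sigma> * real n * r n ^ DIM('a) / ln (real n) > t * (1 - \<eta>)) sequentially"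
      using t \<eta> by (intro order_tendstoD[OF lim]) (auto simp: algebra_simps)
    moreover have "eventually (\<lambda>n. y n \<ge> 1) sequentially"
    proof -
      have "filterlim (\<lambda>n. g * (t * (1 - \<eta>)) * ln (real n)) at_top sequentially"
        using g t \<eta> by (intro filterlim_tendsto_pos_mult_at_top[OF tendsto_const]) (auto, real_asymp)
      then show ?thesis unfolding y_def filterlim_at_top by blast
    qed
    ultimately show ?case using elim(2)[rule_format, of J] eventually_ge_at_top[of 3]
    proof eventually_elim
      case (elim n)
      have ln: "ln (real n) > 0" using elim(5) by simp
      have up: "\<sigma> * real n * r n ^ DIM('a) < t * (1 + \<eta>) * ln (real n)" using elim(1) ln by (simp add: pos_divide_less_eq)
      have "t * (1 - \<eta>) * ln (real n) < \<sigma> * real n * r n ^ DIM('a)" using elim(2) ln by (simp add: pos_less_divide_eq)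
      then have lo: "y n < g * (\<sigma> * real n * r n ^ DIM('a))" using g unfolding y_def by (simp add: mult.assoc)
      have rn: "r n < \<rho> n"
      proof -
        have "r n ^ DIM('a) < t * (1 + \<eta>) / \<sigma> * (ln (real n) / real n)"
          using up \<sigma>_pos elim(5) by (simp add: field_simps)
        then have "r n ^ DIM('a) < \<rho> n ^ DIM('a)" using elim(5) by (simp add: \<rho>d)
        then show ?thesis by (rule power_less_imp_less_base) (use t \<eta> \<sigma>_pos elim(5) in \<open>auto simp: \<rho>_def\<close>)
      qed
      show ?case
      proof (rule ccontr)
        assume "\<not> real (cl n \<omega>) \<le> g * (\<sigma> * real n * r n ^ DIM('a))"
        then have big: "y n < real (cl n \<omega>)" using lo by linarith
        obtain S where S: "S \<subseteq> {1..n}" "clique (r n) \<omega> S" "cl n \<omega> \<le> card S" using cl_ge_iff[of "cl n \<omega>" n \<omega>] by blast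
        have "2 \<le> card S" using big elim(3) S(3) by linarith
        then have fS: "finite S" "S \<noteq> {}" using S(1) finite_subset by auto
        define j where "j = Max S"
        have jS: "j \<in> S" unfolding j_def using Max_in[OF fS] .
        have "S \<subseteq> {1..j}" using S(1) Max_ge[OF fS(1)] unfolding j_def by auto
        with jS S(1) have j: "j \<in> S" "S \<subseteq> {1..j}" "1 \<le> j" "j \<le> n" by auto
        have jJ: "j \<ge> J"
        proof (rule ccontr)
          assume "\<not> j \<ge> J"
          then have "S \<subseteq> {..J}" using j(2) by auto
          then show False using elim(4) S(2) \<open>2 \<le> card S\<close> by blast
        qed
        have "ln (real n) / real n \<le> ln (real j) / real j"
          using jJ j(4) exp_le by (intro ln_x_over_x_mono) (auto simp: J_def)
        then have "\<rho> n \<le> \<rho> j"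
          unfolding \<rho>_def using t \<eta> \<sigma>_pos by (intro real_root_le_mono mult_left_mono) auto
        then have "clique (\<rho> j) \<omega> S" using rn by (intro clique_mono[OF S(2)]) linarith
        moreover have "nat \<lfloor>y j\<rfloor> + 1 \<le> card S"
        proof -
          have "y j \<le> y n" unfolding y_def using j g t \<eta> by (intro mult_left_mono) auto
          then have "y j < real (card S)" using big S(3) by linarith
          then show ?thesis using y0[OF j(3)] by linarith
        qed
        ultimately show False using J0[OF _ j(2,1)] jJ by (simp add: J_def)
      qed
    qed
  qed
qed

text \<open>The union bound over all \<open>j \<le> n\<close> is affordable: \<open>n r^d\<close>
  dominates \<open>ln n\<close>, so any positive rate beats every power of \<open>n\<close>. Hence
  \<open>r n\<close> itself serves as the radius.\<close>

lemma clique_number_upper_dense: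
  assumes lno: "(\<lambda>n. ln (real n)) \<in> o(\<lambda>n. real n * r n ^ DIM('a))" and g: "g > 0"
    and x: "x \<ge> 1" and H: "g * ln x - volB / 2 ^ DIM('a) * (x - 1) > 0"
  shows "AE \<omega> in M. eventually (\<lambda>n. real (cl n \<omega>) \<le> g * (\<sigma> * real n * r n ^ DIM('a))) sequentially"
proof -
  define \<phi> where "\<phi> \<eta> = g * ln x - volB * ((1 + \<eta>) / 2) ^ DIM('a) * (x - 1)" for \<eta>
  have "((\<lambda>\<eta>. \<phi> \<eta>) \<longlongrightarrow> \<phi> 0) (at_right 0)"
    unfolding \<phi>_def by (intro tendsto_intros) auto
  moreover have "\<phi> 0 > 0" using H by (simp add: \<phi>_def power_divide)
  ultimately have "eventually (\<lambda>\<eta>. \<phi> \<eta> > 0) (at_right 0)" by (rule order_tendstoD(1))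
  then have "eventually (\<lambda>\<eta>. \<phi> \<eta> > 0 \<and> 0 < \<eta>) (at_right 0)"
    using eventually_at_right_less[of "0::real"] by (rule eventually_conj)
  then obtain \<eta> where \<eta>: "\<phi> \<eta> > 0" "0 < \<eta>"
    using eventually_happens'[OF trivial_limit_at_right_real] by blast
  obtain K where K: "0 \<le> K"
    "\<And>\<rho> I j l x. \<lbrakk>0 < \<rho>; finite I; j \<in> I; 1 \<le> x\<rbrakk> \<Longrightarrow>
       \<exists>E\<in>events. {\<omega>\<in>space M. \<exists>S\<subseteq>I. j \<in> S \<and> l + 1 \<le> card S \<and> clique \<rho> \<omega> S} \<subseteq> E \<and>
         prob E \<le> K * ((1 / x) ^ l * exp (real (card I) * (\<sigma> * volB * ((1 + \<eta>) * \<rho> / 2) ^ DIM('a)) * (x - 1)))"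
    using prob_clique_through_le[OF \<eta>(2)] by blast
  have "AE \<omega> in M. eventually (\<lambda>n. \<not> g * (\<sigma> * real n * r n ^ DIM('a)) < real (cl n \<omega>)) sequentially"
  proof (rule AE_eventually_not)
    show "summable (\<lambda>n. K * x * real n powr (- 1 - 1))" by (intro summable_mult summable_nat_powr) simp
    \<comment> \<open>The 3 gives each index probability of order \<open>n^(-3)\<close>, which
      leaves \<open>n^(-2)\<close> after the union bound.\<close>
    have "eventually (\<lambda>n. norm (ln (real n)) \<le> (\<phi> \<eta> * \<sigma> / 3) * norm (real n * r n ^ DIM('a))) sequentially"
      using \<eta> \<sigma>_pos by (intro landau_o.smallD[OF lno]) auto
    then show "eventually (\<lambda>n. \<exists>E\<in>events. {\<omega>\<in>space M. g * (\<sigma> * real n * r n ^ DIM('a)) < real (cl n \<omega>)} \<subseteq> E \<and>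
       prob E \<le> K * x * real n powr (- 1 - 1)) sequentially"
      using eventually_ge_at_top[of 1]
    proof eventually_elim
      case (elim n)
      define y where "y = g * (\<sigma> * real n * r n ^ DIM('a))"
      have y: "0 \<le> y" using g \<sigma>_pos r_pos[of n] by (simp add: y_def)
      define b where "b = K * ((1 / x) ^ nat \<lfloor>y\<rfloor> * exp (real n * (\<sigma> * volB * ((1 + \<eta>) * r n / 2) ^ DIM('a)) * (x - 1)))"
      have "\<exists>E\<in>events. {\<omega>\<in>space M. \<exists>S\<subseteq>{1..n}. j \<in> S \<and> nat \<lfloor>y\<rfloor> + 1 \<le> card S \<and> clique (r n) \<omega> S} \<subseteq> E \<and> prob E \<le> b"
        if "j \<in> {1..n}" for j
        using K(2)[OF r_pos[of n] _ that x, of "nat \<lfloor>y\<rfloor>"] unfolding b_def by simp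
      then have "\<forall>j\<in>{1..n}. \<exists>E. E \<in> events \<and> {\<omega>\<in>space M. \<exists>S\<subseteq>{1..n}. j \<in> S \<and> nat \<lfloor>y\<rfloor> + 1 \<le> card S \<and> clique (r n) \<omega> S} \<subseteq> E \<and> prob E \<le> b"
        by blast
      from bchoice[OF this] obtain E where E: "\<forall>j\<in>{1..n}. E j \<in> events \<and> {\<omega>\<in>space M. \<exists>S\<subseteq>{1..n}. j \<in> S \<and> nat \<lfloor>y\<rfloor> + 1 \<le> card S \<and> clique (r n) \<omega> S} \<subseteq> E j \<and> prob (E j) \<le> b"
        by (rule exE)
      let ?E = "\<Union>j\<in>{1..n}. E j"
      have "?E \<in> events" using E by (intro sets.finite_UN) auto
      moreover have "{\<omega>\<in>space M. g * (\<sigma> * real n * r n ^ DIM('a)) < real (cl n \<omega>)} \<subseteq> ?E"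
      proof
        fix \<omega> assume \<omega>: "\<omega> \<in> {\<omega>\<in>space M. g * (\<sigma> * real n * r n ^ DIM('a)) < real (cl n \<omega>)}"
        then have "nat \<lfloor>y\<rfloor> + 1 \<le> cl n \<omega>" using y unfolding y_def[symmetric] by simp linarith
        then obtain S where S: "S \<subseteq> {1..n}" "clique (r n) \<omega> S" "nat \<lfloor>y\<rfloor> + 1 \<le> card S" unfolding cl_ge_iff by blast
        then obtain j where j: "j \<in> S" by fastforce
        then have "\<omega> \<in> E j" using E S \<omega> by blast
        then show "\<omega> \<in> ?E" using S(1) j by blast
      qed
      moreover have "prob ?E \<le> K * x * real n powr (- 1 - 1)"
      proof -
        have "prob ?E \<le> (\<Sum>j\<in>{1..n}. prob (E j))" using E by (intro finite_measure_subadditive_finite) auto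
        also have "\<dots> \<le> (\<Sum>j\<in>{1..n}. b)" using E by (intro sum_mono) auto
        also have "\<dots> = real n * b" by simp
        also have "b \<le> K * (x * exp (- (\<sigma> * real n * r n ^ DIM('a)) * \<phi> \<eta>))"
        proof -
          define z where "z = real n * (\<sigma> * volB * ((1 + \<eta>) * r n / 2) ^ DIM('a)) * (x - 1)"
          have z: "z = (\<sigma> * real n * r n ^ DIM('a)) * (volB * ((1 + \<eta>) / 2) ^ DIM('a) * (x - 1))"
            by (simp add: z_def power_mult_distrib power_divide)
          have "b \<le> K * (x * exp (- y * ln x) * exp z)"
            unfolding b_def z_def[symmetric]
            using one_over_power_floor_le[OF x y] K(1) by (intro mult_left_mono mult_right_mono) auto
          also have "x * exp (- y * ln x) * exp z = x * exp (- (\<sigma> * real n * r n ^ DIM('a)) * \<phi> \<eta>)"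
            unfolding z by (simp add: exp_add[symmetric] \<phi>_def y_def algebra_simps)
          finally show ?thesis .
        qed
        also have "exp (- (\<sigma> * real n * r n ^ DIM('a)) * \<phi> \<eta>) \<le> exp (- 3 * ln (real n))"
        proof -
          have "ln (real n) \<le> (\<phi> \<eta> * \<sigma> / 3) * (real n * r n ^ DIM('a))"
            using elim r_pos[of n] by simp
          then show ?thesis by (simp add: algebra_simps)
        qed
        also have "exp (- 3 * ln (real n)) = real n powr (- 3)" using elim by (simp add: powr_def)
        finally have "prob ?E \<le> real n * (K * (x * real n powr (- 3)))" using K(1) x by (simp add: mult_left_mono)
        also have "\<dots> = K * x * (real n powr 1 * real n powr (- 3))" using elim by simp
        also have "real n powr 1 * real n powr (- 3) = real n powr (- 1 - 1)" by (subst powr_add[symmetric]) simp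
        finally show ?thesis .
      qed
      ultimately show ?case by blast
    qed
  qed
  then show ?thesis by (simp add: not_less)
qed

end

section \<open>The function f-omega\<close>

lemma Hfun_1 [simp]: "Hfun 1 = 0"
  by (simp add: Hfun_def)

lemma Hfun_deriv: "x > 0 \<Longrightarrow> (Hfun has_real_derivative ln x) (at x)"
  unfolding Hfun_def[abs_def] by (auto intro!: derivative_eq_intros)

lemma continuous_on_Hfun: "continuous_on {0<..} Hfun"
  unfolding Hfun_def[abs_def] by (intro continuous_intros) auto

lemma Hfun_strict_mono:
  assumes xy: "1 \<le> x" "x < y"
  shows "Hfun x < Hfun y"
proof (rule DERIV_pos_imp_increasing_open[OF xy(2)])
  show "\<exists>D. (Hfun has_real_derivative D) (at z) \<and> 0 < D" if "x < z" "z < y" for z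
    using that xy by (intro exI[of _ "ln z"] conjI Hfun_deriv) auto
  show "continuous_on {x..y} Hfun"
    using xy by (intro continuous_on_subset[OF continuous_on_Hfun]) auto
qed

lemma Hfun_strict_antimono:
  assumes xy: "0 < x" "x < y" "y \<le> 1"
  shows "Hfun y < Hfun x"
proof (rule DERIV_neg_imp_decreasing_open[OF xy(2)])
  show "\<exists>D. (Hfun has_real_derivative D) (at z) \<and> D < 0" if "x < z" "z < y" for z
    using that xy by (intro exI[of _ "ln z"] conjI Hfun_deriv) auto
  show "continuous_on {x..y} Hfun"
    using xy by (intro continuous_on_subset[OF continuous_on_Hfun]) auto
qed

lemma Hfun_pos: "0 < x \<Longrightarrow> x \<noteq> 1 \<Longrightarrow> 0 < Hfun x"
  using Hfun_strict_mono[of 1 x] Hfun_strict_antimono[of x 1] by (cases "x < 1") auto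

lemma Hfun_less_iff: "1 \<le> x \<Longrightarrow> 1 \<le> y \<Longrightarrow> Hfun x < Hfun y \<longleftrightarrow> x < y"
  using Hfun_strict_mono[of x y] Hfun_strict_mono[of y x] by (metis less_asym less_irrefl linorder_neqE_linordered_idom)

lemma Hfun_at_top: "filterlim Hfun at_top at_top"
  unfolding Hfun_def[abs_def] by real_asymp

lemma Hfun_surj:
  assumes "0 \<le> s"
  obtains x where "1 \<le> x" "Hfun x = s"
proof -
  have "eventually (\<lambda>x. 1 \<le> x \<and> s \<le> Hfun x) at_top"
    using Hfun_at_top by (auto simp: filterlim_at_top eventually_conj_iff eventually_ge_at_top)
  then obtain y where y: "1 \<le> y" "s \<le> Hfun y" by (auto simp: eventually_at_top_linorder)
  have "\<exists>x\<ge>1. x \<le> y \<and> Hfun x = s"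
    using y assms by (intro IVT' continuous_on_subset[OF continuous_on_Hfun]) auto
  then show thesis using that by blast
qed

context
  fixes vB :: real and d :: nat
  assumes vB: "vB > 0"
begin

lemma f_omega_ex1:
  assumes t: "t > 0"
  shows "\<exists>!g. g \<ge> vB / 2 ^ d \<and> Hfun (g * 2 ^ d / vB) = 2 ^ d / (t * vB)"
proof -
  obtain x where x: "1 \<le> x" "Hfun x = 2 ^ d / (t * vB)"
    using Hfun_surj[of "2 ^ d / (t * vB)"] vB t by auto
  show ?thesis
  proof (rule ex1I[of _ "x * vB / 2 ^ d"])
    show "vB / 2 ^ d \<le> x * vB / 2 ^ d \<and> Hfun (x * vB / 2 ^ d * 2 ^ d / vB) = 2 ^ d / (t * vB)"
      using x vB by (auto intro!: divide_right_mono)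
  next
    fix g assume g: "vB / 2 ^ d \<le> g \<and> Hfun (g * 2 ^ d / vB) = 2 ^ d / (t * vB)"
    then have "1 \<le> g * 2 ^ d / vB" using vB by (simp add: field_simps)
    then have "g * 2 ^ d / vB = x"
      using Hfun_less_iff[of x "g * 2 ^ d / vB"] Hfun_less_iff[of "g * 2 ^ d / vB" x] g x by linarith
    then show "g = x * vB / 2 ^ d" using vB by (simp add: field_simps)
  qed
qed

lemma f_omega_props:
  assumes t: "t > 0"
  shows "vB / 2 ^ d \<le> f_omega vB d t" "Hfun (f_omega vB d t * 2 ^ d / vB) = 2 ^ d / (t * vB)"
  using theI'[OF f_omega_ex1[OF t]] unfolding f_omega_def by auto

text \<open>Strict monotonicity of \<open>Hfun\<close> on \<open>[1, \<infinity>)\<close> turns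
  comparisons with the implicitly defined value into explicit inequalities. All properties of
  \<open>f_omega\<close> below, and its use as a threshold, go through this.\<close>

lemma f_omega_compare:
  assumes t: "t > 0" and a: "vB / 2 ^ d \<le> a"
  shows "a < f_omega vB d t \<longleftrightarrow> Hfun (a * 2 ^ d / vB) < 2 ^ d / (t * vB)"
    and "f_omega vB d t < a \<longleftrightarrow> 2 ^ d / (t * vB) < Hfun (a * 2 ^ d / vB)"
proof -
  have "1 \<le> a * 2 ^ d / vB" "1 \<le> f_omega vB d t * 2 ^ d / vB"
    using a f_omega_props(1)[OF t] vB by (auto simp: field_simps)
  moreover have "a * 2 ^ d / vB < f_omega vB d t * 2 ^ d / vB \<longleftrightarrow> a < f_omega vB d t"
    "f_omega vB d t * 2 ^ d / vB < a * 2 ^ d / vB \<longleftrightarrow> f_omega vB d t < a"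
    using vB by (auto simp: field_simps)
  ultimately show "a < f_omega vB d t \<longleftrightarrow> Hfun (a * 2 ^ d / vB) < 2 ^ d / (t * vB)"
    and "f_omega vB d t < a \<longleftrightarrow> 2 ^ d / (t * vB) < Hfun (a * 2 ^ d / vB)"
    using Hfun_less_iff f_omega_props(2)[OF t] by metis+
qed

lemma f_omega_gt: "t > 0 \<Longrightarrow> vB / 2 ^ d < f_omega vB d t"
  using vB by (subst f_omega_compare(1)) auto

lemma f_omega_strict_decreasing:
  assumes "0 < s" "s < t"
  shows "f_omega vB d t < f_omega vB d s"
proof -
  have "2 ^ d / (t * vB) < 2 ^ d / (s * vB)" using assms vB by (intro divide_strict_left_mono) auto
  then show ?thesis
    using assms f_omega_props[of s] by (subst f_omega_compare(2)) auto
qed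

lemma continuous_on_f_omega: "continuous_on {0<..} (f_omega vB d)"
  unfolding continuous_on_def
proof
  fix t :: real assume "t \<in> {0<..}"
  then have t: "t > 0" by simp
  have lim: "((\<lambda>t. 2 ^ d / (t * vB)) \<longlongrightarrow> 2 ^ d / (t * vB)) (at t within {0<..})"
    using t vB by (intro tendsto_intros) auto
  have pos: "eventually (\<lambda>t. t > 0) (at t within {0<..})" by (simp add: eventually_at_filter)
  show "(f_omega vB d \<longlongrightarrow> f_omega vB d t) (at t within {0<..})"
  proof (rule order_tendstoI)
    fix a assume a: "a < f_omega vB d t"
    \<comment> \<open>Levels below \<open>vB / 2 ^ d\<close> are raised to it, as the comparison
      holds only on the branch where \<open>Hfun\<close> increases.\<close>
    define a' where "a' = max a (vB / 2 ^ d)"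
    have "a' < f_omega vB d t" using a f_omega_gt[OF t] by (simp add: a'_def)
    then have "Hfun (a' * 2 ^ d / vB) < 2 ^ d / (t * vB)" using f_omega_compare(1)[OF t, of a'] by (simp add: a'_def)
    from order_tendstoD(1)[OF lim this] pos show "eventually (\<lambda>t. a < f_omega vB d t) (at t within {0<..})"
    proof eventually_elim
      case (elim s)
      then have "a' < f_omega vB d s" using f_omega_compare(1)[of s a'] by (simp add: a'_def)
      then show ?case by (simp add: a'_def)
    qed
  next
    fix a assume a: "f_omega vB d t < a"
    then have va: "vB / 2 ^ d \<le> a" using f_omega_gt[OF t] by linarith
    then have "2 ^ d / (t * vB) < Hfun (a * 2 ^ d / vB)" using f_omega_compare(2)[OF t va] a by simp
    from order_tendstoD(2)[OF lim this] pos show "eventually (\<lambda>t. f_omega vB d t < a) (at t within {0<..})"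
      by eventually_elim (use f_omega_compare(2) va in simp)
  qed
qed

lemma f_omega_at_top: "(f_omega vB d \<longlongrightarrow> vB / 2 ^ d) at_top"
proof (rule order_tendstoI)
  fix a assume a: "a < vB / 2 ^ d"
  show "eventually (\<lambda>t. a < f_omega vB d t) at_top"
    using eventually_gt_at_top[of 0] by eventually_elim (use f_omega_gt a in \<open>auto intro: less_trans\<close>)
next
  fix a assume a: "vB / 2 ^ d < a"
  have "1 < a * 2 ^ d / vB" using a vB by (simp add: field_simps)
  then have "0 < Hfun (a * 2 ^ d / vB)" by (intro Hfun_pos) auto
  moreover have "((\<lambda>t. 2 ^ d / (t * vB)) \<longlongrightarrow> 0) at_top" using vB by real_asymp
  ultimately have "eventually (\<lambda>t. 2 ^ d / (t * vB) < Hfun (a * 2 ^ d / vB)) at_top" using order_tendstoD(2) by blast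
  then show "eventually (\<lambda>t. f_omega vB d t < a) at_top" using eventually_gt_at_top[of 0]
    by eventually_elim (use f_omega_compare(2) a in simp)
qed

lemma f_omega_at_right_0: "filterlim (f_omega vB d) at_top (at_right 0)"
  unfolding filterlim_at_top
proof
  fix Z :: real
  define a where "a = max Z (vB / 2 ^ d)"
  have "filterlim (\<lambda>t. 2 ^ d / (t * vB)) at_top (at_right 0)" using vB by real_asymp
  then have "eventually (\<lambda>t. Hfun (a * 2 ^ d / vB) < 2 ^ d / (t * vB)) (at_right 0)"
    by (auto simp: filterlim_at_top_dense)
  then show "eventually (\<lambda>t. Z \<le> f_omega vB d t) (at_right 0)"
    using eventually_at_right_less[of "0::real"]
  proof eventually_elim
    case (elim t)
    then have "a < f_omega vB d t" by (subst f_omega_compare(1)) (auto simp: a_def)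
    then show ?case by (simp add: a_def)
  qed
qed

end

section \<open>Almost sure lower bounds\<close>

text \<open>A one-sided Stirling bound with error of order \<open>ln k\<close>. The term
  \<open>- k\<close> must be kept, since it enters the critical exponent.\<close>

lemma ln_fact_le: "k \<ge> 1 \<Longrightarrow> ln (fact k :: real) \<le> (real k + 1) * ln (real k) - real k + 1"
proof (induction k rule: dec_induct)
  case (step k)
  have k: "real k > 0" using step.hyps by simp
  have "ln (real k / (real k + 1)) \<le> real k / (real k + 1) - 1"
    using k by (intro ln_le_minus_one) auto
  also have "\<dots> = - 1 / (real k + 1)" using k by (simp add: field_simps)
  finally have "ln (real k) - ln (real k + 1) \<le> - 1 / (real k + 1)" using k by (simp add: ln_div)
  then have "(real k + 1) * (ln (real k) - ln (real k + 1)) \<le> - 1"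
    using k mult_left_mono[of "ln (real k) - ln (real k + 1)" "- 1 / (real k + 1)" "real k + 1"] by simp
  moreover have "ln (fact (Suc k) :: real) = ln (real k + 1) + ln (fact k)"
    using k by (simp add: ln_mult add.commute)
  ultimately show ?case using step.IH by (simp add: algebra_simps)
qed simp

text \<open>Dividing by \<open>k!\<close> rather than by \<open>k^k\<close> keeps the factor of
  order \<open>exp k\<close>, without which the critical constant would be wrong.\<close>

lemma binomial_ge_pow_div_fact:
  assumes "k \<le> b"
  shows "(real b - real k) ^ k / fact k \<le> real (b choose k)"
proof -
  have "(real b - real k) ^ k / fact k = (\<Prod>i = 0..<k. (real b - real k) / real (k - i))"
    by (simp add: prod_dividef fact_prod_rev)
  also have "\<dots> \<le> (\<Prod>i = 0..<k. real (b - i) / real (k - i))"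
    using assms by (intro prod_mono conjI divide_right_mono divide_nonneg_nonneg) auto
  also have "\<dots> = real (b choose k)" using binomial_altdef_of_nat[OF assms, where 'a = real] by simp
  finally show ?thesis .
qed

lemma exp_le_one_minus_pow:
  fixes z :: real
  assumes "0 \<le> z" "z \<le> 1/2"
  shows "exp (- (real n * (z + 2 * z\<^sup>2))) \<le> (1 - z) ^ n"
proof -
  have "- z - 2 * z\<^sup>2 \<le> ln (1 - z)" by (rule ln_one_minus_pos_lower_bound[OF assms])
  then have "exp (- z - 2 * z\<^sup>2) \<le> 1 - z" using assms by (subst (asm) ln_ge_iff) auto
  then have "exp (- z - 2 * z\<^sup>2) ^ n \<le> (1 - z) ^ n" by (intro power_mono) auto
  then show ?thesis by (simp add: exp_of_nat_mult[symmetric] algebra_simps)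
qed

lemma summable_exp_neg: "\<kappa> > 0 \<Longrightarrow> summable (\<lambda>n. exp (- \<kappa> * real n))"
proof -
  assume "\<kappa> > 0"
  then have "summable (\<lambda>n. exp (- \<kappa>) ^ n)" by (intro summable_geometric) simp
  then show ?thesis by (simp add: exp_of_nat_mult[symmetric] mult.commute)
qed

context random_geometric_graph
begin

lemma cl_less_iff: "cl n \<omega> < k \<longleftrightarrow> (\<forall>S\<subseteq>{1..n}. clique (r n) \<omega> S \<longrightarrow> card S < k)"
  using cl_ge_iff[of k n \<omega>] by (meson not_le)

lemma eventually_r_less: "c > 0 \<Longrightarrow> eventually (\<lambda>n. r n < c) sequentially"
  using r_lim by (rule order_tendstoD(2))

lemma eventually_rd_less: "c > 0 \<Longrightarrow> eventually (\<lambda>n. r n ^ DIM('a) < c) sequentially"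
proof -
  assume "c > 0"
  have "(\<lambda>n. r n ^ DIM('a)) \<longlonglongrightarrow> 0 ^ DIM('a)" by (intro tendsto_power r_lim)
  then have "(\<lambda>n. r n ^ DIM('a)) \<longlonglongrightarrow> 0" by (simp add: zero_power)
  then show ?thesis using \<open>c > 0\<close> by (rule order_tendstoD(2))
qed

text \<open>One heavy ball suffices: its lower tail is exponentially small in \<open>n r^d\<close>,
  hence below every power of \<open>n\<close>.\<close>

lemma clique_number_lower_dense:
  assumes lno: "(\<lambda>n. ln (real n)) \<in> o(\<lambda>n. real n * r n ^ DIM('a))" and g: "g > 0"
    and x: "0 < x" "x \<le> 1" and H: "g * ln x + volB / 2 ^ DIM('a) * (1 - x) > 0"
  shows "AE \<omega> in M. eventually (\<lambda>n. g * (\<sigma> * real n * r n ^ DIM('a)) \<le> real (cl n \<omega>)) sequentially"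
proof -
  define \<phi> where "\<phi> \<eta> = g * ln x + (1 - \<eta>) * (volB / 2 ^ DIM('a)) * (1 - x)" for \<eta>
  have "((\<lambda>\<eta>. \<phi> \<eta>) \<longlongrightarrow> \<phi> 0) (at_right 0)"
    unfolding \<phi>_def by (intro tendsto_intros) auto
  moreover have "\<phi> 0 > 0" using H by (simp add: \<phi>_def)
  ultimately have "eventually (\<lambda>\<eta>. \<phi> \<eta> > 0) (at_right 0)" by (rule order_tendstoD(1))
  moreover have "eventually (\<lambda>\<eta>::real. 0 < \<eta> \<and> \<eta> < 1) (at_right 0)" by (rule eventually_at_right_0_between) simp
  ultimately have "eventually (\<lambda>\<eta>. \<phi> \<eta> > 0 \<and> 0 < \<eta> \<and> \<eta> < 1) (at_right 0)" by (rule eventually_conj)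
  then obtain \<eta> where \<eta>: "\<phi> \<eta> > 0" "0 < \<eta>" "\<eta> < 1"
    using eventually_happens'[OF trivial_limit_at_right_real] by blast
  obtain r0 where r0: "0 < r0"
    "\<And>\<rho> n k x. \<lbrakk>0 < \<rho>; \<rho> < r0; 0 < x; x \<le> 1\<rbrakk> \<Longrightarrow>
       \<exists>E\<in>events. {\<omega>\<in>space M. \<forall>S\<subseteq>{1..n}. clique \<rho> \<omega> S \<longrightarrow> card S \<le> k} \<subseteq> E \<and>
         prob E \<le> (1 / x) ^ k * exp (real n * ((1 - \<eta>) * (\<sigma> * volB * (\<rho> / 2) ^ DIM('a))) * (x - 1))"
    using prob_no_clique_single_ball[OF \<eta>(2,3)] by blast
  have "AE \<omega> in M. eventually (\<lambda>n. \<not> real (cl n \<omega>) < g * (\<sigma> * real n * r n ^ DIM('a))) sequentially"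
  proof (rule AE_eventually_not)
    show "summable (\<lambda>n. real n powr (- 1 - 1))" by (intro summable_nat_powr) simp
    have "eventually (\<lambda>n. norm (ln (real n)) \<le> (\<phi> \<eta> * \<sigma> / 2) * norm (real n * r n ^ DIM('a))) sequentially"
      using \<eta> \<sigma>_pos by (intro landau_o.smallD[OF lno]) auto
    then show "eventually (\<lambda>n. \<exists>E\<in>events. {\<omega>\<in>space M. real (cl n \<omega>) < g * (\<sigma> * real n * r n ^ DIM('a))} \<subseteq> E \<and>
       prob E \<le> real n powr (- 1 - 1)) sequentially"
      using eventually_ge_at_top[of 1] eventually_r_less[OF r0(1)]
    proof eventually_elim
      case (elim n)
      define y where "y = g * (\<sigma> * real n * r n ^ DIM('a))"
      have y: "0 \<le> y" using g \<sigma>_pos r_pos[of n] by (simp add: y_def)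
      define k where "k = nat \<lfloor>y\<rfloor>"
      have k: "real k \<le> y" using y by (simp add: k_def)
      obtain E where E: "E \<in> events" "{\<omega>\<in>space M. \<forall>S\<subseteq>{1..n}. clique (r n) \<omega> S \<longrightarrow> card S \<le> k} \<subseteq> E"
         "prob E \<le> (1 / x) ^ k * exp (real n * ((1 - \<eta>) * (\<sigma> * volB * (r n / 2) ^ DIM('a))) * (x - 1))"
        using r0(2)[OF r_pos elim(3) x, of n k] by blast
      have "{\<omega>\<in>space M. real (cl n \<omega>) < y} \<subseteq> E"
      proof
        fix \<omega> assume \<omega>: "\<omega> \<in> {\<omega>\<in>space M. real (cl n \<omega>) < y}"
        then have "cl n \<omega> < k + 1" unfolding k_def by simp linarith
        then have "\<forall>S\<subseteq>{1..n}. clique (r n) \<omega> S \<longrightarrow> card S \<le> k" unfolding cl_less_iff by (metis Suc_eq_plus1 less_Suc_eq_le)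
        then show "\<omega> \<in> E" using \<omega> E(2) by blast
      qed
      moreover have "prob E \<le> real n powr (- 1 - 1)"
      proof -
        have "(1 / x) ^ k = exp (- (real k * ln x))"
          using x by (simp add: exp_minus exp_of_nat_mult power_one_over inverse_eq_divide)
        also have "\<dots> \<le> exp (- (y * ln x))"
          using k x by (simp add: mult_right_mono_neg)
        finally have 1: "(1 / x) ^ k \<le> exp (- (y * ln x))" .
        have "prob E \<le> exp (- (y * ln x)) * exp (real n * ((1 - \<eta>) * (\<sigma> * volB * (r n / 2) ^ DIM('a))) * (x - 1))"
          using E(3) mult_right_mono[OF 1] by (meson exp_ge_zero order_trans)
        also have "\<dots> = exp (- (\<sigma> * real n * r n ^ DIM('a)) * \<phi> \<eta>)"
          by (simp add: exp_add[symmetric] \<phi>_def y_def power_divide algebra_simps)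
        also have "\<dots> \<le> exp (- 2 * ln (real n))"
        proof -
          have "ln (real n) \<le> (\<phi> \<eta> * \<sigma> / 2) * (real n * r n ^ DIM('a))"
            using elim r_pos[of n] by simp
          then show ?thesis by (simp add: algebra_simps)
        qed
        also have "exp (- 2 * ln (real n)) = real n powr (- 1 - 1)" using elim by (simp add: powr_def)
        finally show ?thesis .
      qed
      ultimately show ?case using E(1) unfolding y_def by blast
    qed
  qed
  then show ?thesis by (simp add: not_less)
qed

text \<open>The term \<open>exp (- \<kappa> * n)\<close> covers too many points in the packed balls,
  \<open>exp (- W n)\<close> the absence of a full ball; with \<open>W n \<ge> 2 * ln n\<close> the
  latter is at most \<open>n^(-2)\<close>.\<close>

lemma AE_clique_number_ge:
  assumes "\<kappa> > 0"
    and "eventually (\<lambda>n. \<exists>E\<in>events. {\<omega>\<in>space M. cl n \<omega> < k n} \<subseteq> E \<and> prob E \<le> exp (- \<kappa> * real n) + exp (- W n)) sequentially"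
    and "eventually (\<lambda>n. 2 * ln (real n) \<le> W n) sequentially"
  shows "AE \<omega> in M. eventually (\<lambda>n. k n \<le> cl n \<omega>) sequentially"
proof -
  have "AE \<omega> in M. eventually (\<lambda>n. \<not> cl n \<omega> < k n) sequentially"
  proof (rule AE_eventually_not)
    show "summable (\<lambda>n. exp (- \<kappa> * real n) + real n powr (- 1 - 1))"
      using assms(1) by (intro summable_add summable_exp_neg summable_nat_powr) auto
    from assms(2,3) eventually_gt_at_top[of 0]
    show "eventually (\<lambda>n. \<exists>E\<in>events. {\<omega>\<in>space M. cl n \<omega> < k n} \<subseteq> E \<and>
        prob E \<le> exp (- \<kappa> * real n) + real n powr (- 1 - 1)) sequentially"
    proof eventually_elim
      case (elim n)
      have "exp (- W n) \<le> exp (- 2 * ln (real n))" using elim(2) by simp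
      also have "\<dots> = real n powr (- 1 - 1)" using elim(3) by (simp add: powr_def)
      finally have W: "exp (- W n) \<le> real n powr (- 1 - 1)" .
      obtain E where "E \<in> events" "{\<omega>\<in>space M. cl n \<omega> < k n} \<subseteq> E" "prob E \<le> exp (- \<kappa> * real n) + exp (- W n)"
        using elim(1) by blast
      then show ?case using W by (intro bexI[of _ E] conjI) linarith+
    qed
  qed
  then show ?thesis by (simp add: not_less)
qed

text \<open>The relative losses are fixed at \<open>1/2\<close> and the binomial coefficient is
  bounded by \<open>(n / k)^k\<close>. Constant factors to the power \<open>k\<close> are harmless
  in the two sparse regimes, where \<open>k\<close> is bounded or of smaller order than
  \<open>ln n\<close>.\<close>

lemma prob_clique_number_less_sparse:
  obtains c2 c3 c4 \<kappa> where "c2 > 0" "c3 > 0" "c4 > 0" "\<kappa> > 0"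
    "eventually (\<lambda>n. \<forall>k. 1 \<le> k \<longrightarrow> 4 * k \<le> n \<longrightarrow>
       (\<exists>E\<in>events. {\<omega>\<in>space M. cl n \<omega> < k} \<subseteq> E \<and> prob E \<le> exp (- \<kappa> * real n) +
          exp (- (c4 * (real n / (real n * r n ^ DIM('a))) * (c2 * (real n * r n ^ DIM('a)) / real k) ^ k * exp (- c3 * (real n * r n ^ DIM('a))))))) sequentially"
proof -
  define v where "v = \<sigma> * volB / 2 ^ DIM('a)"
  have v: "v > 0" using \<sigma>_pos volB_pos by (simp add: v_def)
  have vP: "\<sigma> * volB * (\<rho> / 2) ^ DIM('a) = v * \<rho> ^ DIM('a)" for \<rho> by (simp add: v_def power_divide)
  have half: "0 < (1/2::real)" "(1/2::real) < 1" by auto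
  obtain c r0 \<kappa> where c: "0 < c" "0 < r0" "0 < \<kappa>"
    "\<And>\<rho> n k. \<lbrakk>0 < \<rho>; \<rho> < r0\<rbrakk> \<Longrightarrow>
       \<exists>E\<in>events. {\<omega>\<in>space M. \<forall>S\<subseteq>{1..n}. clique \<rho> \<omega> S \<longrightarrow> card S < k} \<subseteq> E \<and>
         prob E \<le> exp (- \<kappa> * real n) + exp (- (c / \<rho> ^ DIM('a) * (real ((n - nat \<lceil>1/2 * real n\<rceil>) choose k) *
            ((1 - 1/2) * (v * \<rho> ^ DIM('a))) ^ k * (1 - (1 + 1/2) * (v * \<rho> ^ DIM('a))) ^ n)))"
    using prob_no_clique_le[OF half, unfolded vP] by blast
  show thesis
  \<comment> \<open>The constant \<open>v / 8\<close> combines \<open>b \<ge> n / 4\<close> with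
    half the ball mass; \<open>3 * v\<close> is twice \<open>(1 + 1/2) * v\<close>.\<close>
  proof (rule that[of "v / 8" "3 * v" c \<kappa>])
    have "eventually (\<lambda>n. r n ^ DIM('a) < 1 / (3 * v)) sequentially" using v by (intro eventually_rd_less) simp
    with eventually_r_less[OF c(2)] eventually_ge_at_top[of 4]
    show "eventually (\<lambda>n. \<forall>k. 1 \<le> k \<longrightarrow> 4 * k \<le> n \<longrightarrow>
       (\<exists>E\<in>events. {\<omega>\<in>space M. cl n \<omega> < k} \<subseteq> E \<and> prob E \<le> exp (- \<kappa> * real n) +
          exp (- (c * (real n / (real n * r n ^ DIM('a))) * (v / 8 * (real n * r n ^ DIM('a)) / real k) ^ k * exp (- (3 * v) * (real n * r n ^ DIM('a))))))) sequentially"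
    proof eventually_elim
      case (elim n)
      show ?case
      proof (intro allI impI)
        fix k :: nat assume k: "1 \<le> k" "4 * k \<le> n"
        define b where "b = n - nat \<lceil>1/2 * real n\<rceil>"
        define rd where "rd = r n ^ DIM('a)"
        have rd: "rd > 0" "rd < 1 / (3 * v)" using r_pos[of n] elim by (auto simp: rd_def)
        have "nat \<lceil>1/2 * real n\<rceil> \<le> n" by linarith
        then have b1: "real b = real n - real (nat \<lceil>1/2 * real n\<rceil>)" unfolding b_def by simp
        moreover have "real (nat \<lceil>1/2 * real n\<rceil>) \<le> 1/2 * real n + 1" by linarith
        moreover have "4 \<le> real n" using elim(2) by simp
        ultimately have b: "real n / 4 \<le> real b" by linarith
        then have kb: "k \<le> b" using k(2) by linarith
        obtain E where E: "E \<in> events" "{\<omega>\<in>space M. cl n \<omega> < k} \<subseteq> E"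
          "prob E \<le> exp (- \<kappa> * real n) + exp (- (c / rd * (real (b choose k) * ((1 - 1/2) * (v * rd)) ^ k * (1 - (1 + 1/2) * (v * rd)) ^ n)))"
          using c(4)[OF r_pos elim(1), of n k] unfolding cl_less_iff rd_def b_def by blast
        have "(v / 8 * (real n * rd) / real k) ^ k * exp (- (3 * v) * (real n * rd)) \<le>
            real (b choose k) * ((1 - 1/2) * (v * rd)) ^ k * (1 - (1 + 1/2) * (v * rd)) ^ n"
        proof (rule mult_mono)
          have "(v / 8 * (real n * rd) / real k) ^ k = (real n / 4 / real k) ^ k * ((1 - 1/2) * (v * rd)) ^ k"
            unfolding power_mult_distrib[symmetric] by (simp add: field_simps)
          also have "\<dots> \<le> (real b / real k) ^ k * ((1 - 1/2) * (v * rd)) ^ k"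
            using b v rd by (intro mult_right_mono power_mono divide_right_mono) auto
          also have "\<dots> \<le> real (b choose k) * ((1 - 1/2) * (v * rd)) ^ k"
            using v rd binomial_ge_n_over_k_pow_k[OF kb, where 'a = real] by (intro mult_right_mono) auto
          finally show "(v / 8 * (real n * rd) / real k) ^ k \<le> real (b choose k) * ((1 - 1/2) * (v * rd)) ^ k" .
          define z where "z = (1 + 1/2) * (v * rd)"
          have "v * rd < 1/3" using rd v by (simp add: field_simps)
          moreover have "0 < v * rd" using v rd by simp
          moreover have "z = 3 / 2 * (v * rd)" by (simp add: z_def)
          ultimately have z: "0 \<le> z" "z \<le> 1/2" by linarith+
          have "z * (2 * z) \<le> z * 1" using z by (intro mult_left_mono) auto
          then have "z + 2 * z\<^sup>2 \<le> 2 * z" by (simp add: power2_eq_square)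
          then have "real n * (z + 2 * z\<^sup>2) \<le> real n * (2 * z)" by (intro mult_left_mono) auto
          also have "\<dots> = 3 * v * (real n * rd)" by (simp add: z_def)
          finally have "exp (- (3 * v) * (real n * rd)) \<le> exp (- (real n * (z + 2 * z\<^sup>2)))" by simp
          also have "\<dots> \<le> (1 - z) ^ n" by (rule exp_le_one_minus_pow[OF z])
          finally show "exp (- (3 * v) * (real n * rd)) \<le> (1 - (1 + 1/2) * (v * rd)) ^ n" by (simp add: z_def)
        qed (use v rd in auto)
        then have "c / rd * ((v / 8 * (real n * rd) / real k) ^ k * exp (- (3 * v) * (real n * rd))) \<le>
           c / rd * (real (b choose k) * ((1 - 1/2) * (v * rd)) ^ k * (1 - (1 + 1/2) * (v * rd)) ^ n)"
          using c(1) rd by (intro mult_left_mono) auto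
        moreover have "c / rd = c * (real n / (real n * rd))" using elim(2) by simp
        ultimately have le: "exp (- (c / rd * (real (b choose k) * ((1 - 1/2) * (v * rd)) ^ k * (1 - (1 + 1/2) * (v * rd)) ^ n))) \<le>
          exp (- (c * (real n / (real n * rd)) * (v / 8 * (real n * rd) / real k) ^ k * exp (- (3 * v) * (real n * rd))))"
          by (simp add: mult.assoc)
        show "\<exists>E\<in>events. {\<omega>\<in>space M. cl n \<omega> < k} \<subseteq> E \<and> prob E \<le> exp (- \<kappa> * real n) +
          exp (- (c * (real n / (real n * r n ^ DIM('a))) * (v / 8 * (real n * r n ^ DIM('a)) / real k) ^ k * exp (- (3 * v) * (real n * r n ^ DIM('a)))))"
          using E(1,2) order_trans[OF E(3) add_left_mono[OF le]] unfolding rd_def[symmetric] by blast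
      qed
    qed
  qed (use v c in auto)
qed

text \<open>A ball of mean occupation about \<open>v * a n\<close> holds \<open>g * a n\<close>
  points with probability about \<open>exp (- a n * (g * ln (g / v) - g + v))\<close>, that is
  \<open>n\<close> to a negative power. There are of order \<open>n / a n\<close> balls, so the
  hypothesis makes the expected number of full balls grow like a positive power of \<open>n\<close>,
  far above \<open>2 * ln n\<close>.\<close>

lemma clique_number_lower_critical:
  assumes lim: "(\<lambda>n. \<sigma> * real n * r n ^ DIM('a) / ln (real n)) \<longlonglongrightarrow> t" and t: "t > 0" and g: "g > 0"
    and H: "t * (g * ln (g / (volB / 2 ^ DIM('a))) - g + volB / 2 ^ DIM('a)) < 1"
  shows "AE \<omega> in M. eventually (\<lambda>n. g * (\<sigma> * real n * r n ^ DIM('a)) \<le> real (cl n \<omega>)) sequentially"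
proof -
  define v where "v = volB / 2 ^ DIM('a)"
  have v: "v > 0" using volB_pos by (simp add: v_def)
  \<comment> \<open>The factor \<open>1 - 2 * \<epsilon>\<close> accounts for the points set aside
    and the \<open>k\<close> chosen ones, \<open>1 - \<epsilon>\<close> for the mass of a ball. Of
    the two factors \<open>1 + \<epsilon>\<close> one comes from the relative mass, the other from
    bounding \<open>(1 - z)^n\<close> by an exponential.\<close>
  define \<psi> where "\<psi> \<epsilon> = t * (g * ln (g / ((1 - 2 * \<epsilon>) * (1 - \<epsilon>) * v)) - g + (1 + \<epsilon>)\<^sup>2 * v)" for \<epsilon>
  have "((\<lambda>\<epsilon>. \<psi> \<epsilon>) \<longlongrightarrow> \<psi> 0) (at_right 0)"
    unfolding \<psi>_def using v g by (intro tendsto_intros) auto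
  moreover have "\<psi> 0 < 1" using H by (simp add: \<psi>_def v_def)
  ultimately have "eventually (\<lambda>\<epsilon>. \<psi> \<epsilon> < 1) (at_right 0)" by (rule order_tendstoD(2))
  moreover have "eventually (\<lambda>\<epsilon>::real. 0 < \<epsilon> \<and> \<epsilon> < 1/4) (at_right 0)" by (rule eventually_at_right_0_between) simp
  ultimately have "eventually (\<lambda>\<epsilon>. \<psi> \<epsilon> < 1 \<and> 0 < \<epsilon> \<and> \<epsilon> < 1/4) (at_right 0)" by (rule eventually_conj)
  then obtain \<epsilon> where \<epsilon>: "\<psi> \<epsilon> < 1" "0 < \<epsilon>" "\<epsilon> < 1/4"
    using eventually_happens'[OF trivial_limit_at_right_real] by blast
  have \<epsilon>1: "\<epsilon> < 1" using \<epsilon> by simp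
  define \<mu> where "\<mu> = (1 - 2 * \<epsilon>) * (1 - \<epsilon>) * v"
  have \<mu>: "\<mu> > 0" using \<epsilon> v by (simp add: \<mu>_def)
  obtain c r0 \<kappa> where c: "0 < c" "0 < r0" "0 < \<kappa>"
    "\<And>\<rho> n k. \<lbrakk>0 < \<rho>; \<rho> < r0\<rbrakk> \<Longrightarrow>
       \<exists>E\<in>events. {\<omega>\<in>space M. \<forall>S\<subseteq>{1..n}. clique \<rho> \<omega> S \<longrightarrow> card S < k} \<subseteq> E \<and>
         prob E \<le> exp (- \<kappa> * real n) + exp (- (c / \<rho> ^ DIM('a) * (real ((n - nat \<lceil>\<epsilon> * real n\<rceil>) choose k) *
            ((1 - \<epsilon>) * (\<sigma> * volB * (\<rho> / 2) ^ DIM('a))) ^ k * (1 - (1 + \<epsilon>) * (\<sigma> * volB * (\<rho> / 2) ^ DIM('a))) ^ n)))"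
    using prob_no_clique_le[OF \<epsilon>(2) \<epsilon>1] by blast
  define a where "a n = \<sigma> * real n * r n ^ DIM('a)" for n
  have lim_a: "(\<lambda>n. a n / ln (real n)) \<longlonglongrightarrow> t" using lim by (simp add: a_def)
  define k where "k n = nat \<lceil>g * a n\<rceil>" for n
  define W where "W n = c / r n ^ DIM('a) * (real ((n - nat \<lceil>\<epsilon> * real n\<rceil>) choose k n) *
            ((1 - \<epsilon>) * (\<sigma> * volB * (r n / 2) ^ DIM('a))) ^ k n * (1 - (1 + \<epsilon>) * (\<sigma> * volB * (r n / 2) ^ DIM('a))) ^ n)" for n
  have ln_top: "filterlim (\<lambda>n. ln (real n)) at_top sequentially" by real_asymp
  have a_top: "filterlim a at_top sequentially"
  proof -
    have "filterlim (\<lambda>n. a n / ln (real n) * ln (real n)) at_top sequentially"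
      by (rule filterlim_tendsto_pos_mult_at_top[OF lim_a t ln_top])
    moreover have "eventually (\<lambda>n. a n / ln (real n) * ln (real n) = a n) sequentially"
      using eventually_gt_at_top[of 1] by eventually_elim auto
    ultimately show ?thesis using filterlim_cong[OF refl refl, of "\<lambda>n. a n / ln (real n) * ln (real n)" a] by blast
  qed
  have a_pos: "eventually (\<lambda>n. a n > 0) sequentially" using a_top by (simp add: filterlim_at_top_dense)
  have lim_k: "(\<lambda>n. real (k n) / a n) \<longlonglongrightarrow> g"
  proof (rule tendsto_sandwich)
    show "(\<lambda>n. g) \<longlonglongrightarrow> g" by simp
    have "(\<lambda>n. g + 1 / a n) \<longlonglongrightarrow> g + 0"
      by (intro tendsto_intros tendsto_divide_0[OF tendsto_const] filterlim_at_top_imp_at_infinity a_top)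
    then show "(\<lambda>n. g + 1 / a n) \<longlonglongrightarrow> g" by simp
    show "eventually (\<lambda>n. g \<le> real (k n) / a n) sequentially" using a_pos
    proof eventually_elim
      case (elim n)
      have "g * a n \<le> real (k n)" unfolding k_def by (rule of_nat_ceiling)
      then show ?case using elim by (simp add: field_simps)
    qed
    show "eventually (\<lambda>n. real (k n) / a n \<le> g + 1 / a n) sequentially" using a_pos
    proof eventually_elim
      case (elim n)
      have "0 \<le> g * a n" using elim g by simp
      then have "real (k n) \<le> g * a n + 1" unfolding k_def by linarith
      then show ?case using elim by (simp add: field_simps)
    qed
  qed
  have lim_kl: "(\<lambda>n. real (k n) / ln (real n)) \<longlonglongrightarrow> g * t"
  proof (rule Lim_transform_eventually[OF tendsto_mult[OF lim_k lim_a]])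
    show "eventually (\<lambda>n. real (k n) / a n * (a n / ln (real n)) = real (k n) / ln (real n)) sequentially"
      using a_pos by eventually_elim simp
  qed
  have lim_lna: "(\<lambda>n. ln (a n) / ln (real n)) \<longlonglongrightarrow> 0"
  proof (rule Lim_transform_eventually)
    have "(\<lambda>n. ln (a n / ln (real n)) * (1 / ln (real n)) + ln (ln (real n)) / ln (real n)) \<longlonglongrightarrow> ln t * 0 + 0"
      using t by (intro tendsto_add tendsto_mult tendsto_ln lim_a) (auto, real_asymp+)
    then show "(\<lambda>n. ln (a n / ln (real n)) * (1 / ln (real n)) + ln (ln (real n)) / ln (real n)) \<longlonglongrightarrow> 0" by simp
    show "eventually (\<lambda>n. ln (a n / ln (real n)) * (1 / ln (real n)) + ln (ln (real n)) / ln (real n) = ln (a n) / ln (real n)) sequentially"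
      using a_pos eventually_gt_at_top[of 1]
    proof eventually_elim
      case (elim n)
      then have "ln (a n / ln (real n)) = ln (a n) - ln (ln (real n))" by (simp add: ln_div)
      then show ?case by (simp add: diff_divide_distrib)
    qed
  qed
  have k_pos: "eventually (\<lambda>n. k n \<ge> 1) sequentially"
    using a_pos by eventually_elim (use g in \<open>simp add: k_def Suc_le_eq\<close>)
  have lim_lnk: "(\<lambda>n. ln (real (k n)) / ln (real n)) \<longlonglongrightarrow> 0"
  proof (rule Lim_transform_eventually)
    have "(\<lambda>n. ln (real (k n) / a n) * (1 / ln (real n)) + ln (a n) / ln (real n)) \<longlonglongrightarrow> ln g * 0 + 0"
      using g by (intro tendsto_add tendsto_mult tendsto_ln lim_k lim_lna) (auto, real_asymp+)
    then show "(\<lambda>n. ln (real (k n) / a n) * (1 / ln (real n)) + ln (a n) / ln (real n)) \<longlonglongrightarrow> 0" by simp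
    show "eventually (\<lambda>n. ln (real (k n) / a n) * (1 / ln (real n)) + ln (a n) / ln (real n) = ln (real (k n)) / ln (real n)) sequentially"
      using a_pos k_pos
    proof eventually_elim
      case (elim n)
      then have "ln (real (k n) / a n) = ln (real (k n)) - ln (a n)" by (simp add: ln_div)
      then show ?case by (simp add: diff_divide_distrib)
    qed
  qed
  \<comment> \<open>The logarithm of a lower bound for \<open>W n\<close>: the number of balls, the
    factor \<open>(\<mu> * a n)^k / k!\<close> with the factorial estimated by
    \<open>ln_fact_le\<close>, and the probability that the remaining points avoid the ball.\<close>
  define E where "E n = ln (c * \<sigma>) - 1 + ln (real n) - ln (a n) - ln (real (k n)) + real (k n) * (ln \<mu> - ln (real (k n) / a n) + 1) - (1 + \<epsilon>)\<^sup>2 * v * a n" for n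
  have lim_E: "(\<lambda>n. E n / ln (real n)) \<longlonglongrightarrow> 1 - \<psi> \<epsilon>"
  proof (rule Lim_transform_eventually)
    have "(\<lambda>n. (ln (c * \<sigma>) - 1) * (1 / ln (real n)) + 1 - ln (a n) / ln (real n) - ln (real (k n)) / ln (real n) +
        real (k n) / ln (real n) * (ln \<mu> - ln (real (k n) / a n) + 1) - (1 + \<epsilon>)\<^sup>2 * v * (a n / ln (real n)))
      \<longlonglongrightarrow> (ln (c * \<sigma>) - 1) * 0 + 1 - 0 - 0 + g * t * (ln \<mu> - ln g + 1) - (1 + \<epsilon>)\<^sup>2 * v * t"
      using g by (intro tendsto_intros lim_a lim_k lim_kl lim_lna lim_lnk) (auto, real_asymp)
    also have "(ln (c * \<sigma>) - 1) * 0 + 1 - 0 - 0 + g * t * (ln \<mu> - ln g + 1) - (1 + \<epsilon>)\<^sup>2 * v * t = 1 - \<psi> \<epsilon>"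
      unfolding \<psi>_def \<mu>_def[symmetric] using g \<mu> by (simp add: ln_div algebra_simps)
    finally show "(\<lambda>n. (ln (c * \<sigma>) - 1) * (1 / ln (real n)) + 1 - ln (a n) / ln (real n) - ln (real (k n)) / ln (real n) +
        real (k n) / ln (real n) * (ln \<mu> - ln (real (k n) / a n) + 1) - (1 + \<epsilon>)\<^sup>2 * v * (a n / ln (real n))) \<longlonglongrightarrow> 1 - \<psi> \<epsilon>" .
    show "eventually (\<lambda>n. (ln (c * \<sigma>) - 1) * (1 / ln (real n)) + 1 - ln (a n) / ln (real n) - ln (real (k n)) / ln (real n) +
        real (k n) / ln (real n) * (ln \<mu> - ln (real (k n) / a n) + 1) - (1 + \<epsilon>)\<^sup>2 * v * (a n / ln (real n)) = E n / ln (real n)) sequentially"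
      using eventually_gt_at_top[of 1]
    proof eventually_elim
      case (elim n)
      then have "ln (real n) \<noteq> 0" by simp
      then show ?case unfolding E_def add_divide_distrib diff_divide_distrib by (simp add: diff_divide_distrib)
    qed
  qed
  define \<eta> where "\<eta> = (1 - \<psi> \<epsilon>) / 2"
  have \<eta>: "\<eta> > 0" "\<eta> < 1 - \<psi> \<epsilon>" using \<epsilon> by (auto simp: \<eta>_def)
  have an: "(\<lambda>n. a n / real n) \<longlonglongrightarrow> 0"
  proof (rule Lim_transform_eventually)
    have "(\<lambda>n. r n ^ DIM('a)) \<longlonglongrightarrow> 0 ^ DIM('a)" by (intro tendsto_power r_lim)
    then have "(\<lambda>n. \<sigma> * r n ^ DIM('a)) \<longlonglongrightarrow> \<sigma> * 0" by (intro tendsto_mult tendsto_const) (simp add: zero_power)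
    then show "(\<lambda>n. \<sigma> * r n ^ DIM('a)) \<longlonglongrightarrow> 0" by simp
    show "eventually (\<lambda>n. \<sigma> * r n ^ DIM('a) = a n / real n) sequentially"
      using eventually_gt_at_top[of 0] by eventually_elim (simp add: a_def)
  qed
  define w where "w = (1 + \<epsilon>) * v"
  have w: "w > 0" using \<epsilon> v by (simp add: w_def)
  have W_ge: "eventually (\<lambda>n. exp (E n) \<le> W n) sequentially"
  proof -
    have "eventually (\<lambda>n. a n / real n < \<epsilon> / (4 * g)) sequentially"
      using \<epsilon> g by (intro order_tendstoD(2)[OF an]) auto
    moreover have "eventually (\<lambda>n. a n / real n < \<epsilon> / (4 * w)) sequentially"
      using \<epsilon> w by (intro order_tendstoD(2)[OF an]) auto
    \<comment> \<open>This absorbs the two roundings up, in the number of points set aside and in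
      \<open>k n\<close>.\<close>
    moreover have "eventually (\<lambda>n. real n > 4 / \<epsilon>) sequentially" by real_asymp
    ultimately show ?thesis using a_pos k_pos
    proof eventually_elim
      case (elim n)
      have n: "real n > 0" using elim(3) \<epsilon> by (meson divide_pos_pos less_trans zero_less_numeral)
      define b where "b = n - nat \<lceil>\<epsilon> * real n\<rceil>"
      define P where "P = v * a n / real n"
      have P: "\<sigma> * volB * (r n / 2) ^ DIM('a) = P" using n by (simp add: P_def v_def a_def power_divide)
      have P0: "P > 0" using v elim(4) n by (simp add: P_def)
      have f1: "c / r n ^ DIM('a) = c * \<sigma> * real n / a n" using n \<sigma>_pos by (simp add: a_def)
      have "(1 - 2 * \<epsilon>) * real n \<le> real b - real (k n)"
      proof -
        have en: "4 < \<epsilon> * real n" using elim(3) \<epsilon> by (simp add: field_simps)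
        have "real (nat \<lceil>\<epsilon> * real n\<rceil>) \<le> \<epsilon> * real n + 1" using en by linarith
        moreover have "real b \<ge> real n - real (nat \<lceil>\<epsilon> * real n\<rceil>)" unfolding b_def by linarith
        moreover have "real (k n) \<le> g * a n + 1" unfolding k_def using elim(4) g by (smt (verit) mult_pos_pos of_nat_nat ceiling_correct zero_le_ceiling)
        moreover have "g * a n \<le> \<epsilon> * real n / 4" using elim(1) g n by (simp add: field_simps)
        ultimately show ?thesis using en by (simp add: algebra_simps)
      qed
      have f2: "exp (- ((1 + \<epsilon>)\<^sup>2 * v * a n)) \<le> (1 - (1 + \<epsilon>) * P) ^ n"
      proof -
        define z where "z = (1 + \<epsilon>) * P"
        have z0: "0 \<le> z" using \<epsilon> P0 by (simp add: z_def)
        have "w * (a n / real n) \<le> w * (\<epsilon> / (4 * w))"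
          using elim(2) w by (intro mult_left_mono) auto
        also have "\<dots> = \<epsilon> / 4" using w by simp
        finally have z4: "z \<le> \<epsilon> / 4" by (simp add: z_def P_def w_def mult.assoc)
        then have "z \<le> 1/2" using \<epsilon> by simp
        from exp_le_one_minus_pow[OF z0 this, of n]
        have "exp (- (real n * (z + 2 * z\<^sup>2))) \<le> (1 - z) ^ n" .
        moreover have "real n * (z + 2 * z\<^sup>2) \<le> (1 + \<epsilon>)\<^sup>2 * v * a n"
        proof -
          have "z * (1 + 2 * z) \<le> z * (1 + \<epsilon>)" using z0 z4 \<epsilon> by (intro mult_left_mono) auto
          then have "real n * (z + 2 * z\<^sup>2) \<le> real n * (z * (1 + \<epsilon>))"
            by (intro mult_left_mono) (auto simp: power2_eq_square algebra_simps)
          also have "\<dots> = (1 + \<epsilon>)\<^sup>2 * v * a n" using n by (simp add: z_def P_def power2_eq_square)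
          finally show ?thesis .
        qed
        ultimately show ?thesis unfolding z_def[symmetric] by (meson exp_le_cancel_iff neg_le_iff_le order_trans)
      qed
      have f3: "(\<mu> * a n) ^ k n / fact (k n) \<le> real (b choose k n) * ((1 - \<epsilon>) * P) ^ k n"
      proof -
        have nn: "0 \<le> (1 - 2 * \<epsilon>) * real n" using \<epsilon> by simp
        then have kb: "k n \<le> b" using \<open>(1 - 2 * \<epsilon>) * real n \<le> real b - real (k n)\<close> by linarith
        have "\<mu> * a n = ((1 - 2 * \<epsilon>) * real n) * ((1 - \<epsilon>) * P)" using n by (simp add: \<mu>_def P_def)
        then have "(\<mu> * a n) ^ k n / fact (k n) = ((1 - 2 * \<epsilon>) * real n) ^ k n / fact (k n) * ((1 - \<epsilon>) * P) ^ k n"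
          by (simp add: power_mult_distrib)
        also have "\<dots> \<le> (real b - real (k n)) ^ k n / fact (k n) * ((1 - \<epsilon>) * P) ^ k n"
          using nn \<open>(1 - 2 * \<epsilon>) * real n \<le> real b - real (k n)\<close> \<epsilon> P0
          by (intro mult_right_mono divide_right_mono power_mono) auto
        also have "\<dots> \<le> real (b choose k n) * ((1 - \<epsilon>) * P) ^ k n"
          using binomial_ge_pow_div_fact[OF kb] \<epsilon> P0 by (intro mult_right_mono) auto
        finally show ?thesis .
      qed
      have W: "c * \<sigma> * real n / a n * ((\<mu> * a n) ^ k n / fact (k n) * exp (- ((1 + \<epsilon>)\<^sup>2 * v * a n))) \<le> W n"
        unfolding W_def P b_def[symmetric] f1
        by (intro mult_left_mono mult_mono f2 f3) (use c(1) \<sigma>_pos n elim(4) \<mu> \<epsilon> P0 in auto)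
      have "exp (E n) \<le> c * \<sigma> * real n / a n * ((\<mu> * a n) ^ k n / fact (k n) * exp (- ((1 + \<epsilon>)\<^sup>2 * v * a n)))"
      proof -
        have pos: "0 < c * \<sigma> * real n / a n" "0 < (\<mu> * a n) ^ k n / (fact (k n) :: real)" "0 < c * \<sigma>" "0 < real (k n)"
          using c(1) \<sigma>_pos n elim \<mu> by auto
        have e1: "c * \<sigma> * real n / a n * ((\<mu> * a n) ^ k n / fact (k n) * exp (- ((1 + \<epsilon>)\<^sup>2 * v * a n))) =
          exp (ln (c * \<sigma> * real n / a n) + (ln ((\<mu> * a n) ^ k n / fact (k n)) - (1 + \<epsilon>)\<^sup>2 * v * a n))"
          using pos by (simp add: exp_add exp_diff exp_minus divide_inverse)
        have e2: "ln (c * \<sigma> * real n / a n) = ln (c * \<sigma>) + ln (real n) - ln (a n)"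
          using pos(3) n elim(4) c(1) \<sigma>_pos by (simp add: ln_div ln_mult)
        have e3: "ln ((\<mu> * a n) ^ k n / fact (k n)) = real (k n) * (ln \<mu> + ln (a n)) - ln (fact (k n))"
          using \<mu> elim(4) by (simp add: ln_div ln_realpow ln_mult)
        have e4: "ln (fact (k n) :: real) \<le> (real (k n) + 1) * ln (real (k n)) - real (k n) + 1"
          by (rule ln_fact_le[OF elim(5)])
        have e5: "ln (real (k n) / a n) = ln (real (k n)) - ln (a n)" using pos elim(4) by (simp add: ln_div)
        show ?thesis unfolding e1 exp_le_cancel_iff E_def e2 e3 e5 using e4 by (simp add: algebra_simps)
      qed
      then show ?case using W by linarith
    qed
  qed
  have "AE \<omega> in M. eventually (\<lambda>n. k n \<le> cl n \<omega>) sequentially"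
  proof (rule AE_clique_number_ge[OF c(3), of _ W])
    show "eventually (\<lambda>n. \<exists>E\<in>events. {\<omega>\<in>space M. cl n \<omega> < k n} \<subseteq> E \<and> prob E \<le> exp (- \<kappa> * real n) + exp (- W n)) sequentially"
      using eventually_r_less[OF c(2)]
    proof eventually_elim
      case (elim n)
      show ?case using c(4)[OF r_pos elim, of n "k n"] unfolding cl_less_iff W_def by blast
    qed
    have "eventually (\<lambda>n. \<eta> < E n / ln (real n)) sequentially" using \<eta> by (intro order_tendstoD(1)[OF lim_E])
    moreover have "eventually (\<lambda>n. 2 * ln (real n) \<le> real n powr \<eta>) sequentially" using \<eta> by real_asymp
    ultimately show "eventually (\<lambda>n. 2 * ln (real n) \<le> W n) sequentially"
      using W_ge eventually_gt_at_top[of 1]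
    proof eventually_elim
      case (elim n)
      have "\<eta> * ln (real n) \<le> E n" using elim(1,4) by (simp add: pos_less_divide_eq)
      then have "real n powr \<eta> \<le> exp (E n)" using elim(4) by (simp add: powr_def)
      then show ?case using elim(2,3) by linarith
    qed
  qed
  then show ?thesis
  proof eventually_elim
    case (elim \<omega>)
    then show ?case
    proof eventually_elim
      case (elim n)
      have "g * a n \<le> real (k n)" unfolding k_def by (rule of_nat_ceiling)
      then show ?case using elim unfolding a_def by linarith
    qed
  qed
qed

end

section \<open>The four regimes\<close>

text \<open>Countably many tolerances suffice, so one null set works. They stay below
  \<open>e0\<close> because the lower bounds are available only for levels close to the
  limit.\<close>

lemma AE_tendstoI:
  fixes Y :: "nat \<Rightarrow> 'w \<Rightarrow> real"
  assumes e0: "e0 > 0"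
    and ev: "\<And>e. 0 < e \<Longrightarrow> e < e0 \<Longrightarrow> AE \<omega> in M. eventually (\<lambda>n. L - e \<le> Y n \<omega> \<and> Y n \<omega> \<le> L + e) sequentially"
  shows "AE \<omega> in M. (\<lambda>n. Y n \<omega>) \<longlonglongrightarrow> L"
proof -
  define e where "e m = e0 / real (m + 2)" for m :: nat
  have e: "0 < e m" "e m < e0" for m using e0 by (auto simp: e_def divide_less_eq)
  have "AE \<omega> in M. \<forall>m. eventually (\<lambda>n. L - e m \<le> Y n \<omega> \<and> Y n \<omega> \<le> L + e m) sequentially"
    unfolding AE_all_countable using ev e by blast
  then show ?thesis
  proof eventually_elim
    case (elim \<omega>)
    show ?case
    proof (rule metric_LIMSEQ_I)
      fix \<delta> :: real assume "0 < \<delta>"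
      moreover have "e \<longlonglongrightarrow> 0" unfolding e_def by real_asymp
      ultimately obtain m where m: "e m < \<delta>"
        using order_tendstoD(2)[of e 0 sequentially \<delta>] eventually_sequentially by (metis le_refl)
      from elim[rule_format, of m] obtain n0 where "\<And>n. n \<ge> n0 \<Longrightarrow> L - e m \<le> Y n \<omega> \<and> Y n \<omega> \<le> L + e m"
        unfolding eventually_sequentially by blast
      then show "\<exists>n0. \<forall>n\<ge>n0. dist (Y n \<omega>) L < \<delta>"
        using m by (intro exI[of _ n0]) (fastforce simp: dist_real_def abs_less_iff)
    qed
  qed
qed

context random_geometric_graph
begin

text \<open>With \<open>y = n^(-1 / q)\<close>, about \<open>n * y^l = n^(1 - l / q)\<close> cliques
  of size \<open>l + 1\<close> are expected, so the transition is at \<open>l = q\<close>. The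
  offset \<open>1/2\<close> in \<open>k\<close> keeps both decisions away from it by at least
  \<open>1/2\<close>: size \<open>k + 2\<close> means \<open>l = k + 1 > q + 1/2\<close>, and size
  \<open>k\<close> means \<open>l = k - 1 \<le> q - 1/2\<close>. Since \<open>q\<close> is bounded
  by \<open>1 / \<alpha>\<close>, this gap is a fixed power of \<open>n\<close>.\<close>

lemma clique_number_very_sparse:
  assumes \<alpha>: "\<alpha> > 0" and sparse: "eventually (\<lambda>n. real n * r n ^ DIM('a) \<le> real n powr (- \<alpha>)) sequentially"
  shows "AE \<omega> in M. eventually (\<lambda>n. int (cl n \<omega>) \<in>
      {\<lfloor>ln (real n) / ln (1 / (real n * r n ^ DIM('a))) + 1/2\<rfloor>,
       \<lfloor>ln (real n) / ln (1 / (real n * r n ^ DIM('a))) + 1/2\<rfloor> + 1}) sequentially"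
proof -
  define y where "y n = real n * r n ^ DIM('a)" for n
  define q where "q n = ln (real n) / ln (1 / y n)" for n
  define k where "k n = nat \<lfloor>q n + 1/2\<rfloor>" for n
  have basic: "eventually (\<lambda>n. 2 \<le> n \<and> 0 < y n \<and> y n \<le> 1 \<and> 0 < q n \<and> q n \<le> 1 / \<alpha> \<and> y n = real n powr (- 1 / q n)) sequentially"
    using sparse eventually_ge_at_top[of 2]
  proof eventually_elim
    case (elim n)
    have y0: "0 < y n" using r_pos[of n] elim(2) by (simp add: y_def)
    have lnn: "0 < ln (real n)" using elim(2) by simp
    have "ln (y n) \<le> ln (real n powr (- \<alpha>))"
      using elim y0 by (subst ln_le_cancel_iff) (auto simp: y_def)
    also have "\<dots> = - \<alpha> * ln (real n)" using elim(2) by (simp add: ln_powr)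
    finally have l: "\<alpha> * ln (real n) \<le> ln (1 / y n)" using y0 by (simp add: ln_div)
    have pos: "0 < ln (1 / y n)" using l \<alpha> lnn by (meson less_le_trans mult_pos_pos)
    have "q n > 0" using pos lnn by (simp add: q_def)
    moreover have "q n \<le> 1 / \<alpha>" using l pos \<alpha> by (simp add: q_def field_simps)
    moreover have "y n \<le> 1" using pos y0 by (simp add: ln_div)
    moreover have "y n = real n powr (- 1 / q n)"
    proof -
      have "- 1 / q n * ln (real n) = ln (y n)" using lnn pos y0 by (simp add: q_def ln_div)
      then show ?thesis using y0 elim(2) by (simp add: powr_def)
    qed
    ultimately show ?case using y0 elim(2) by blast
  qed
  \<comment> \<open>An upper bound for \<open>k + 1\<close>, as \<open>k \<le> q + 1/2\<close> and
    \<open>q \<le> 1 / \<alpha>\<close>.\<close>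
  define L0 where "L0 = 1 / \<alpha> + 3 / 2"
  have "1 / \<alpha> > 0" using \<alpha> by simp
  then have L0: "L0 > 1" unfolding L0_def by linarith
  define \<delta> where "\<delta> = 1 / (4 * L0)"
  have \<delta>: "\<delta> > 0" using L0 by (simp add: \<delta>_def)
  obtain c where c: "c > 0" "AE \<omega> in M. eventually (\<lambda>n. \<forall>l\<ge>1. l + 1 \<le> cl n \<omega> \<longrightarrow>
      c * real l * real n powr (- (1 + \<delta>) / real l) < real n * r n ^ DIM('a)) sequentially"
    using clique_number_upper_sparse[OF \<delta>] by blast
  define \<eta> where "\<eta> = 1 / (4 * L0\<^sup>2)"
  have \<eta>: "\<eta> > 0" using L0 by (simp add: \<eta>_def)
  from c(2) have upper: "AE \<omega> in M. eventually (\<lambda>n. cl n \<omega> \<le> k n + 1) sequentially"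
  proof eventually_elim
    case (elim \<omega>)
    have "eventually (\<lambda>n. real n powr (- \<eta>) < c) sequentially" using \<eta> c(1) by real_asymp
    with elim basic show ?case
    proof eventually_elim
      case (elim n)
      define l where "l = k n + 1"
      have n: "real n \<ge> 1" using elim(2) by simp
      have q: "0 < q n" "q n \<le> 1 / \<alpha>" and yq: "y n = real n powr (- 1 / q n)" using elim(2) by auto
      have kq: "real (k n) \<le> q n + 1/2" "q n + 1/2 < real (k n) + 1" unfolding k_def using q by linarith+
      have l: "q n < real l - 1/2" "real l \<le> L0" "1 \<le> l" using kq q by (auto simp: l_def L0_def)
      show ?case
      proof (rule ccontr)
        assume "\<not> cl n \<omega> \<le> k n + 1"
        then have "l + 1 \<le> cl n \<omega>" by (simp add: l_def)
        with elim(1) l(3) have "c * real l * real n powr (- (1 + \<delta>) / real l) < y n" by (simp add: y_def)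
        moreover have "c * 1 * real n powr (- (1 + \<delta>) / real l) \<le> c * real l * real n powr (- (1 + \<delta>) / real l)"
          using c(1) l(3) by (intro mult_right_mono mult_left_mono) auto
        ultimately have "c * real n powr (- (1 + \<delta>) / real l) < real n powr (- 1 / q n)" using yq by simp
        then have "c < real n powr (- 1 / q n) / real n powr (- (1 + \<delta>) / real l)"
          using n by (simp add: pos_less_divide_eq)
        also have "\<dots> = real n powr (- 1 / q n - (- (1 + \<delta>) / real l))" by (rule powr_diff[symmetric])
        also have "\<dots> \<le> real n powr (- \<eta>)"
        proof (rule powr_mono[OF _ n])
          \<comment> \<open>The intermediate value \<open>h\<close> exceeds \<open>q n\<close> and
            is \<open>1/2\<close> below \<open>l\<close>. The choices of \<open>\<delta>\<close> and
            \<open>\<eta>\<close> let \<open>\<delta> * h\<close> and \<open>\<eta> * l * h\<close>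
            each consume at most half of that gap.\<close>
          define h where "h = real l - 1/2"
          have h: "0 < h" "h \<le> L0" "real l = h + 1/2" "q n < h" using l q by (auto simp: h_def)
          have "- 1 / q n \<le> - 1 / h" using h q by (simp add: frac_le)
          moreover have "(1 + \<delta>) / real l - 1 / h \<le> - \<eta>"
          proof -
            have "\<delta> * h \<le> 1 / 4"
            proof -
              have "\<delta> * h \<le> \<delta> * L0" using h \<delta> by (intro mult_left_mono) auto
              also have "\<dots> = 1 / 4" using L0 by (simp add: \<delta>_def)
              finally show ?thesis .
            qed
            moreover have "\<eta> * (real l * h) \<le> 1 / 4"
            proof -
              have "real l * h \<le> L0 * L0" using h l(2) by (intro mult_mono) auto
              then have "\<eta> * (real l * h) \<le> \<eta> * (L0 * L0)" using \<eta> by (intro mult_left_mono) auto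
              also have "\<dots> = 1 / 4" using L0 by (simp add: \<eta>_def power2_eq_square)
              finally show ?thesis .
            qed
            ultimately have "(1 + \<delta>) * h - real l \<le> - \<eta> * (real l * h)" using h(3) by (simp add: algebra_simps)
            moreover have lh: "0 < real l * h" using h by simp
            moreover have "(1 + \<delta>) / real l - 1 / h = ((1 + \<delta>) * h - real l) / (real l * h)"
              using h by (simp add: field_simps)
            ultimately show ?thesis by (simp only: pos_divide_le_eq)
          qed
          ultimately show "- 1 / q n - (- (1 + \<delta>) / real l) \<le> - \<eta>"
            unfolding minus_divide_left[symmetric] by linarith
        qed
        finally show False using elim(3) by simp
      qed
    qed
  qed
  obtain c2 c3 c4 \<kappa> where cc: "c2 > 0" "c3 > 0" "c4 > 0" "\<kappa> > 0"
    "eventually (\<lambda>n. \<forall>k. 1 \<le> k \<longrightarrow> 4 * k \<le> n \<longrightarrow>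
       (\<exists>E\<in>events. {\<omega>\<in>space M. cl n \<omega> < k} \<subseteq> E \<and> prob E \<le> exp (- \<kappa> * real n) +
          exp (- (c4 * (real n / (real n * r n ^ DIM('a))) * (c2 * (real n * r n ^ DIM('a)) / real k) ^ k * exp (- c3 * (real n * r n ^ DIM('a))))))) sequentially"
    using prob_clique_number_less_sparse by blast
  \<comment> \<open>A uniform base for \<open>(c2 / k)^k\<close> over all \<open>k \<le> L0\<close>;
    being at most 1, its power decreases when the exponent is raised to
    \<open>nat \<lfloor>L0\<rfloor>\<close>.\<close>
  define m0 where "m0 = min 1 (c2 / L0)"
  have m0: "0 < m0" "m0 \<le> 1" using cc(1) L0 by (auto simp: m0_def)
  define c5 where "c5 = c4 * m0 ^ nat \<lfloor>L0\<rfloor> * exp (- c3)"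
  have c5: "c5 > 0" using cc m0 by (simp add: c5_def)
  have lower: "AE \<omega> in M. eventually (\<lambda>n. k n \<le> cl n \<omega>) sequentially"
  proof (rule AE_clique_number_ge[OF cc(4), of _ "\<lambda>n. c5 * real n powr (\<alpha> / 2)"])
    show "eventually (\<lambda>n. 2 * ln (real n) \<le> c5 * real n powr (\<alpha> / 2)) sequentially" using c5 \<alpha> by real_asymp
    have "eventually (\<lambda>n. 4 * L0 \<le> real n) sequentially" by real_asymp
    with cc(5) basic
    show "eventually (\<lambda>n. \<exists>E\<in>events. {\<omega>\<in>space M. cl n \<omega> < k n} \<subseteq> E \<and>
        prob E \<le> exp (- \<kappa> * real n) + exp (- (c5 * real n powr (\<alpha> / 2)))) sequentially"
    proof eventually_elim
      case (elim n)
      have n: "real n \<ge> 1" using elim(2) by simp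
      have y: "0 < y n" "y n \<le> 1" and q: "0 < q n" "q n \<le> 1 / \<alpha>" and yq: "y n = real n powr (- 1 / q n)" using elim(2) by auto
      have kq: "real (k n) \<le> q n + 1/2" unfolding k_def using q by linarith
      show ?case
      \<comment> \<open>A single vertex is a clique, so here the bad event is empty; this includes
        \<open>k n = 0\<close>, which the probability bound does not cover.\<close>
      proof (cases "k n \<le> 1")
        case True
        have "1 \<le> cl n \<omega>" for \<omega> using cl_pos elim(2) by simp
        then have "{\<omega>\<in>space M. cl n \<omega> < k n} = {}" using True by (auto simp: not_less) (meson order_trans)
        then show ?thesis by (intro bexI[of _ "{}"]) auto
      next
        case False
        then have k2: "2 \<le> k n" by simp
        have kL: "real (k n) \<le> L0" using kq q by (simp add: L0_def)
        have "real (4 * k n) \<le> real n" using kL elim(3) by simp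
        then have "4 * k n \<le> n" by linarith
        then obtain E where E: "E \<in> events" "{\<omega>\<in>space M. cl n \<omega> < k n} \<subseteq> E"
          "prob E \<le> exp (- \<kappa> * real n) + exp (- (c4 * (real n / y n) * (c2 * y n / real (k n)) ^ k n * exp (- c3 * y n)))"
          using elim(1) k2 unfolding y_def by (meson one_le_numeral order_trans)
        have "c5 * real n powr (\<alpha> / 2) \<le> c4 * (real n / y n) * (c2 * y n / real (k n)) ^ k n * exp (- c3 * y n)"
        proof -
          have "m0 ^ nat \<lfloor>L0\<rfloor> \<le> m0 ^ k n"
          proof (rule power_decreasing)
            show "k n \<le> nat \<lfloor>L0\<rfloor>" using kL by linarith
          qed (use m0 in auto)
          also have "\<dots> \<le> (c2 / real (k n)) ^ k n"
          proof (rule power_mono)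
            have "c2 / L0 \<le> c2 / real (k n)" using cc(1) kL k2 by (intro divide_left_mono) auto
            then show "m0 \<le> c2 / real (k n)" by (simp add: m0_def)
          qed (use m0 in auto)
          finally have 1: "m0 ^ nat \<lfloor>L0\<rfloor> \<le> (c2 / real (k n)) ^ k n" .
          \<comment> \<open>Rounding gives \<open>h \<le> q n\<close>, so
            \<open>1 - (k - 1) / q\<close> is at least \<open>1 / (2 * h)\<close>, and this is at
            least \<open>\<alpha> / 2\<close>.\<close>
          define h where "h = real (k n) - 1/2"
          have h: "h > 1" "h \<le> q n" "h \<le> 1 / \<alpha>" using k2 kq q by (auto simp: h_def)
          have "real n powr (\<alpha> / 2) \<le> real n powr (1 - (real (k n) - 1) / q n)"
          proof (rule powr_mono[OF _ n])
            have "(real (k n) - 1) / q n \<le> (real (k n) - 1) / h" using h k2 q by (intro divide_left_mono) auto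
            also have "\<dots> = 1 - 1 / (2 * h)" using h by (simp add: h_def field_simps)
            also have "\<alpha> / 2 \<le> 1 / (2 * h)" using h \<alpha> by (simp add: field_simps)
            then have "1 - 1 / (2 * h) \<le> 1 - \<alpha> / 2" by simp
            finally show "\<alpha> / 2 \<le> 1 - (real (k n) - 1) / q n" by linarith
          qed
          also have "\<dots> = real n * y n ^ (k n - 1)"
          proof -
            have "y n ^ (k n - 1) = real n powr (- 1 / q n * real (k n - 1))"
              unfolding yq using n by (subst powr_realpow[symmetric]) (auto simp: powr_powr)
            moreover have "real n = real n powr 1" using n by simp
            ultimately have "real n * y n ^ (k n - 1) = real n powr (1 + - 1 / q n * real (k n - 1))"
              by (metis powr_add)
            then show ?thesis using k2 by (simp add: of_nat_diff)
          qed
          finally have 2: "real n powr (\<alpha> / 2) \<le> real n * y n ^ (k n - 1)" .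
          have 3: "exp (- c3) \<le> exp (- c3 * y n)" using y cc(2) by simp
          have "c5 * real n powr (\<alpha> / 2) = c4 * (m0 ^ nat \<lfloor>L0\<rfloor> * real n powr (\<alpha> / 2) * exp (- c3))"
            by (simp add: c5_def)
          also have "\<dots> \<le> c4 * ((c2 / real (k n)) ^ k n * (real n * y n ^ (k n - 1)) * exp (- c3 * y n))"
            using 1 2 3 cc y m0 by (intro mult_left_mono mult_mono) auto
          also have "\<dots> = c4 * (real n / y n) * (c2 * y n / real (k n)) ^ k n * exp (- c3 * y n)"
          proof -
            have "y n ^ k n = y n * y n ^ (k n - 1)" using k2 by (metis One_nat_def Suc_1 Suc_le_D diff_Suc_1 power_Suc)
            moreover have "(c2 * y n / real (k n)) ^ k n = (c2 / real (k n)) ^ k n * y n ^ k n"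
              unfolding power_mult_distrib[symmetric] by simp
            ultimately show ?thesis using y by simp
          qed
          finally show ?thesis .
        qed
        then have "exp (- (c4 * (real n / y n) * (c2 * y n / real (k n)) ^ k n * exp (- c3 * y n))) \<le> exp (- (c5 * real n powr (\<alpha> / 2)))" by simp
        then show ?thesis using E(1,2) order_trans[OF E(3) add_left_mono] by blast
      qed
    qed
  qed
  from upper lower show ?thesis
  proof eventually_elim
    case (elim \<omega>)
    from elim basic show ?case
    proof eventually_elim
      case (elim n)
      have "0 \<le> \<lfloor>q n + 1/2\<rfloor>" using elim(3) by simp
      then have "int (k n) = \<lfloor>q n + 1/2\<rfloor>" by (simp add: k_def)
      then show ?case using elim(1,2) unfolding q_def y_def by auto
    qed
  qed
qed

text \<open>Both bounds are compared on the logarithmic scale, where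
  \<open>L n * ln (x n) = ln n\<close> is the main term. The lower condition on \<open>n r^d\<close>
  makes \<open>L\<close> tend to infinity, so additive constants in the size vanish in the ratio;
  the upper one makes \<open>x\<close> tend to infinity, so constants and
  \<open>ln (ln (x n))\<close> are negligible against \<open>ln (x n)\<close>.\<close>

lemma clique_number_sparse:
  assumes ge: "\<And>\<epsilon>. \<epsilon> > 0 \<Longrightarrow> (\<lambda>n. real n powr (- \<epsilon>)) \<in> o(\<lambda>n. real n * r n ^ DIM('a))"
    and le: "(\<lambda>n. real n * r n ^ DIM('a)) \<in> o(\<lambda>n. ln (real n))"
  shows "AE \<omega> in M. (\<lambda>n. real (cl n \<omega>) / (ln (real n) / ln (ln (real n) / (real n * r n ^ DIM('a))))) \<longlonglongrightarrow> 1"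
proof -
  define y where "y n = real n * r n ^ DIM('a)" for n
  define x where "x n = ln (real n) / y n" for n
  define L where "L n = ln (real n) / ln (x n)" for n
  have y_pos: "eventually (\<lambda>n. y n > 0) sequentially"
    using eventually_gt_at_top[of 0] by eventually_elim (use r_pos in \<open>simp add: y_def\<close>)
  have y_small: "eventually (\<lambda>n. y n \<le> e * ln (real n)) sequentially" if "e > 0" for e
    using landau_o.smallD[OF le that] eventually_gt_at_top[of 1]
    by eventually_elim (use r_pos in \<open>auto simp: y_def abs_mult power_abs less_imp_le\<close>)
  have x_top: "filterlim x at_top sequentially"
    unfolding filterlim_at_top
  proof
    fix Z :: real
    define Z' where "Z' = max Z 1"
    have Z': "Z' > 0" "Z \<le> Z'" by (auto simp: Z'_def)
    have "eventually (\<lambda>n. y n \<le> 1 / Z' * ln (real n)) sequentially" using Z' by (intro y_small) simp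
    then show "eventually (\<lambda>n. Z \<le> x n) sequentially" using y_pos
    proof eventually_elim
      case (elim n)
      then have "Z' \<le> x n" using Z' unfolding x_def by (simp add: field_simps)
      then show ?case using Z' by simp
    qed
  qed
  have L_top: "filterlim L at_top sequentially"
    unfolding filterlim_at_top
  proof
    fix Z :: real
    define Z' where "Z' = max Z 1"
    have Z': "Z' > 0" "Z \<le> Z'" by (auto simp: Z'_def)
    have "eventually (\<lambda>n. norm (real n powr (- (1 / (2 * Z')))) \<le> 1 * norm (real n * r n ^ DIM('a))) sequentially"
      using Z' by (intro landau_o.smallD[OF ge]) auto
    moreover have "eventually (\<lambda>n. ln (ln (real n)) \<le> 1 / (2 * Z') * ln (real n)) sequentially"
      using Z' by real_asymp
    moreover have "eventually (\<lambda>n. x n > 1) sequentially" using x_top by (simp add: filterlim_at_top_dense)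
    ultimately show "eventually (\<lambda>n. Z \<le> L n) sequentially" using y_pos eventually_gt_at_top[of 1]
    proof eventually_elim
      case (elim n)
      have "real n powr (- (1 / (2 * Z'))) \<le> y n" using elim(1,4) by (simp add: y_def)
      then have "ln (real n powr (- (1 / (2 * Z')))) \<le> ln (y n)" using elim(4,5) by (subst ln_le_cancel_iff) auto
      then have "- (1 / (2 * Z')) * ln (real n) \<le> ln (y n)" using elim(5) by (simp add: ln_powr)
      moreover have "ln (x n) = ln (ln (real n)) - ln (y n)" using elim(4,5) by (simp add: x_def ln_div)
      ultimately have "ln (x n) \<le> 1 / (2 * Z') * ln (real n) + 1 / (2 * Z') * ln (real n)" using elim(2) by simp
      also have "\<dots> = ln (real n) / Z'" by simp
      finally have "Z' * ln (x n) \<le> ln (real n)" using Z' by (simp add: field_simps)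
      moreover have "0 < ln (x n)" using elim(3) by simp
      ultimately have "Z' \<le> L n" unfolding L_def by (simp add: pos_le_divide_eq)
      then show ?case using Z' by simp
    qed
  qed
  have upper: "AE \<omega> in M. eventually (\<lambda>n. real (cl n \<omega>) \<le> (1 + \<epsilon>) * L n) sequentially" if \<epsilon>: "0 < \<epsilon>" for \<epsilon>
  proof -
    define \<delta> where "\<delta> = \<epsilon> / 4"
    have \<delta>: "\<delta> > 0" using \<epsilon> by (simp add: \<delta>_def)
    obtain c where c: "c > 0" "AE \<omega> in M. eventually (\<lambda>n. \<forall>l\<ge>1. l + 1 \<le> cl n \<omega> \<longrightarrow>
        c * real l * real n powr (- (1 + \<delta>) / real l) < real n * r n ^ DIM('a)) sequentially"
      using clique_number_upper_sparse[OF \<delta>] by blast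
    \<comment> \<open>Since \<open>\<delta>\<close> is smaller than \<open>\<epsilon> / 2\<close>, a
      size beyond \<open>(1 + \<epsilon> / 2) * L n\<close> leaves the positive fraction
      \<open>1 - s\<close> of \<open>ln (x n)\<close> to contradict the size bound.\<close>
    define s where "s = (1 + \<delta>) / (1 + \<epsilon> / 2)"
    have s: "s < 1" using \<epsilon> by (simp add: s_def \<delta>_def)
    from c(2) show ?thesis
    proof eventually_elim
      case (elim \<omega>)
      have "eventually (\<lambda>z. ln (ln z) - (ln c + ln (1 + \<epsilon> / 2)) \<le> (1 - s) * ln z) at_top" using s by real_asymp
      then have "eventually (\<lambda>n. ln (ln (x n)) - (ln c + ln (1 + \<epsilon> / 2)) \<le> (1 - s) * ln (x n)) sequentially"
        using x_top by (rule eventually_compose_filterlim)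
      moreover have "eventually (\<lambda>n. L n \<ge> 2 / \<epsilon>) sequentially" using L_top by (simp add: filterlim_at_top)
      moreover have "eventually (\<lambda>n. L n \<ge> 1) sequentially" using L_top by (simp add: filterlim_at_top)
      moreover have "eventually (\<lambda>n. x n > 1) sequentially" using x_top by (simp add: filterlim_at_top_dense)
      ultimately show ?case using elim y_pos eventually_gt_at_top[of 1]
      proof eventually_elim
        case (elim n)
        define l0 where "l0 = (1 + \<epsilon> / 2) * L n"
        have l0: "l0 \<ge> 1" using elim(3) \<epsilon> mult_mono[of 1 "1 + \<epsilon> / 2" 1 "L n"] by (simp add: l0_def)
        have lx: "ln (x n) > 0" using elim(4) by simp
        show ?case
        proof (rule ccontr)
          assume "\<not> real (cl n \<omega>) \<le> (1 + \<epsilon>) * L n"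
          then have big: "(1 + \<epsilon>) * L n < real (cl n \<omega>)" by simp
          \<comment> \<open>The other half of \<open>\<epsilon>\<close> pays for the shift from
            \<open>cl n \<omega>\<close> to \<open>l = cl n \<omega> - 1\<close>.\<close>
          have "1 \<le> \<epsilon> / 2 * L n" using elim(2) \<epsilon> by (simp add: field_simps)
          then have "l0 + 1 \<le> (1 + \<epsilon>) * L n" unfolding l0_def by (simp add: algebra_simps)
          then have ge2: "l0 + 1 < real (cl n \<omega>)" using big by linarith
          define l where "l = cl n \<omega> - 1"
          have l: "l0 < real l" "1 \<le> l" "l + 1 \<le> cl n \<omega>" using ge2 l0 by (auto simp: l_def of_nat_diff)
          have "c * l0 * real n powr (- (1 + \<delta>) / l0) \<le> c * real l * real n powr (- (1 + \<delta>) / real l)"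
          proof (intro mult_mono powr_mono)
            show "- (1 + \<delta>) / l0 \<le> - (1 + \<delta>) / real l"
              unfolding minus_divide_left[symmetric] using l l0 \<delta> by (intro le_imp_neg_le divide_left_mono) auto
          qed (use c l l0 elim(7) in auto)
          also have "\<dots> < y n" using elim(5) l unfolding y_def by blast
          finally have "c * l0 * real n powr (- (1 + \<delta>) / l0) < y n" .
          then have "ln (c * l0 * real n powr (- (1 + \<delta>) / l0)) < ln (y n)"
            using c l0 elim(6,7) by (subst ln_less_cancel_iff) auto
          moreover have "ln (c * l0 * real n powr (- (1 + \<delta>) / l0)) = ln c + ln l0 - (1 + \<delta>) / l0 * ln (real n)"
            unfolding minus_divide_left[symmetric] using c(1) l0 elim(7) by (simp add: ln_mult ln_powr)
          moreover have "ln l0 = ln (1 + \<epsilon> / 2) + ln (L n)" unfolding l0_def using \<epsilon> elim(3) by (simp add: ln_mult)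
          moreover have "ln (L n) = ln (ln (real n)) - ln (ln (x n))" unfolding L_def using lx elim(7) by (simp add: ln_div)
          moreover have "(1 + \<delta>) / l0 * ln (real n) = s * ln (x n)"
          proof -
            have "ln (real n) = L n * ln (x n)" unfolding L_def using lx by simp
            then show ?thesis using elim(3) unfolding l0_def s_def by simp
          qed
          moreover have "ln (x n) = ln (ln (real n)) - ln (y n)" using elim(6,7) by (simp add: x_def ln_div)
          ultimately have "ln (x n) - s * ln (x n) < ln (ln (x n)) - (ln c + ln (1 + \<epsilon> / 2))" by linarith
          then show False using elim(1) by (simp add: left_diff_distrib)
        qed
      qed
    qed
  qed
  obtain c2 c3 c4 \<kappa> where cc: "c2 > 0" "c3 > 0" "c4 > 0" "\<kappa> > 0"
    "eventually (\<lambda>n. \<forall>k. 1 \<le> k \<longrightarrow> 4 * k \<le> n \<longrightarrow>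
       (\<exists>E\<in>events. {\<omega>\<in>space M. cl n \<omega> < k} \<subseteq> E \<and> prob E \<le> exp (- \<kappa> * real n) +
          exp (- (c4 * (real n / (real n * r n ^ DIM('a))) * (c2 * (real n * r n ^ DIM('a)) / real k) ^ k * exp (- c3 * (real n * r n ^ DIM('a))))))) sequentially"
    using prob_clique_number_less_sparse by blast
  have lower: "AE \<omega> in M. eventually (\<lambda>n. (1 - \<epsilon>) * L n \<le> real (cl n \<omega>)) sequentially" if \<epsilon>: "0 < \<epsilon>" "\<epsilon> < 1" for \<epsilon>
  proof -
    define k where "k n = nat \<lceil>(1 - \<epsilon>) * L n\<rceil>" for n
    have "AE \<omega> in M. eventually (\<lambda>n. k n \<le> cl n \<omega>) sequentially"
    proof (rule AE_clique_number_ge[OF cc(4), of _ "\<lambda>n. real n powr (\<epsilon> / 8)"])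
      show "eventually (\<lambda>n. 2 * ln (real n) \<le> real n powr (\<epsilon> / 8)) sequentially" using \<epsilon> by real_asymp
      have "eventually (\<lambda>n. L n \<ge> 2 / \<epsilon>) sequentially" using L_top by (simp add: filterlim_at_top)
      moreover have "eventually (\<lambda>n. L n \<ge> 1) sequentially" using L_top by (simp add: filterlim_at_top)
      \<comment> \<open>From \<open>ln (x n) > 1\<close> follows \<open>L n \<le> ln n\<close>,
        needed for \<open>4 * k \<le> n\<close>; from \<open>ln (x n) > 1 / c2\<close> follows that
        \<open>x n / (c2 * ln (x n))\<close> is at most \<open>x n\<close>.\<close>
      moreover have "eventually (\<lambda>n. x n > exp (max 1 (1 / c2))) sequentially" using x_top by (simp add: filterlim_at_top_dense)
      moreover have "eventually (\<lambda>n. y n \<le> \<epsilon> / (8 * c3) * ln (real n)) sequentially" using \<epsilon> cc by (intro y_small) simp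
      moreover have "eventually (\<lambda>n. y n \<le> 1 * ln (real n)) sequentially" by (intro y_small) simp
      \<comment> \<open>The choice of \<open>k\<close> leaves \<open>\<epsilon> / 2 * ln n\<close>
        in the exponent; the term \<open>c3 * y n\<close> takes \<open>\<epsilon> / 8\<close> of
        \<open>ln n\<close>, which leaves \<open>3 * \<epsilon> / 8\<close>.\<close>
      moreover have "eventually (\<lambda>n. \<epsilon> / 8 * ln (real n) \<le> ln c4 + 3 * \<epsilon> / 8 * ln (real n) - ln (ln (real n))) sequentially"
        using \<epsilon> by real_asymp
      moreover have "eventually (\<lambda>n. 4 * (ln (real n) + 1) \<le> real n) sequentially" by real_asymp
      ultimately show "eventually (\<lambda>n. \<exists>E\<in>events. {\<omega>\<in>space M. cl n \<omega> < k n} \<subseteq> E \<and>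
          prob E \<le> exp (- \<kappa> * real n) + exp (- (real n powr (\<epsilon> / 8)))) sequentially"
        using cc(5) y_pos eventually_gt_at_top[of 1]
      proof eventually_elim
        case (elim n)
        have ln0: "ln (real n) > 0" using elim(10) by simp
        have x0: "x n > 0" using elim(3) by (meson exp_gt_zero less_trans)
        have lx: "ln (x n) > max 1 (1 / c2)" using elim(3) x0 by (metis exp_less_cancel_iff exp_ln)
        then have lx1: "ln (x n) > 1" "ln (x n) > 1 / c2" by auto
        have L: "L n * ln (x n) = ln (real n)" unfolding L_def using lx1 by simp
        have pos: "0 < (1 - \<epsilon>) * L n" using \<epsilon> elim(2) by simp
        then have k1: "1 \<le> k n" unfolding k_def by linarith
        have kup: "real (k n) \<le> (1 - \<epsilon>) * L n + 1" unfolding k_def using pos by linarith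
        also have "\<dots> \<le> (1 - \<epsilon> / 2) * L n"
        proof -
          have "1 \<le> \<epsilon> / 2 * L n" using elim(1) \<epsilon> by (simp add: field_simps)
          then show ?thesis by (simp add: algebra_simps)
        qed
        finally have kL: "real (k n) \<le> (1 - \<epsilon> / 2) * L n" .
        have kL': "real (k n) \<le> L n"
        proof -
          have "(1 - \<epsilon> / 2) * L n \<le> 1 * L n" using \<epsilon> elim(2) by (intro mult_right_mono) auto
          then show ?thesis using kL by simp
        qed
        have "L n \<le> ln (real n)" unfolding L_def using ln0 lx1 by (simp add: divide_le_eq)
        then have "real (4 * k n) \<le> real n" using kL' elim(7) by simp
        then have "4 * k n \<le> n" by linarith
        then obtain E where E: "E \<in> events" "{\<omega>\<in>space M. cl n \<omega> < k n} \<subseteq> E"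
          "prob E \<le> exp (- \<kappa> * real n) + exp (- (c4 * (real n / y n) * (c2 * y n / real (k n)) ^ k n * exp (- c3 * y n)))"
          using elim(8) k1 unfolding y_def by meson
        have "real n powr (\<epsilon> / 8) \<le> c4 * (real n / y n) * (c2 * y n / real (k n)) ^ k n * exp (- c3 * y n)"
        proof -
          have e1: "c4 * (real n / y n) * (c2 * y n / real (k n)) ^ k n * exp (- c3 * y n) =
             exp (ln c4 + (ln (real n) - ln (y n)) + real (k n) * ln (c2 * y n / real (k n)) - c3 * y n)"
          proof -
            have "exp (real (k n) * ln (c2 * y n / real (k n))) = (c2 * y n / real (k n)) ^ k n"
              using cc(1) elim(9) k1 by (simp add: exp_of_nat_mult)
            then show ?thesis using cc(3) elim(9,10) by (simp add: exp_add exp_diff exp_minus divide_inverse)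
          qed
          have "real (k n) * ln (real (k n) / (c2 * y n)) \<le> (1 - \<epsilon> / 2) * ln (real n)"
          proof -
            have "real (k n) / (c2 * y n) \<le> L n / (c2 * y n)" using kL' cc(1) elim(9) by (intro divide_right_mono) auto
            also have "\<dots> = x n / (c2 * ln (x n))" unfolding L_def x_def by simp
            also have "\<dots> \<le> x n"
            proof -
              have "1 \<le> c2 * ln (x n)" using lx1(2) cc(1) by (simp add: field_simps)
              then show ?thesis using x0 by (simp add: divide_le_eq)
            qed
            finally have "ln (real (k n) / (c2 * y n)) \<le> ln (x n)"
              using k1 cc(1) elim(9) x0 by (subst ln_le_cancel_iff) auto
            then have "real (k n) * ln (real (k n) / (c2 * y n)) \<le> real (k n) * ln (x n)" by (intro mult_left_mono) auto
            also have "\<dots> \<le> (1 - \<epsilon> / 2) * L n * ln (x n)" using kL lx1 by (intro mult_right_mono) auto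
            finally show ?thesis using L by (simp add: mult.assoc)
          qed
          moreover have "ln (c2 * y n / real (k n)) = - ln (real (k n) / (c2 * y n))"
            using cc(1) elim(9) k1 by (simp add: ln_div)
          moreover have "ln (y n) \<le> ln (ln (real n))" using elim(5,9) ln0 by simp
          moreover have "c3 * y n \<le> \<epsilon> / 8 * ln (real n)"
          proof -
            have "c3 * y n \<le> c3 * (\<epsilon> / (8 * c3) * ln (real n))" using elim(4) cc(2) by (intro mult_left_mono) auto
            also have "\<dots> = \<epsilon> / 8 * ln (real n)" using cc(2) by simp
            finally show ?thesis .
          qed
          ultimately have "\<epsilon> / 8 * ln (real n) \<le> ln c4 + (ln (real n) - ln (y n)) + real (k n) * ln (c2 * y n / real (k n)) - c3 * y n"
            using elim(6) by (simp add: algebra_simps)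
          then show ?thesis unfolding e1 using elim(10) by (simp add: powr_def)
        qed
        then have "exp (- (c4 * (real n / y n) * (c2 * y n / real (k n)) ^ k n * exp (- c3 * y n))) \<le> exp (- (real n powr (\<epsilon> / 8)))" by simp
        then show ?case using E(1,2) order_trans[OF E(3) add_left_mono] by blast
      qed
    qed
    then show ?thesis
    proof eventually_elim
      case (elim \<omega>)
      then show ?case
      proof eventually_elim
        case (elim n)
        have "(1 - \<epsilon>) * L n \<le> real (k n)" unfolding k_def by (rule of_nat_ceiling)
        then show ?case using elim by linarith
      qed
    qed
  qed
  have L_pos: "eventually (\<lambda>n. L n > 0) sequentially" using L_top by (simp add: filterlim_at_top_dense)
  have "AE \<omega> in M. (\<lambda>n. real (cl n \<omega>) / L n) \<longlonglongrightarrow> 1"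
  proof (rule AE_tendstoI[of 1])
    fix e :: real assume e: "0 < e" "e < 1"
    from upper[OF e(1)] lower[OF e]
    show "AE \<omega> in M. eventually (\<lambda>n. 1 - e \<le> real (cl n \<omega>) / L n \<and> real (cl n \<omega>) / L n \<le> 1 + e) sequentially"
    proof eventually_elim
      case (elim \<omega>)
      from elim L_pos show ?case
        by eventually_elim (simp add: pos_le_divide_eq pos_divide_le_eq)
    qed
  qed simp
  then show ?thesis by (simp add: L_def x_def y_def)
qed

lemma AE_ratio_tendsto:
  assumes e0: "e0 > 0"
    and "\<And>g. G < g \<Longrightarrow> AE \<omega> in M. eventually (\<lambda>n. real (cl n \<omega>) \<le> g * (\<sigma> * real n * r n ^ DIM('a))) sequentially"
    and "\<And>g. G - e0 < g \<Longrightarrow> g < G \<Longrightarrow> AE \<omega> in M. eventually (\<lambda>n. g * (\<sigma> * real n * r n ^ DIM('a)) \<le> real (cl n \<omega>)) sequentially"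
  shows "AE \<omega> in M. (\<lambda>n. real (cl n \<omega>) / (\<sigma> * real n * r n ^ DIM('a))) \<longlonglongrightarrow> G"
proof (rule AE_tendstoI[OF e0])
  fix e :: real assume e: "0 < e" "e < e0"
  have "AE \<omega> in M. eventually (\<lambda>n. real (cl n \<omega>) \<le> (G + e) * (\<sigma> * real n * r n ^ DIM('a))) sequentially"
    using e by (intro assms) auto
  moreover have "AE \<omega> in M. eventually (\<lambda>n. (G - e) * (\<sigma> * real n * r n ^ DIM('a)) \<le> real (cl n \<omega>)) sequentially"
    using e by (intro assms) auto
  ultimately show "AE \<omega> in M. eventually (\<lambda>n. G - e \<le> real (cl n \<omega>) / (\<sigma> * real n * r n ^ DIM('a)) \<and>
      real (cl n \<omega>) / (\<sigma> * real n * r n ^ DIM('a)) \<le> G + e) sequentially"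
  proof eventually_elim
    case (elim \<omega>)
    from elim eventually_gt_at_top[of 0] show ?case
    proof eventually_elim
      case (elim n)
      have "0 < \<sigma> * real n * r n ^ DIM('a)" using \<sigma>_pos r_pos[of n] elim(3) by simp
      then show ?case using elim(1,2) by (simp add: pos_le_divide_eq pos_divide_le_eq)
    qed
  qed
qed

text \<open>At \<open>x = g / v\<close>, which maximises \<open>g * ln x - v * (x - 1)\<close>, the
  upper rate becomes \<open>t * v * Hfun (g / v)\<close>. The lower bound has the same rate, and
  \<open>f_omega\<close> is the level at which it equals 1.\<close>

lemma clique_number_critical:
  assumes t: "t > 0" and lim: "(\<lambda>n. \<sigma> * real n * r n ^ DIM('a) / ln (real n)) \<longlonglongrightarrow> t"
  shows "AE \<omega> in M. (\<lambda>n. real (cl n \<omega>) / (\<sigma> * real n * r n ^ DIM('a))) \<longlonglongrightarrow> f_omega volB DIM('a) t"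
proof -
  define v where "v = volB / 2 ^ DIM('a)"
  have v: "v > 0" using volB_pos by (simp add: v_def)
  have fv: "v < f_omega volB DIM('a) t" unfolding v_def by (rule f_omega_gt[OF volB_pos t])
  have H: "t * (g * ln (g / v) - v * (g / v - 1)) = Hfun (g * 2 ^ DIM('a) / volB) / (2 ^ DIM('a) / (t * volB))" for g
    using v t volB_pos by (simp add: Hfun_def v_def field_simps)
  have s: "2 ^ DIM('a) / (t * volB) > 0" using t volB_pos by simp
  show ?thesis
  \<comment> \<open>The window keeps the lower levels \<open>g\<close> above \<open>v\<close>, where
    the comparison with \<open>f_omega\<close> is valid.\<close>
  proof (rule AE_ratio_tendsto[of "f_omega volB DIM('a) t - v"])
    fix g assume g: "f_omega volB DIM('a) t < g"
    then have "2 ^ DIM('a) / (t * volB) < Hfun (g * 2 ^ DIM('a) / volB)"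
      using f_omega_compare(2)[OF volB_pos t, of "DIM('a)" g] fv unfolding v_def by simp
    then have "1 < t * (g * ln (g / v) - v * (g / v - 1))" unfolding H less_divide_eq_1_pos[OF s] .
    then show "AE \<omega> in M. eventually (\<lambda>n. real (cl n \<omega>) \<le> g * (\<sigma> * real n * r n ^ DIM('a))) sequentially"
      using g fv v by (intro clique_number_upper_critical[OF lim t, of g "g / v", folded v_def]) auto
  next
    fix g assume g: "f_omega volB DIM('a) t - (f_omega volB DIM('a) t - v) < g" "g < f_omega volB DIM('a) t"
    then have "Hfun (g * 2 ^ DIM('a) / volB) < 2 ^ DIM('a) / (t * volB)"
      using f_omega_compare(1)[OF volB_pos t, of "DIM('a)" g] unfolding v_def by simp
    then have "t * (g * ln (g / v) - v * (g / v - 1)) < 1" unfolding H divide_less_eq_1_pos[OF s] .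
    moreover have "v * (g / v - 1) = g - v" using v by (simp add: field_simps)
    ultimately have "t * (g * ln (g / v) - g + v) < 1" by (simp add: algebra_simps)
    then show "AE \<omega> in M. eventually (\<lambda>n. g * (\<sigma> * real n * r n ^ DIM('a)) \<le> real (cl n \<omega>)) sequentially"
      using g v by (intro clique_number_lower_critical[OF lim t, of g, folded v_def]) auto
  qed (use fv in simp)
qed

text \<open>Again \<open>x = g / v\<close> is optimal and the rate is
  \<open>v * Hfun (g / v)\<close>. It is positive for every \<open>g\<close> other than
  \<open>v\<close>, and positivity alone is enough in this regime.\<close>

lemma clique_number_dense:
  assumes lno: "(\<lambda>n. ln (real n)) \<in> o(\<lambda>n. real n * r n ^ DIM('a))"
  shows "AE \<omega> in M. (\<lambda>n. real (cl n \<omega>) / (\<sigma> * real n * r n ^ DIM('a))) \<longlonglongrightarrow> volB / 2 ^ DIM('a)"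
proof -
  define v where "v = volB / 2 ^ DIM('a)"
  have v: "v > 0" using volB_pos by (simp add: v_def)
  have H: "g * ln (g / v) - v * (g / v - 1) = v * Hfun (g / v)" for g
    using v by (simp add: Hfun_def algebra_simps)
  have pos: "g * ln (g / v) - v * (g / v - 1) > 0" if "0 < g" "g \<noteq> v" for g
    unfolding H using that v by (intro mult_pos_pos Hfun_pos) auto
  have "AE \<omega> in M. (\<lambda>n. real (cl n \<omega>) / (\<sigma> * real n * r n ^ DIM('a))) \<longlonglongrightarrow> v"
  \<comment> \<open>A window of width \<open>v\<close> keeps the lower levels positive, so that
    \<open>g / v\<close> is an admissible Chernoff parameter.\<close>
  proof (rule AE_ratio_tendsto[OF v])
    fix g assume g: "v < g"
    then show "AE \<omega> in M. eventually (\<lambda>n. real (cl n \<omega>) \<le> g * (\<sigma> * real n * r n ^ DIM('a))) sequentially"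
      using pos[of g] v by (intro clique_number_upper_dense[OF lno, of g "g / v", folded v_def]) auto
  next
    fix g assume g: "v - v < g" "g < v"
    moreover have "- (v * (g / v - 1)) = v * (1 - g / v)" by (simp add: algebra_simps)
    ultimately show "AE \<omega> in M. eventually (\<lambda>n. g * (\<sigma> * real n * r n ^ DIM('a)) \<le> real (cl n \<omega>)) sequentially"
      using pos[of g] v by (intro clique_number_lower_dense[OF lno, of g "g / v", folded v_def]) auto
  qed
  then show ?thesis by (simp add: v_def)
qed

end

theorem theorem1p2:
  fixes N :: "'a::euclidean_space \<Rightarrow> real"
    and M :: "'w measure"
    and f :: "'a \<Rightarrow> real"
    and X :: "nat \<Rightarrow> 'w \<Rightarrow> 'a"
    and r :: "nat \<Rightarrow> real"
  defines "d \<equiv> DIM('a)"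
    and "vB \<equiv> measure lborel {x. N x < 1}"
    and "\<sigma> \<equiv> ess_sup_dens f"
    and "cl \<equiv> (\<lambda>n \<omega>. geom_clique_number N (r n) (\<lambda>i. X i \<omega>) n)"
  assumes N: "is_norm N"
    and M: "prob_space M"
    and f_meas: "f \<in> borel_measurable lborel"
    and f_nonneg: "\<And>x. f x \<ge> 0"
    and f_bdd: "\<exists>C. \<forall>x. f x \<le> C"
    and X_distr: "\<And>i. distributed M lborel (X i) (\<lambda>x. ennreal (f x))"
    and X_indep: "prob_space.indep_vars M (\<lambda>_. borel) X UNIV"
    and r_pos: "\<And>n. r n > 0"
    and r_lim: "r \<longlonglongrightarrow> 0"
  shows
    "((\<exists>\<alpha>>0. eventually (\<lambda>n. real n * r n ^ d \<le> real n powr (- \<alpha>)) sequentially) \<longrightarrow>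
        (AE \<omega> in M. eventually (\<lambda>n.
           int (cl n \<omega>) \<in> {\<lfloor>ln (real n) / ln (1 / (real n * r n ^ d)) + 1/2\<rfloor>,
                             \<lfloor>ln (real n) / ln (1 / (real n * r n ^ d)) + 1/2\<rfloor> + 1}) sequentially))
     \<and>
     (((\<forall>\<epsilon>>0. (\<lambda>n. real n powr (- \<epsilon>)) \<in> o(\<lambda>n. real n * r n ^ d)) \<and>
       (\<lambda>n. real n * r n ^ d) \<in> o(\<lambda>n. ln (real n))) \<longrightarrow>
        (AE \<omega> in M. (\<lambda>n. real (cl n \<omega>) /
             (ln (real n) / ln (ln (real n) / (real n * r n ^ d)))) \<longlonglongrightarrow> 1))
     \<and>
     (\<forall>t>0. ((\<lambda>n. \<sigma> * real n * r n ^ d / ln (real n)) \<longlonglongrightarrow> t) \<longrightarrow>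
        (AE \<omega> in M. (\<lambda>n. real (cl n \<omega>) / (\<sigma> * real n * r n ^ d)) \<longlonglongrightarrow> f_omega vB d t))
     \<and>
     (\<forall>t>0. \<exists>!g. g \<ge> vB / 2 ^ d \<and> Hfun (g * 2 ^ d / vB) = 2 ^ d / (t * vB))
     \<and> continuous_on {0<..} (f_omega vB d)
     \<and> (\<forall>s t. 0 < s \<longrightarrow> s < t \<longrightarrow> f_omega vB d t < f_omega vB d s)
     \<and> (f_omega vB d \<longlongrightarrow> vB / 2 ^ d) at_top
     \<and> filterlim (f_omega vB d) at_top (at_right 0)
     \<and>
     ((\<lambda>n. ln (real n)) \<in> o(\<lambda>n. real n * r n ^ d) \<longrightarrow>
        (AE \<omega> in M. (\<lambda>n. real (cl n \<omega>) / (\<sigma> * real n * r n ^ d)) \<longlonglongrightarrow> vB / 2 ^ d))"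
proof -
  interpret D: prob_space M by (rule M)
  have X_meas: "X i \<in> measurable M borel" for i
    using distributed_measurable[OF X_distr[of i]] by simp
  have law: "distr M lborel (X i) = density lborel (\<lambda>x. ennreal (f x))" for i
    by (rule distributed_distr_eq_density[OF X_distr])
  \<comment> \<open>The total mass of \<open>f\<close> is read off from the law of
    \<open>X 0\<close>.\<close>
  have f_int: "(\<integral>\<^sup>+x. ennreal (f x) \<partial>lborel) = 1"
  proof -
    have "(\<integral>\<^sup>+x. ennreal (f x) \<partial>lborel) = emeasure (density lborel (\<lambda>x. ennreal (f x))) UNIV"
      using f_meas by (subst emeasure_density) auto
    also have "\<dots> = emeasure M (space M)"
      unfolding law[of 0, symmetric] using X_meas[of 0] by (subst emeasure_distr) auto
    finally show ?thesis by (simp add: D.emeasure_space_1)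
  qed
  interpret B: bounded_density N f
    using N f_meas f_nonneg f_bdd f_int by unfold_locales auto
  interpret G: random_geometric_graph N f M X r
  proof unfold_locales
    fix i and A :: "'a set" assume A: "A \<in> sets borel"
    have "D.prob {\<omega>\<in>space M. X i \<omega> \<in> A} = measure (distr M lborel (X i)) A"
      using A X_meas[of i] by (subst measure_distr) (auto intro!: arg_cong[where f = "measure M"])
    then show "D.prob {\<omega>\<in>space M. X i \<omega> \<in> A} = B.\<nu> A" by (simp add: law B.\<nu>_def)
  qed (use X_meas X_indep r_pos r_lim in auto)
  have [simp]: "G.cl = cl" "B.volB = vB" "B.\<sigma> = \<sigma>"
    by (simp_all add: G.cl_def[abs_def] cl_def B.volB_def vB_def B.\<sigma>_def \<sigma>_def)
  have vB_pos: "vB > 0" using B.volB_pos by simp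
  show ?thesis
  proof (intro conjI impI allI)
    assume "\<exists>\<alpha>>0. eventually (\<lambda>n. real n * r n ^ d \<le> real n powr (- \<alpha>)) sequentially"
    then show "AE \<omega> in M. eventually (\<lambda>n.
           int (cl n \<omega>) \<in> {\<lfloor>ln (real n) / ln (1 / (real n * r n ^ d)) + 1/2\<rfloor>,
                             \<lfloor>ln (real n) / ln (1 / (real n * r n ^ d)) + 1/2\<rfloor> + 1}) sequentially"
      using G.clique_number_very_sparse unfolding d_def \<open>G.cl = cl\<close> by blast
  next
    assume "(\<forall>\<epsilon>>0. (\<lambda>n. real n powr (- \<epsilon>)) \<in> o(\<lambda>n. real n * r n ^ d)) \<and>
       (\<lambda>n. real n * r n ^ d) \<in> o(\<lambda>n. ln (real n))"
    then show "AE \<omega> in M. (\<lambda>n. real (cl n \<omega>) /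
             (ln (real n) / ln (ln (real n) / (real n * r n ^ d)))) \<longlonglongrightarrow> 1"
      using G.clique_number_sparse unfolding d_def \<open>G.cl = cl\<close> by blast
  next
    fix t :: real assume "t > 0" "(\<lambda>n. \<sigma> * real n * r n ^ d / ln (real n)) \<longlonglongrightarrow> t"
    then show "AE \<omega> in M. (\<lambda>n. real (cl n \<omega>) / (\<sigma> * real n * r n ^ d)) \<longlonglongrightarrow> f_omega vB d t"
      using G.clique_number_critical[of t] by (simp add: d_def)
  next
    fix t :: real assume "t > 0"
    then show "\<exists>!g. g \<ge> vB / 2 ^ d \<and> Hfun (g * 2 ^ d / vB) = 2 ^ d / (t * vB)"
      by (rule f_omega_ex1[OF vB_pos])
  next
    show "continuous_on {0<..} (f_omega vB d)" by (rule continuous_on_f_omega[OF vB_pos])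
    show "f_omega vB d t < f_omega vB d s" if "0 < s" "s < t" for s t
      using that by (rule f_omega_strict_decreasing[OF vB_pos])
    show "(f_omega vB d \<longlongrightarrow> vB / 2 ^ d) at_top" by (rule f_omega_at_top[OF vB_pos])
    show "filterlim (f_omega vB d) at_top (at_right 0)" by (rule f_omega_at_right_0[OF vB_pos])
  next
    assume "(\<lambda>n. ln (real n)) \<in> o(\<lambda>n. real n * r n ^ d)"
    then show "AE \<omega> in M. (\<lambda>n. real (cl n \<omega>) / (\<sigma> * real n * r n ^ d)) \<longlonglongrightarrow> vB / 2 ^ d"
      using G.clique_number_dense by (simp add: d_def)
  qed
qed

end
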